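(* Let $\mathcal{E}$ be a Frobenius category with triangulated quotient $\mathcal{T}$, and let $\mathcal{R}$ be a class of objects in $\mathcal{E}$ such that: (i) $\mathcal{R}$ is a precovering class in $\mathcal{E}$, and every $\mathcal{R}$-precover in $\mathcal{E}$ has a kernel in $\mathcal{E}$; (ii) $\mathcal{R}$ is closed under shifts in $\mathcal{T}$; (iii) for all $R$ in $\mathcal{R}$ the injective hull $I(R)$ is in $\mathcal{R}$. Suppose that every object in $\mathcal{T}$ has finite $\mathcal{R}$-dimension. Let $\mathcal{S}$ be the smallest full localizing subcategory of $\mathcal{T}$ that contains $\mathcal{R}$. Then the inclusion functor $i:\mathcal{S}\to\mathcal{T}$ has a right adjoint $i^!$.
   Context: A Frobenius category is an exact category $\mathcal{E}$ with enough projectives and enough injectives in which the projective and injective objects coincide; $\mathcal{P}$ denotes the class of these objects and $\mathcal{T}=\mathcal{E}/\mathcal{P}$ the (stable) quotient category, which has the same objects as $\mathcal{E}$ and is triangulated. Each object $R$ comes with a conflation $R\to I(R)\to R[1]$ with $I(R)$ injective (the "injective hull"), and this gives the shift $R[1]$ in $\mathcal{T}$. Precovers: a class $\mathcal{R}$ of objects of $\mathcal{E}$ is precovering (contravariantly finite) if for each object $X$ of $\mathcal{E}$ there is a (not necessarily unique) morphism $R_X\to X$ in $\mathcal{E}$ with $R_X\in\mathcal{R}$, called a precover, such that every morphism in $\mathcal{E}$ from an object of $\mathcal{R}$ to $X$ factors in $\mathcal{E}$ through $R_X\to X$. Resolutions and dimension: an $\mathcal{R}$-resolution of $X$ is obtained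 by setting $K_0=X$ and, inductively, choosing a precover $R_i\to K_i$ with kernel $K_{i+1}\to R_i$ in $\mathcal{E}$ (the sequences $K_{i+1}\to R_i\to K_i$ are not required to be conflations). If $K_d\in\mathcal{R}$ for some $d$, then $X$ has finite $\mathcal{R}$-dimension. A localizing subcategory is a triangulated subcategory closed under direct sums (arbitrary coproducts). *)

theory Defs
  imports "HOL-Algebra.Group"
begin

section \<open>Categories, functors and adjunctions\<close>

text \<open>
  Hom-sets of distinct pairs of objects are disjoint, so that an arrow determines its domain and
  codomain; composition is only meaningful on composable arrows, and \<open>g \<cdot> f\<close> is \<open>g\<close> after \<open>f\<close>.
  Nothing is assumed about \<open>Hom A B\<close> unless \<open>A\<close> and \<open>B\<close> are objects.
\<close>

record ('o, 'm) cat =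
  Obj :: "'o set"
  Hom :: "'o \<Rightarrow> 'o \<Rightarrow> 'm set"
  Ident :: "'o \<Rightarrow> 'm"
  Comp :: "'m \<Rightarrow> 'm \<Rightarrow> 'm"  (infixr \<open>\<cdot>\<index>\<close> 70)

locale category =
  fixes C :: "('o, 'm, 'z) cat_scheme" (structure)
  assumes Hom_disjoint:
      "\<lbrakk>A \<in> Obj C; B \<in> Obj C; A' \<in> Obj C; B' \<in> Obj C; f \<in> Hom C A B; f \<in> Hom C A' B'\<rbrakk>
        \<Longrightarrow> A = A' \<and> B = B'"
    and Ident_in_Hom: "A \<in> Obj C \<Longrightarrow> Ident C A \<in> Hom C A A"
    and Comp_in_Hom:
      "\<lbrakk>A \<in> Obj C; B \<in> Obj C; D \<in> Obj C; f \<in> Hom C A B; g \<in> Hom C B D\<rbrakk> \<Longrightarrow> g \<cdot> f \<in> Hom C A D"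
    and Comp_Ident_right: "\<lbrakk>A \<in> Obj C; B \<in> Obj C; f \<in> Hom C A B\<rbrakk> \<Longrightarrow> f \<cdot> Ident C A = f"
    and Comp_Ident_left: "\<lbrakk>A \<in> Obj C; B \<in> Obj C; f \<in> Hom C A B\<rbrakk> \<Longrightarrow> Ident C B \<cdot> f = f"
    and Comp_assoc:
      "\<lbrakk>A \<in> Obj C; B \<in> Obj C; D \<in> Obj C; K \<in> Obj C;
        f \<in> Hom C A B; g \<in> Hom C B D; h \<in> Hom C D K\<rbrakk> \<Longrightarrow> (h \<cdot> g) \<cdot> f = h \<cdot> (g \<cdot> f)"

definition is_iso :: "('o, 'm, 'z) cat_scheme \<Rightarrow> 'o \<Rightarrow> 'o \<Rightarrow> 'm \<Rightarrow> bool" where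
  "is_iso C A B f \<longleftrightarrow> f \<in> Hom C A B \<and>
     (\<exists>g\<in>Hom C B A. g \<cdot>\<^bsub>C\<^esub> f = Ident C A \<and> f \<cdot>\<^bsub>C\<^esub> g = Ident C B)"

definition isomorphic :: "('o, 'm, 'z) cat_scheme \<Rightarrow> 'o \<Rightarrow> 'o \<Rightarrow> bool" where
  "isomorphic C A B \<longleftrightarrow> (\<exists>f. is_iso C A B f)"

definition is_zero_object :: "('o, 'm, 'z) cat_scheme \<Rightarrow> 'o \<Rightarrow> bool" where
  "is_zero_object C Z \<longleftrightarrow> Z \<in> Obj C \<and>
     (\<forall>A\<in>Obj C. (\<exists>!f. f \<in> Hom C A Z) \<and> (\<exists>!f. f \<in> Hom C Z A))"

text \<open>\<open>Q\<close> with the arrows \<open>\<iota> i\<close> is a coproduct of the family \<open>X\<close> indexed by \<open>I\<close>.\<close>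

definition is_coproduct ::
    "('o, 'm, 'z) cat_scheme \<Rightarrow> 'i set \<Rightarrow> ('i \<Rightarrow> 'o) \<Rightarrow> 'o \<Rightarrow> ('i \<Rightarrow> 'm) \<Rightarrow> bool" where
  "is_coproduct C I X Q \<iota> \<longleftrightarrow> Q \<in> Obj C \<and> (\<forall>i\<in>I. X i \<in> Obj C \<and> \<iota> i \<in> Hom C (X i) Q) \<and>
     (\<forall>Y\<in>Obj C. \<forall>f. (\<forall>i\<in>I. f i \<in> Hom C (X i) Y) \<longrightarrow>
        (\<exists>!g. g \<in> Hom C Q Y \<and> (\<forall>i\<in>I. g \<cdot>\<^bsub>C\<^esub> \<iota> i = f i)))"

text \<open>The square \<open>f' \<cdot> i = i' \<cdot> f\<close> with \<open>i : A \<rightarrow> B\<close>, \<open>f : A \<rightarrow> A'\<close>, \<open>f' : B \<rightarrow> B'\<close>, \<open>i' : A' \<rightarrow> B'\<close>.\<close>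

definition is_pushout ::
    "('o, 'm, 'z) cat_scheme \<Rightarrow> 'o \<Rightarrow> 'o \<Rightarrow> 'o \<Rightarrow> 'o \<Rightarrow> 'm \<Rightarrow> 'm \<Rightarrow> 'm \<Rightarrow> 'm \<Rightarrow> bool" where
  "is_pushout C A B A' B' i f f' i' \<longleftrightarrow>
     A \<in> Obj C \<and> B \<in> Obj C \<and> A' \<in> Obj C \<and> B' \<in> Obj C \<and>
     i \<in> Hom C A B \<and> f \<in> Hom C A A' \<and> f' \<in> Hom C B B' \<and> i' \<in> Hom C A' B' \<and>
     f' \<cdot>\<^bsub>C\<^esub> i = i' \<cdot>\<^bsub>C\<^esub> f \<and>
     (\<forall>Y\<in>Obj C. \<forall>s\<in>Hom C B Y. \<forall>t\<in>Hom C A' Y. s \<cdot>\<^bsub>C\<^esub> i = t \<cdot>\<^bsub>C\<^esub> f \<longrightarrow>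
        (\<exists>!h. h \<in> Hom C B' Y \<and> h \<cdot>\<^bsub>C\<^esub> f' = s \<and> h \<cdot>\<^bsub>C\<^esub> i' = t))"

text \<open>The square \<open>p \<cdot> f' = f \<cdot> p'\<close> with \<open>p : B \<rightarrow> C\<close>, \<open>f : C' \<rightarrow> C\<close>, \<open>f' : B' \<rightarrow> B\<close>, \<open>p' : B' \<rightarrow> C'\<close>.\<close>

definition is_pullback ::
    "('o, 'm, 'z) cat_scheme \<Rightarrow> 'o \<Rightarrow> 'o \<Rightarrow> 'o \<Rightarrow> 'o \<Rightarrow> 'm \<Rightarrow> 'm \<Rightarrow> 'm \<Rightarrow> 'm \<Rightarrow> bool" where
  "is_pullback E B C B' C' p f f' p' \<longleftrightarrow>
     B \<in> Obj E \<and> C \<in> Obj E \<and> B' \<in> Obj E \<and> C' \<in> Obj E \<and>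
     p \<in> Hom E B C \<and> f \<in> Hom E C' C \<and> f' \<in> Hom E B' B \<and> p' \<in> Hom E B' C' \<and>
     p \<cdot>\<^bsub>E\<^esub> f' = f \<cdot>\<^bsub>E\<^esub> p' \<and>
     (\<forall>Y\<in>Obj E. \<forall>s\<in>Hom E Y B. \<forall>t\<in>Hom E Y C'. p \<cdot>\<^bsub>E\<^esub> s = f \<cdot>\<^bsub>E\<^esub> t \<longrightarrow>
        (\<exists>!h. h \<in> Hom E Y B' \<and> f' \<cdot>\<^bsub>E\<^esub> h = s \<and> p' \<cdot>\<^bsub>E\<^esub> h = t))"

text \<open>A functor is the pair of its object map and its arrow map.\<close>

type_synonym ('o, 'm, 'p, 'n) fctr = "('o \<Rightarrow> 'p) \<times> ('m \<Rightarrow> 'n)"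

definition is_functor ::
    "('o, 'm, 'y) cat_scheme \<Rightarrow> ('p, 'n, 'z) cat_scheme \<Rightarrow> ('o, 'm, 'p, 'n) fctr \<Rightarrow> bool" where
  "is_functor C D F \<longleftrightarrow> category C \<and> category D \<and>
     (\<forall>A\<in>Obj C. fst F A \<in> Obj D \<and> snd F (Ident C A) = Ident D (fst F A)) \<and>
     (\<forall>A\<in>Obj C. \<forall>B\<in>Obj C. \<forall>f\<in>Hom C A B. snd F f \<in> Hom D (fst F A) (fst F B)) \<and>
     (\<forall>A\<in>Obj C. \<forall>B\<in>Obj C. \<forall>K\<in>Obj C. \<forall>f\<in>Hom C A B. \<forall>g\<in>Hom C B K.
        snd F (g \<cdot>\<^bsub>C\<^esub> f) = snd F g \<cdot>\<^bsub>D\<^esub> snd F f)"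

text \<open>
  \<open>\<phi> X Y : Hom D (F X) Y \<rightarrow> Hom C X (G Y)\<close> is the natural bijection exhibiting \<open>G\<close> as right adjoint
  to \<open>F\<close>.
\<close>

definition is_adjunction ::
    "('o, 'm, 'y) cat_scheme \<Rightarrow> ('p, 'n, 'z) cat_scheme \<Rightarrow> ('o, 'm, 'p, 'n) fctr
      \<Rightarrow> ('p, 'n, 'o, 'm) fctr \<Rightarrow> ('o \<Rightarrow> 'p \<Rightarrow> 'n \<Rightarrow> 'm) \<Rightarrow> bool" where
  "is_adjunction C D F G \<phi> \<longleftrightarrow> is_functor C D F \<and> is_functor D C G \<and>
     (\<forall>X\<in>Obj C. \<forall>Y\<in>Obj D. bij_betw (\<phi> X Y) (Hom D (fst F X) Y) (Hom C X (fst G Y))) \<and>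
     (\<forall>X\<in>Obj C. \<forall>X'\<in>Obj C. \<forall>Y\<in>Obj D. \<forall>Y'\<in>Obj D.
        \<forall>a\<in>Hom C X' X. \<forall>g\<in>Hom D (fst F X) Y. \<forall>b\<in>Hom D Y Y'.
          \<phi> X' Y' (b \<cdot>\<^bsub>D\<^esub> g \<cdot>\<^bsub>D\<^esub> snd F a) = snd G b \<cdot>\<^bsub>C\<^esub> \<phi> X Y g \<cdot>\<^bsub>C\<^esub> a)"

definition has_right_adjoint ::
    "('o, 'm, 'y) cat_scheme \<Rightarrow> ('p, 'n, 'z) cat_scheme \<Rightarrow> ('o, 'm, 'p, 'n) fctr \<Rightarrow> bool" where
  "has_right_adjoint C D F \<longleftrightarrow> (\<exists>G \<phi>. is_adjunction C D F G \<phi>)"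

definition full_subcategory ::
    "('o, 'm, 'z) cat_scheme \<Rightarrow> 'o set \<Rightarrow> ('o, 'm, 'z) cat_scheme" where
  "full_subcategory C S = C\<lparr>Obj := S\<rparr>"

definition inclusion_functor :: "('o, 'm, 'o, 'm) fctr" where
  "inclusion_functor = (id, id)"

section \<open>Additive, exact and Frobenius categories\<close>

record ('o, 'm) addcat = "('o, 'm) cat" +
  Plus :: "'m \<Rightarrow> 'm \<Rightarrow> 'm"  (infixl \<open>\<boxplus>\<index>\<close> 65)
  Zero :: "'o \<Rightarrow> 'o \<Rightarrow> 'm"

definition Hom_group :: "('o, 'm, 'z) addcat_scheme \<Rightarrow> 'o \<Rightarrow> 'o \<Rightarrow> 'm monoid" where
  "Hom_group C A B = \<lparr>carrier = Hom C A B, mult = Plus C, one = Zero C A B\<rparr>"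

locale additive_category = category C
  for C :: "('o, 'm, 'z) addcat_scheme" (structure) +
  assumes Hom_comm_group: "\<lbrakk>A \<in> Obj C; B \<in> Obj C\<rbrakk> \<Longrightarrow> comm_group (Hom_group C A B)"
    and Comp_Plus_left:
      "\<lbrakk>A \<in> Obj C; B \<in> Obj C; D \<in> Obj C; f \<in> Hom C A B; g \<in> Hom C B D; h \<in> Hom C B D\<rbrakk>
        \<Longrightarrow> (g \<boxplus> h) \<cdot> f = (g \<cdot> f) \<boxplus> (h \<cdot> f)"
    and Comp_Plus_right:
      "\<lbrakk>A \<in> Obj C; B \<in> Obj C; D \<in> Obj C; f \<in> Hom C A B; g \<in> Hom C A B; h \<in> Hom C B D\<rbrakk>
        \<Longrightarrow> h \<cdot> (f \<boxplus> g) = (h \<cdot> f) \<boxplus> (h \<cdot> g)"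
    and ex_zero_object: "\<exists>Z. is_zero_object C Z"
    and ex_biproduct:
      "\<lbrakk>A \<in> Obj C; B \<in> Obj C\<rbrakk> \<Longrightarrow>
        \<exists>S\<in>Obj C. \<exists>i\<in>Hom C A S. \<exists>j\<in>Hom C B S. \<exists>p\<in>Hom C S A. \<exists>q\<in>Hom C S B.
          p \<cdot> i = Ident C A \<and> q \<cdot> j = Ident C B \<and> q \<cdot> i = Zero C A B \<and> p \<cdot> j = Zero C B A \<and>
          (i \<cdot> p) \<boxplus> (j \<cdot> q) = Ident C S"

definition is_kernel ::
    "('o, 'm, 'z) addcat_scheme \<Rightarrow> 'o \<Rightarrow> 'm \<Rightarrow> 'o \<Rightarrow> 'm \<Rightarrow> 'o \<Rightarrow> bool" where
  "is_kernel C K k A f B \<longleftrightarrow> K \<in> Obj C \<and> A \<in> Obj C \<and> B \<in> Obj C \<and>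
     k \<in> Hom C K A \<and> f \<in> Hom C A B \<and> f \<cdot>\<^bsub>C\<^esub> k = Zero C K B \<and>
     (\<forall>Y\<in>Obj C. \<forall>g\<in>Hom C Y A. f \<cdot>\<^bsub>C\<^esub> g = Zero C Y B \<longrightarrow> (\<exists>!h. h \<in> Hom C Y K \<and> k \<cdot>\<^bsub>C\<^esub> h = g))"

definition is_cokernel ::
    "('o, 'm, 'z) addcat_scheme \<Rightarrow> 'o \<Rightarrow> 'm \<Rightarrow> 'o \<Rightarrow> 'm \<Rightarrow> 'o \<Rightarrow> bool" where
  "is_cokernel C A f B c K \<longleftrightarrow> A \<in> Obj C \<and> B \<in> Obj C \<and> K \<in> Obj C \<and>
     f \<in> Hom C A B \<and> c \<in> Hom C B K \<and> c \<cdot>\<^bsub>C\<^esub> f = Zero C A K \<and>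
     (\<forall>Y\<in>Obj C. \<forall>g\<in>Hom C B Y. g \<cdot>\<^bsub>C\<^esub> f = Zero C A Y \<longrightarrow> (\<exists>!h. h \<in> Hom C K Y \<and> h \<cdot>\<^bsub>C\<^esub> c = g))"

text \<open>\<open>Conf\<close> is the class of conflations \<open>(i, p)\<close>, also called admissible short exact sequences.\<close>

record ('o, 'm) exactcat = "('o, 'm) addcat" +
  Conf :: "('m \<times> 'm) set"

definition conflation ::
    "('o, 'm, 'z) exactcat_scheme \<Rightarrow> 'o \<Rightarrow> 'm \<Rightarrow> 'o \<Rightarrow> 'm \<Rightarrow> 'o \<Rightarrow> bool" where
  "conflation E A i B p C \<longleftrightarrow> A \<in> Obj E \<and> B \<in> Obj E \<and> C \<in> Obj E \<and>
     i \<in> Hom E A B \<and> p \<in> Hom E B C \<and> (i, p) \<in> Conf E"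

definition inflation :: "('o, 'm, 'z) exactcat_scheme \<Rightarrow> 'o \<Rightarrow> 'o \<Rightarrow> 'm \<Rightarrow> bool" where
  "inflation E A B i \<longleftrightarrow> (\<exists>C p. conflation E A i B p C)"

definition deflation :: "('o, 'm, 'z) exactcat_scheme \<Rightarrow> 'o \<Rightarrow> 'o \<Rightarrow> 'm \<Rightarrow> bool" where
  "deflation E B C p \<longleftrightarrow> (\<exists>A i. conflation E A i B p C)"

text \<open>Quillen's axioms, in the self-dual form of Keller and Buehler.\<close>

locale exact_category = additive_category E
  for E :: "('o, 'm, 'z) exactcat_scheme" (structure) +
  assumes conflation_kernel: "conflation E A i B p C \<Longrightarrow> is_kernel E A i B p C"
    and conflation_cokernel: "conflation E A i B p C \<Longrightarrow> is_cokernel E A i B p C"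
    and conflation_iso:
      "\<lbrakk>conflation E A i B p C; A' \<in> Obj E; B' \<in> Obj E; C' \<in> Obj E;
        i' \<in> Hom E A' B'; p' \<in> Hom E B' C';
        is_iso E A A' a; is_iso E B B' b; is_iso E C C' c;
        b \<cdot> i = i' \<cdot> a; c \<cdot> p = p' \<cdot> b\<rbrakk> \<Longrightarrow> conflation E A' i' B' p' C'"
    and inflation_Ident: "A \<in> Obj E \<Longrightarrow> inflation E A A (Ident E A)"
    and deflation_Ident: "A \<in> Obj E \<Longrightarrow> deflation E A A (Ident E A)"
    and inflation_Comp: "\<lbrakk>inflation E A B i; inflation E B C j\<rbrakk> \<Longrightarrow> inflation E A C (j \<cdot> i)"
    and deflation_Comp: "\<lbrakk>deflation E A B p; deflation E B C q\<rbrakk> \<Longrightarrow> deflation E A C (q \<cdot> p)"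
    and inflation_pushout:
      "\<lbrakk>inflation E A B i; A' \<in> Obj E; f \<in> Hom E A A'\<rbrakk> \<Longrightarrow>
        \<exists>B' f' i'. is_pushout E A B A' B' i f f' i' \<and> inflation E A' B' i'"
    and deflation_pullback:
      "\<lbrakk>deflation E B C p; C' \<in> Obj E; f \<in> Hom E C' C\<rbrakk> \<Longrightarrow>
        \<exists>B' f' p'. is_pullback E B C B' C' p f f' p' \<and> deflation E B' C' p'"

definition is_projective :: "('o, 'm, 'z) exactcat_scheme \<Rightarrow> 'o \<Rightarrow> bool" where
  "is_projective E P \<longleftrightarrow> P \<in> Obj E \<and>
     (\<forall>B C p. deflation E B C p \<longrightarrow> (\<forall>f\<in>Hom E P C. \<exists>g\<in>Hom E P B. p \<cdot>\<^bsub>E\<^esub> g = f))"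

definition is_injective :: "('o, 'm, 'z) exactcat_scheme \<Rightarrow> 'o \<Rightarrow> bool" where
  "is_injective E J \<longleftrightarrow> J \<in> Obj E \<and>
     (\<forall>A B i. inflation E A B i \<longrightarrow> (\<forall>f\<in>Hom E A J. \<exists>g\<in>Hom E B J. g \<cdot>\<^bsub>E\<^esub> i = f))"

locale frobenius_category = exact_category E
  for E :: "('o, 'm, 'z) exactcat_scheme" (structure) +
  assumes enough_projectives: "X \<in> Obj E \<Longrightarrow> \<exists>P p. is_projective E P \<and> deflation E P X p"
    and enough_injectives: "X \<in> Obj E \<Longrightarrow> \<exists>J i. is_injective E J \<and> inflation E X J i"
    and projective_iff_injective: "is_projective E X \<longleftrightarrow> is_injective E X"

text \<open>
  A choice of a conflation \<open>X \<rightarrow> I(X) \<rightarrow> X[1]\<close> with \<open>I(X)\<close> injective for every object \<open>X\<close>. No minimality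
  of \<open>I(X)\<close> is required, although it is called an injective hull.
\<close>

record ('o, 'm) hulls =
  Inj :: "'o \<Rightarrow> 'o"
  Susp :: "'o \<Rightarrow> 'o"
  inj_arr :: "'o \<Rightarrow> 'm"
  susp_arr :: "'o \<Rightarrow> 'm"

definition injective_hulls ::
    "('o, 'm, 'z) exactcat_scheme \<Rightarrow> ('o, 'm) hulls \<Rightarrow> bool" where
  "injective_hulls E H \<longleftrightarrow>
     (\<forall>X\<in>Obj E. is_injective E (Inj H X) \<and>
        conflation E X (inj_arr H X) (Inj H X) (susp_arr H X) (Susp H X))"

section \<open>Triangles and localizing subcategories\<close>

text \<open>
  \<open>ShO\<close>, \<open>ShM\<close> are the object and arrow map of the shift functor; \<open>Tri\<close> is the class of
  distinguished triangles \<open>(u, v, w)\<close>, with \<open>u : X \<rightarrow> Y\<close>, \<open>v : Y \<rightarrow> Z\<close>, \<open>w : Z \<rightarrow> X[1]\<close>.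
\<close>

record ('o, 'm) tricat = "('o, 'm) addcat" +
  ShO :: "'o \<Rightarrow> 'o"
  ShM :: "'m \<Rightarrow> 'm"
  Tri :: "('m \<times> 'm \<times> 'm) set"

text \<open>
  Full subcategories are given by their sets of objects. Since \<open>X[-1]\<close> is only determined up to
  isomorphism, closure under \<open>[-1]\<close> is expressed through \<open>[1]\<close>; closure under the remaining cases of
  two-out-of-three for distinguished triangles follows by rotation.
\<close>

definition triangulated_subcategory :: "('o, 'm, 'z) tricat_scheme \<Rightarrow> 'o set \<Rightarrow> bool" where
  "triangulated_subcategory T S \<longleftrightarrow> S \<subseteq> Obj T \<and>
     (\<forall>Z. is_zero_object T Z \<longrightarrow> Z \<in> S) \<and>
     (\<forall>X\<in>S. \<forall>Y\<in>Obj T. isomorphic T X Y \<longrightarrow> Y \<in> S) \<and>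
     (\<forall>X\<in>Obj T. X \<in> S \<longleftrightarrow> ShO T X \<in> S) \<and>
     (\<forall>X\<in>S. \<forall>Y\<in>S. \<forall>Z\<in>Obj T. \<forall>u\<in>Hom T X Y. \<forall>v\<in>Hom T Y Z. \<forall>w\<in>Hom T Z (ShO T X).
        (u, v, w) \<in> Tri T \<longrightarrow> Z \<in> S)"

text \<open>
  Closure under all coproducts that exist in \<open>T\<close>. Index sets are sets of arrows of \<open>T\<close>, which is no
  restriction: zero summands can be dropped from a coproduct, and the injections of distinct nonzero
  summands into a coproduct are distinct arrows, so they can serve as the indices.
\<close>

definition localizing_subcategory :: "('o, 'm, 'z) tricat_scheme \<Rightarrow> 'o set \<Rightarrow> bool" where
  "localizing_subcategory T S \<longleftrightarrow> triangulated_subcategory T S \<and>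
     (\<forall>(I :: 'm set) X Q \<iota>. is_coproduct T I X Q \<iota> \<and> (\<forall>i\<in>I. X i \<in> S) \<longrightarrow> Q \<in> S)"

definition localizing_closure :: "('o, 'm, 'z) tricat_scheme \<Rightarrow> 'o set \<Rightarrow> 'o set" where
  "localizing_closure T R = \<Inter>{S. localizing_subcategory T S \<and> R \<subseteq> S}"

definition closed_under_shifts :: "('o, 'm, 'z) tricat_scheme \<Rightarrow> 'o set \<Rightarrow> bool" where
  "closed_under_shifts T R \<longleftrightarrow>
     (\<forall>X\<in>R. (\<exists>Y\<in>R. isomorphic T (ShO T X) Y) \<and> (\<exists>Y\<in>R. isomorphic T (ShO T Y) X))"

section \<open>The stable category of a Frobenius category\<close>

text \<open>Two parallel arrows are identified if they differ by one that factors through an injective.\<close>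

definition stable_rel :: "('o, 'm, 'z) exactcat_scheme \<Rightarrow> ('m \<times> 'm) set" where
  "stable_rel E = {(f, g). \<exists>A\<in>Obj E. \<exists>B\<in>Obj E. f \<in> Hom E A B \<and> g \<in> Hom E A B \<and>
     (\<exists>J. is_injective E J \<and> (\<exists>a\<in>Hom E A J. \<exists>b\<in>Hom E J B. g = f \<boxplus>\<^bsub>E\<^esub> (b \<cdot>\<^bsub>E\<^esub> a)))}"

definition stable_class :: "('o, 'm, 'z) exactcat_scheme \<Rightarrow> 'm \<Rightarrow> 'm set" where
  "stable_class E f = stable_rel E `` {f}"

text \<open>\<open>g : A[1] \<rightarrow> B[1]\<close> is induced by some extension \<open>I(A) \<rightarrow> I(B)\<close> of \<open>f : A \<rightarrow> B\<close>.\<close>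

definition susp_lift ::
    "('o, 'm, 'z) exactcat_scheme \<Rightarrow> ('o, 'm) hulls \<Rightarrow> 'o \<Rightarrow> 'o \<Rightarrow> 'm \<Rightarrow> 'm \<Rightarrow> bool" where
  "susp_lift E H A B f g \<longleftrightarrow> f \<in> Hom E A B \<and> g \<in> Hom E (Susp H A) (Susp H B) \<and>
     (\<exists>h\<in>Hom E (Inj H A) (Inj H B).
        h \<cdot>\<^bsub>E\<^esub> inj_arr H A = inj_arr H B \<cdot>\<^bsub>E\<^esub> f \<and> g \<cdot>\<^bsub>E\<^esub> susp_arr H A = susp_arr H B \<cdot>\<^bsub>E\<^esub> h)"

text \<open>
  The standard triangles are the images of \<open>(u, v, w)\<close> where \<open>(u, v)\<close> is a conflation and \<open>w\<close>
  completes a morphism of conflations from it to \<open>X \<rightarrow> I(X) \<rightarrow> X[1]\<close> that is the identity on \<open>X\<close>.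
\<close>

definition standard_triangle ::
    "('o, 'm, 'z) exactcat_scheme \<Rightarrow> ('o, 'm) hulls \<Rightarrow> 'o \<Rightarrow> 'o \<Rightarrow> 'o \<Rightarrow> 'm \<Rightarrow> 'm \<Rightarrow> 'm \<Rightarrow> bool" where
  "standard_triangle E H X Y Z u v w \<longleftrightarrow> conflation E X u Y v Z \<and> w \<in> Hom E Z (Susp H X) \<and>
     (\<exists>h\<in>Hom E Y (Inj H X). h \<cdot>\<^bsub>E\<^esub> u = inj_arr H X \<and> w \<cdot>\<^bsub>E\<^esub> v = susp_arr H X \<cdot>\<^bsub>E\<^esub> h)"

definition stable_addcat ::
    "('o, 'm, 'z) exactcat_scheme \<Rightarrow> ('o, 'm set) addcat" where
  "stable_addcat E =
    \<lparr>Obj = Obj E,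
     Hom = (\<lambda>A B. Hom E A B // stable_rel E),
     Ident = (\<lambda>A. stable_class E (Ident E A)),
     Comp = (\<lambda>G F. \<Union>g\<in>G. \<Union>f\<in>F. stable_class E (g \<cdot>\<^bsub>E\<^esub> f)),
     Plus = (\<lambda>F G. \<Union>f\<in>F. \<Union>g\<in>G. stable_class E (f \<boxplus>\<^bsub>E\<^esub> g)),
     Zero = (\<lambda>A B. stable_class E (Zero E A B))\<rparr>"

definition stable_shift ::
    "('o, 'm, 'z) exactcat_scheme \<Rightarrow> ('o, 'm) hulls \<Rightarrow> 'm set \<Rightarrow> 'm set" where
  "stable_shift E H F =
     stable_rel E `` {g. \<exists>A\<in>Obj E. \<exists>B\<in>Obj E. \<exists>f\<in>F. susp_lift E H A B f g}"

text \<open>The distinguished triangles are those isomorphic to a standard one.\<close>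

definition stable_triangles ::
    "('o, 'm, 'z) exactcat_scheme \<Rightarrow> ('o, 'm) hulls \<Rightarrow> ('m set \<times> 'm set \<times> 'm set) set" where
  "stable_triangles E H = {(U, V, W).
     \<exists>X'\<in>Obj E. \<exists>Y'\<in>Obj E. \<exists>Z'\<in>Obj E. \<exists>X Y Z u v w a b c.
       U \<in> Hom (stable_addcat E) X' Y' \<and> V \<in> Hom (stable_addcat E) Y' Z' \<and>
       W \<in> Hom (stable_addcat E) Z' (Susp H X') \<and>
       standard_triangle E H X Y Z u v w \<and>
       is_iso (stable_addcat E) X X' a \<and> is_iso (stable_addcat E) Y Y' b \<and>
       is_iso (stable_addcat E) Z Z' c \<and>
       b \<cdot>\<^bsub>stable_addcat E\<^esub> stable_class E u = U \<cdot>\<^bsub>stable_addcat E\<^esub> a \<and>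
       c \<cdot>\<^bsub>stable_addcat E\<^esub> stable_class E v = V \<cdot>\<^bsub>stable_addcat E\<^esub> b \<and>
       stable_shift E H a \<cdot>\<^bsub>stable_addcat E\<^esub> stable_class E w = W \<cdot>\<^bsub>stable_addcat E\<^esub> c}"

definition stable_category ::
    "('o, 'm, 'z) exactcat_scheme \<Rightarrow> ('o, 'm) hulls \<Rightarrow> ('o, 'm set) tricat" where
  "stable_category E H =
     addcat.extend (stable_addcat E)
       \<lparr>ShO = Susp H, ShM = stable_shift E H, Tri = stable_triangles E H\<rparr>"

section \<open>Precovers, resolutions and dimension\<close>

definition precover ::
    "('o, 'm, 'z) cat_scheme \<Rightarrow> 'o set \<Rightarrow> 'o \<Rightarrow> 'm \<Rightarrow> 'o \<Rightarrow> bool" where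
  "precover E R Q p X \<longleftrightarrow> X \<in> Obj E \<and> Q \<in> R \<and> p \<in> Hom E Q X \<and>
     (\<forall>Q'\<in>R. \<forall>f\<in>Hom E Q' X. \<exists>g\<in>Hom E Q' Q. p \<cdot>\<^bsub>E\<^esub> g = f)"

definition precovering :: "('o, 'm, 'z) cat_scheme \<Rightarrow> 'o set \<Rightarrow> bool" where
  "precovering E R \<longleftrightarrow> R \<subseteq> Obj E \<and> (\<forall>X\<in>Obj E. \<exists>Q p. precover E R Q p X)"

text \<open>
  \<open>p i : Q i \<rightarrow> K i\<close> is a precover with kernel \<open>k i : K (i + 1) \<rightarrow> Q i\<close>, where \<open>K 0 = X\<close>.
\<close>

definition is_resolution ::
    "('o, 'm, 'z) addcat_scheme \<Rightarrow> 'o set \<Rightarrow> 'o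
      \<Rightarrow> (nat \<Rightarrow> 'o) \<Rightarrow> (nat \<Rightarrow> 'o) \<Rightarrow> (nat \<Rightarrow> 'm) \<Rightarrow> (nat \<Rightarrow> 'm) \<Rightarrow> bool" where
  "is_resolution E R X K Q p k \<longleftrightarrow> K 0 = X \<and>
     (\<forall>i. precover E R (Q i) (p i) (K i) \<and> is_kernel E (K (Suc i)) (k i) (Q i) (p i) (K i))"

definition finite_dimension :: "('o, 'm, 'z) addcat_scheme \<Rightarrow> 'o set \<Rightarrow> 'o \<Rightarrow> bool" where
  "finite_dimension E R X \<longleftrightarrow>
     (\<exists>K Q p k. is_resolution E R X K Q p k \<and> (\<exists>d. K d \<in> R))"

end

theory Submission
  imports Defs
begin

text \<open>
  Call an arrow of \<open>E\<close> null if it factors through an injective object, so that \<open>Hom\<^sub>T(A, B) = 0\<close> in the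
  stable category \<open>T\<close> means that all arrows \<open>A \<rightarrow> B\<close> are null. Let \<open>\<Y>\<close> be the class of the \<open>Y\<close> with
  \<open>Hom\<^sub>T(Q, Y) = 0\<close> for all \<open>Q\<close> in \<open>R\<close>. As \<open>R\<close> is closed under shifts, so is \<open>\<Y>\<close>, and therefore the
  objects \<open>Z\<close> with \<open>Hom\<^sub>T(Z, \<Y>) = 0\<close> form a localizing subcategory
  (\<open>localizing_left_orthogonal\<close>). It contains \<open>R\<close>, hence also the localizing closure \<open>S\<close> of \<open>R\<close>.

  Suppose that \<open>X\<close> has a special preenvelope, a conflation \<open>X \<rightarrow> Y \<rightarrow> D\<close> with \<open>Y\<close> in \<open>\<Y>\<close> and \<open>D\<close> in
  \<open>S\<close>. It gives a triangle \<open>D[-1] \<rightarrow> X \<rightarrow> Y \<rightarrow> D\<close>. For \<open>Z\<close> in \<open>S\<close> both \<open>Hom\<^sub>T(Z, Y)\<close> and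
  \<open>Hom\<^sub>T(Z[1], Y)\<close> vanish, so composition with \<open>D[-1] \<rightarrow> X\<close> is a bijection
  \<open>Hom\<^sub>T(Z, D[-1]) \<rightarrow> Hom\<^sub>T(Z, X)\<close> (\<open>fibre_coreflection\<close>). Hence \<open>D[-1]\<close> is a coreflection of \<open>X\<close> in
  \<open>S\<close>, and coreflections of all objects amount to a right adjoint of the inclusion
  (\<open>right_adjoint_of_inclusion\<close>).

  Special preenvelopes are constructed by descending induction along a resolution of \<open>X\<close>. It reaches
  an object of \<open>R\<close>, for which the conflation into the injective hull will do. For the inductive
  step (\<open>special_preenvelope_step\<close>) let \<open>k : K \<rightarrow> B\<close> be a kernel of a precover \<open>p : B \<rightarrow> X\<close>. These two
  arrows need not form a conflation, but \<open>R\<close> does not notice: for \<open>Q\<close> in \<open>R\<close> the sequence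
  \<open>0 \<rightarrow> Hom(Q, K) \<rightarrow> Hom(Q, B) \<rightarrow> Hom(Q, X) \<rightarrow> 0\<close> is exact in \<open>E\<close>, and so it is with \<open>Q\<close> replaced by
  \<open>I(Q)\<close>, which lies in \<open>R\<close>, or by \<open>Q[1]\<close>, which is a retract of the sum of an object of \<open>R\<close> and
  \<open>I(Q)\<close> (\<open>lift_from_cokernel\<close>). By the snake lemma the sequence
  \<open>0 \<rightarrow> Hom\<^sub>T(Q, K) \<rightarrow> Hom\<^sub>T(Q, B) \<rightarrow> Hom\<^sub>T(Q, X) \<rightarrow> 0\<close> is exact too.

  Let now \<open>K \<rightarrow> Y \<rightarrow> D\<close> be a special preenvelope of \<open>K\<close>. Its pushout along \<open>k\<close> is a conflation
  \<open>B \<rightarrow> N \<rightarrow> D\<close>, whence \<open>N\<close> is in \<open>S\<close>, and there is an arrow \<open>q : N \<rightarrow> X\<close> that is \<open>p\<close> on \<open>B\<close> and \<open>0\<close> on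
  \<open>Y\<close>. The pushout of \<open>N \<rightarrow> I(N) \<rightarrow> N[1]\<close> along \<open>q\<close> is a conflation \<open>X \<rightarrow> Y' \<rightarrow> N[1]\<close> in which \<open>Y'\<close> is
  the cone of \<open>q\<close>. Here \<open>N\<close> is the cone of the composite \<open>D[-1] \<rightarrow> K \<rightarrow> B\<close>, whose first arrow
  is an isomorphism for \<open>Hom\<^sub>T(Q, -)\<close>. So \<open>R\<close> sees \<open>N\<close> as the cone of \<open>K \<rightarrow> B\<close>, that is, as \<open>X\<close>, and
  the object \<open>Y'\<close> is in \<open>\<Y>\<close>; the lemmas \<open>null_if_killed\<close> and \<open>orthogonal_cone_of_lifting\<close> verify this by diagram chases in
  \<open>E\<close>.
\<close>

section \<open>Arrows of a category\<close>

context category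
begin

definition in_hom :: "'m \<Rightarrow> 'o \<Rightarrow> 'o \<Rightarrow> bool"  (\<open>\<guillemotleft>_ : _ \<rightarrow> _\<guillemotright>\<close>) where
  "\<guillemotleft>f : A \<rightarrow> B\<guillemotright> \<longleftrightarrow> A \<in> Obj C \<and> B \<in> Obj C \<and> f \<in> Hom C A B"

definition arr :: "'m \<Rightarrow> bool" where
  "arr f \<longleftrightarrow> (\<exists>A B. \<guillemotleft>f : A \<rightarrow> B\<guillemotright>)"

definition src :: "'m \<Rightarrow> 'o" where
  "src f = (THE A. \<exists>B. \<guillemotleft>f : A \<rightarrow> B\<guillemotright>)"

definition tgt :: "'m \<Rightarrow> 'o" where
  "tgt f = (THE B. \<exists>A. \<guillemotleft>f : A \<rightarrow> B\<guillemotright>)"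

lemma in_hom_unique: "\<lbrakk>\<guillemotleft>f : A \<rightarrow> B\<guillemotright>; \<guillemotleft>f : A' \<rightarrow> B'\<guillemotright>\<rbrakk> \<Longrightarrow> A = A' \<and> B = B'"
  unfolding in_hom_def using Hom_disjoint by metis

lemma src_eq: "\<guillemotleft>f : A \<rightarrow> B\<guillemotright> \<Longrightarrow> src f = A"
  unfolding src_def using in_hom_unique by blast

lemma tgt_eq: "\<guillemotleft>f : A \<rightarrow> B\<guillemotright> \<Longrightarrow> tgt f = B"
  unfolding tgt_def using in_hom_unique by blast

text \<open>
  Together with the simplification rules for \<open>arr\<close>, \<open>src\<close> and \<open>tgt\<close> composites are typed by
  rewriting, without guessing the middle object.
\<close>

lemma in_hom_iff:
  "\<guillemotleft>f : A \<rightarrow> B\<guillemotright> \<longleftrightarrow> arr f \<and> src f = A \<and> tgt f = B \<and> A \<in> Obj C \<and> B \<in> Obj C"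
  by (metis arr_def in_hom_def src_eq tgt_eq)

lemma arr_in_hom: "arr f \<Longrightarrow> \<guillemotleft>f : src f \<rightarrow> tgt f\<guillemotright>"
  by (metis arr_def src_eq tgt_eq)

lemma in_homD: "\<guillemotleft>f : A \<rightarrow> B\<guillemotright> \<Longrightarrow> f \<in> Hom C A B"
  by (simp add: in_hom_def)

lemma Comp_in_hom: "\<lbrakk>\<guillemotleft>f : A \<rightarrow> B\<guillemotright>; \<guillemotleft>g : B \<rightarrow> D\<guillemotright>\<rbrakk> \<Longrightarrow> \<guillemotleft>g \<cdot> f : A \<rightarrow> D\<guillemotright>"
  unfolding in_hom_def using Comp_in_Hom by metis

lemma Ident_in_hom: "A \<in> Obj C \<Longrightarrow> \<guillemotleft>Ident C A : A \<rightarrow> A\<guillemotright>"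
  unfolding in_hom_def using Ident_in_Hom by metis

lemma src_tgt_Obj [simp]: "arr f \<Longrightarrow> src f \<in> Obj C" "arr f \<Longrightarrow> tgt f \<in> Obj C"
  using arr_in_hom in_hom_def by blast+

lemma Comp_simps [simp]:
  assumes "arr f" "arr g" "tgt f = src g"
  shows "arr (g \<cdot> f)" "src (g \<cdot> f) = src f" "tgt (g \<cdot> f) = tgt g"
  using Comp_in_hom[of f "src f" "tgt f" g "tgt g"] assms arr_in_hom[of f] arr_in_hom[of g]
  by (simp_all add: in_hom_iff)

lemma Ident_simps [simp]:
  assumes "A \<in> Obj C"
  shows "arr (Ident C A)" "src (Ident C A) = A" "tgt (Ident C A) = A"
  using Ident_in_hom[OF assms] by (simp_all add: in_hom_iff)

lemma Comp_assoc_arr [simp]: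
  "\<lbrakk>arr f; arr g; arr h; tgt f = src g; tgt g = src h\<rbrakk> \<Longrightarrow> (h \<cdot> g) \<cdot> f = h \<cdot> g \<cdot> f"
  using arr_in_hom[of f] arr_in_hom[of g] arr_in_hom[of h] Comp_assoc unfolding in_hom_def by metis

lemma Comp_Ident_arr [simp]:
  "\<lbrakk>arr f; src f = A\<rbrakk> \<Longrightarrow> f \<cdot> Ident C A = f"
  "\<lbrakk>arr f; tgt f = B\<rbrakk> \<Longrightarrow> Ident C B \<cdot> f = f"
  using arr_in_hom[of f] Comp_Ident_right Comp_Ident_left unfolding in_hom_def by metis+

text \<open>
  Composites are normalized to the right, so an equation \<open>g \<cdot> f = k\<close> no longer matches inside
  \<open>g \<cdot> f \<cdot> e\<close>; as a rewrite rule this form of the equation does.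
\<close>

lemma post:
  "\<lbrakk>g \<cdot> f = k; arr f; arr g; arr e; tgt e = src f; tgt f = src g\<rbrakk> \<Longrightarrow> g \<cdot> f \<cdot> e = k \<cdot> e"
  by (metis Comp_assoc_arr)

text \<open>
  The right adjoint sends \<open>Y\<close> to its coreflection \<open>e Y : G Y \<rightarrow> Y\<close> and \<open>b : Y \<rightarrow> Y'\<close> to the unique arrow
  over \<open>b \<cdot> e Y\<close>. Both functoriality and naturality follow by cancelling some \<open>e Y\<close>.
\<close>

theorem right_adjoint_of_inclusion:
  assumes S: "S \<subseteq> Obj C"
    and coreflection: "\<And>Y. Y \<in> Obj C \<Longrightarrow> \<exists>X\<in>S. \<exists>e. \<guillemotleft>e : X \<rightarrow> Y\<guillemotright> \<and>
      (\<forall>Z\<in>S. \<forall>f. \<guillemotleft>f : Z \<rightarrow> Y\<guillemotright> \<longrightarrow> (\<exists>!g. \<guillemotleft>g : Z \<rightarrow> X\<guillemotright> \<and> e \<cdot> g = f))"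
  shows "has_right_adjoint (full_subcategory C S) C inclusion_functor"
proof -
  obtain G e where G: "\<And>Y. Y \<in> Obj C \<Longrightarrow> G Y \<in> S" and e: "\<And>Y. Y \<in> Obj C \<Longrightarrow> \<guillemotleft>e Y : G Y \<rightarrow> Y\<guillemotright>"
    and univ: "\<And>Y Z f. \<lbrakk>Y \<in> Obj C; Z \<in> S; \<guillemotleft>f : Z \<rightarrow> Y\<guillemotright>\<rbrakk> \<Longrightarrow> \<exists>!g. \<guillemotleft>g : Z \<rightarrow> G Y\<guillemotright> \<and> e Y \<cdot> g = f"
    using coreflection by metis
  define \<phi> where "\<phi> X Y f = (THE g. \<guillemotleft>g : X \<rightarrow> G Y\<guillemotright> \<and> e Y \<cdot> g = f)" for X Y f
  have \<phi>: "\<guillemotleft>\<phi> Z Y f : Z \<rightarrow> G Y\<guillemotright>" "e Y \<cdot> \<phi> Z Y f = f"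
    if "Z \<in> S" "\<guillemotleft>f : Z \<rightarrow> Y\<guillemotright>" for Y Z f
  proof -
    have "Y \<in> Obj C" using that(2) by (simp add: in_hom_def)
    then show "\<guillemotleft>\<phi> Z Y f : Z \<rightarrow> G Y\<guillemotright>" "e Y \<cdot> \<phi> Z Y f = f"
      using theI'[OF univ[OF _ that]] unfolding \<phi>_def by blast+
  qed
  have uniq: "g = h" if "Z \<in> S" "\<guillemotleft>g : Z \<rightarrow> G Y\<guillemotright>" "\<guillemotleft>h : Z \<rightarrow> G Y\<guillemotright>" "e Y \<cdot> g = e Y \<cdot> h" "Y \<in> Obj C"
    for Y Z g h
    using univ[of Y Z "e Y \<cdot> g"] that Comp_in_hom[OF that(2) e[OF that(5)]] by metis
  define G1 where "G1 b = \<phi> (G (src b)) (tgt b) (b \<cdot> e (src b))" for b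
  have G1: "\<guillemotleft>G1 b : G Y \<rightarrow> G Y'\<guillemotright>" "e Y' \<cdot> G1 b = b \<cdot> e Y" if b: "\<guillemotleft>b : Y \<rightarrow> Y'\<guillemotright>" for b Y Y'
  proof -
    have Y: "Y \<in> Obj C" using b by (simp add: in_hom_def)
    show "\<guillemotleft>G1 b : G Y \<rightarrow> G Y'\<guillemotright>" "e Y' \<cdot> G1 b = b \<cdot> e Y"
      unfolding G1_def using \<phi>[OF G[OF Y] Comp_in_hom[OF e[OF Y] b]] src_eq[OF b] tgt_eq[OF b]
      by auto
  qed
  have sub: "category (full_subcategory C S)"
    by unfold_locales (simp_all add: full_subcategory_def,
      meson S subsetD Hom_disjoint, meson S subsetD Ident_in_Hom, meson S subsetD Comp_in_Hom,
      meson S subsetD Comp_Ident_right, meson S subsetD Comp_Ident_left, meson S subsetD Comp_assoc)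
  have "is_functor (full_subcategory C S) C inclusion_functor"
    unfolding is_functor_def inclusion_functor_def
    using sub category_axioms S by (auto simp: full_subcategory_def)
  moreover have "is_functor C (full_subcategory C S) (G, G1)"
    unfolding is_functor_def
  proof (intro conjI ballI)
    fix A assume A: "A \<in> Obj C"
    show "fst (G, G1) A \<in> Obj (full_subcategory C S)" using G A by (simp add: full_subcategory_def)
    have "G1 (Ident C A) = Ident C (G A)"
      by (rule uniq[of "G A" _ A])
        (use A G S e[OF A] G1[OF Ident_in_hom[OF A]] in \<open>auto simp: in_hom_iff\<close>)
    then show "snd (G, G1) (Ident C A) = Ident (full_subcategory C S) (fst (G, G1) A)"
      by (simp add: full_subcategory_def)
  next
    fix A B f assume "A \<in> Obj C" "B \<in> Obj C" "f \<in> Hom C A B"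
    then show "snd (G, G1) f \<in> Hom (full_subcategory C S) (fst (G, G1) A) (fst (G, G1) B)"
      using in_homD[OF G1(1)] by (simp add: full_subcategory_def in_hom_def)
  next
    fix A B D f g
    assume *: "A \<in> Obj C" "B \<in> Obj C" "D \<in> Obj C" "f \<in> Hom C A B" "g \<in> Hom C B D"
    then have f: "\<guillemotleft>f : A \<rightarrow> B\<guillemotright>" and g: "\<guillemotleft>g : B \<rightarrow> D\<guillemotright>" by (auto simp: in_hom_def)
    note Gf = G1[OF f] and Gg = G1[OF g] and Ggf = G1[OF Comp_in_hom[OF f g]]
    have "G1 (g \<cdot> f) = G1 g \<cdot> G1 f"
    proof (rule uniq[of "G A" _ D])
      show "e D \<cdot> G1 (g \<cdot> f) = e D \<cdot> G1 g \<cdot> G1 f"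
        using f g Gf Gg Ggf e[OF *(1)] e[OF *(2)] e[OF *(3)]
        by (simp add: in_hom_iff Gg(2)[THEN post])
    qed (use * G Gf Gg Ggf Comp_in_hom in auto)
    then show "snd (G, G1) (g \<cdot> f) =
        snd (G, G1) g \<cdot>\<^bsub>full_subcategory C S\<^esub> snd (G, G1) f"
      by (simp add: full_subcategory_def)
  qed (use sub category_axioms in auto)
  moreover have "bij_betw (\<phi> X Y) (Hom C X Y) (Hom C X (G Y))" if X: "X \<in> S" and Y: "Y \<in> Obj C" for X Y
  proof (rule bij_betw_byWitness[where f' = "\<lambda>g. e Y \<cdot> g"])
    have XC: "X \<in> Obj C" and GC: "G Y \<in> Obj C" using X Y S G by auto
    show "\<forall>f\<in>Hom C X Y. e Y \<cdot> \<phi> X Y f = f"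
      using \<phi>(2)[OF X] XC Y by (simp add: in_hom_def)
    have eg: "\<guillemotleft>e Y \<cdot> g : X \<rightarrow> Y\<guillemotright>" if "g \<in> Hom C X (G Y)" for g
      using that Comp_in_hom[OF _ e[OF Y]] XC GC by (simp add: in_hom_def)
    show "\<forall>g\<in>Hom C X (G Y). \<phi> X Y (e Y \<cdot> g) = g"
    proof
      fix g assume g: "g \<in> Hom C X (G Y)"
      show "\<phi> X Y (e Y \<cdot> g) = g"
        by (rule uniq[OF X _ _ _ Y]) (use \<phi>[OF X eg[OF g]] g XC GC in \<open>auto simp: in_hom_def\<close>)
    qed
    show "\<phi> X Y ` Hom C X Y \<subseteq> Hom C X (G Y)"
      using \<phi>(1)[OF X] XC Y by (auto simp: in_hom_def)
    show "(\<lambda>g. e Y \<cdot> g) ` Hom C X (G Y) \<subseteq> Hom C X Y"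
      using eg by (auto simp: in_hom_def)
  qed
  moreover have "\<phi> X' Y' (b \<cdot> g \<cdot> a) = G1 b \<cdot> \<phi> X Y g \<cdot> a"
    if X: "X \<in> S" "X' \<in> S" and Y: "Y \<in> Obj C" "Y' \<in> Obj C"
      and *: "a \<in> Hom C X' X" "g \<in> Hom C X Y" "b \<in> Hom C Y Y'" for X X' Y Y' a g b
  proof (rule uniq[OF X(2) _ _ _ Y(2)])
    have a: "\<guillemotleft>a : X' \<rightarrow> X\<guillemotright>" and g: "\<guillemotleft>g : X \<rightarrow> Y\<guillemotright>" and b: "\<guillemotleft>b : Y \<rightarrow> Y'\<guillemotright>"
      using X Y * S by (auto simp: in_hom_def)
    have bga: "\<guillemotleft>b \<cdot> g \<cdot> a : X' \<rightarrow> Y'\<guillemotright>" using a g b Comp_in_hom by blast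
    show "\<guillemotleft>\<phi> X' Y' (b \<cdot> g \<cdot> a) : X' \<rightarrow> G Y'\<guillemotright>" using \<phi>[OF X(2) bga] by blast
    show "\<guillemotleft>G1 b \<cdot> \<phi> X Y g \<cdot> a : X' \<rightarrow> G Y'\<guillemotright>" using a \<phi>(1)[OF X(1) g] G1(1)[OF b] Comp_in_hom by blast
    have "e Y' \<cdot> G1 b \<cdot> \<phi> X Y g \<cdot> a = b \<cdot> g \<cdot> a"
      using a b g \<phi>[OF X(1) g] G1[OF b] e[OF Y(1)] e[OF Y(2)]
      by (simp add: in_hom_iff G1(2)[OF b, THEN post] \<phi>(2)[OF X(1) g, THEN post])
    then show "e Y' \<cdot> \<phi> X' Y' (b \<cdot> g \<cdot> a) = e Y' \<cdot> G1 b \<cdot> \<phi> X Y g \<cdot> a"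
      using \<phi>[OF X(2) bga] by simp
  qed
  ultimately have "is_adjunction (full_subcategory C S) C inclusion_functor (G, G1) \<phi>"
    unfolding is_adjunction_def by (auto simp: full_subcategory_def inclusion_functor_def)
  then show ?thesis unfolding has_right_adjoint_def by blast
qed

end

context additive_category
begin

lemma Hom_group_simps [simp]:
  "carrier (Hom_group C A B) = Hom C A B"
  "mult (Hom_group C A B) = Plus C"
  "one (Hom_group C A B) = Zero C A B"
  by (simp_all add: Hom_group_def)

lemma Plus_in_hom: "\<lbrakk>\<guillemotleft>f : A \<rightarrow> B\<guillemotright>; \<guillemotleft>g : A \<rightarrow> B\<guillemotright>\<rbrakk> \<Longrightarrow> \<guillemotleft>f \<boxplus> g : A \<rightarrow> B\<guillemotright>"
  unfolding in_hom_def using Hom_comm_group[of A B] monoid.m_closed[of "Hom_group C A B" f g]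
  by (auto simp: comm_group_def comm_monoid_def)

lemma Zero_in_hom: "\<lbrakk>A \<in> Obj C; B \<in> Obj C\<rbrakk> \<Longrightarrow> \<guillemotleft>Zero C A B : A \<rightarrow> B\<guillemotright>"
  unfolding in_hom_def using Hom_comm_group[of A B] monoid.one_closed[of "Hom_group C A B"]
  by (auto simp: comm_group_def comm_monoid_def)

lemma Plus_simps [simp]:
  assumes "arr f" "arr g" "src f = src g" "tgt f = tgt g"
  shows "arr (f \<boxplus> g)" "src (f \<boxplus> g) = src g" "tgt (f \<boxplus> g) = tgt g"
  using Plus_in_hom[of f "src g" "tgt g" g] assms arr_in_hom[of f] arr_in_hom[of g]
  by (simp_all add: in_hom_iff)

lemma Zero_simps [simp]:
  assumes "A \<in> Obj C" "B \<in> Obj C"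
  shows "arr (Zero C A B)" "src (Zero C A B) = A" "tgt (Zero C A B) = B"
  using Zero_in_hom[OF assms] by (simp_all add: in_hom_iff)

lemma hom_group: "\<lbrakk>arr f; src f = A; tgt f = B\<rbrakk> \<Longrightarrow> comm_group (Hom_group C A B)"
  using Hom_comm_group src_tgt_Obj by blast

lemma arr_Hom: "\<lbrakk>arr f; src f = A; tgt f = B\<rbrakk> \<Longrightarrow> f \<in> Hom C A B"
  using arr_in_hom in_homD by blast

lemma Plus_assoc:
  assumes "arr f" "arr g" "arr h" "src f = src g" "tgt f = tgt g" "src g = src h" "tgt g = tgt h"
  shows "f \<boxplus> g \<boxplus> h = f \<boxplus> (g \<boxplus> h)"
proof -
  interpret G: comm_group "Hom_group C (src f) (tgt f)" by (rule hom_group[OF _ refl refl]) fact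
  show ?thesis using G.m_assoc[of f g h] assms by (simp add: arr_Hom)
qed

lemma Plus_commute:
  assumes "arr f" "arr g" "src f = src g" "tgt f = tgt g"
  shows "f \<boxplus> g = g \<boxplus> f"
proof -
  interpret G: comm_group "Hom_group C (src f) (tgt f)" by (rule hom_group[OF _ refl refl]) fact
  show ?thesis using G.m_comm[of f g] assms by (simp add: arr_Hom)
qed

lemma Plus_Zero [simp]:
  assumes "arr f" "src f = A" "tgt f = B"
  shows "f \<boxplus> Zero C A B = f" "Zero C A B \<boxplus> f = f"
proof -
  interpret G: comm_group "Hom_group C (src f) (tgt f)" by (rule hom_group[OF _ refl refl]) fact
  show "f \<boxplus> Zero C A B = f" "Zero C A B \<boxplus> f = f"
    using G.r_one[of f] G.l_one[of f] assms by (simp_all add: arr_Hom)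
qed

text \<open>
  All later computations are phrased with such an \<open>h\<close>, which spares the use of additive inverses.
\<close>

lemma difference_exists:
  assumes "\<guillemotleft>f : A \<rightarrow> B\<guillemotright>" "\<guillemotleft>g : A \<rightarrow> B\<guillemotright>"
  obtains h where "\<guillemotleft>h : A \<rightarrow> B\<guillemotright>" "f = g \<boxplus> h"
proof -
  have AB: "A \<in> Obj C" "B \<in> Obj C" "f \<in> Hom C A B" "g \<in> Hom C A B"
    using assms by (auto simp: in_hom_def)
  interpret G: comm_group "Hom_group C A B" using AB Hom_comm_group by simp
  let ?h = "inv\<^bsub>Hom_group C A B\<^esub> g \<boxplus> f"
  have "?h \<in> Hom C A B"
    using G.m_closed[of "inv\<^bsub>Hom_group C A B\<^esub> g" f] G.inv_closed[of g] AB by simp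
  moreover have "g \<boxplus> ?h = f"
    using G.m_assoc[of g "inv\<^bsub>Hom_group C A B\<^esub> g" f] G.inv_closed[of g] G.r_inv[of g]
      G.l_one[of f] AB by simp
  ultimately show ?thesis using that[of ?h] AB by (simp add: in_hom_def)
qed

lemma Plus_left_cancel:
  assumes "f \<boxplus> g = f \<boxplus> h" "arr f" "arr g" "arr h"
    "src f = src g" "tgt f = tgt g" "src f = src h" "tgt f = tgt h"
  shows "g = h"
proof -
  interpret G: comm_group "Hom_group C (src f) (tgt f)" by (rule hom_group[OF _ refl refl]) fact
  show ?thesis using G.Units_l_cancel[of f g h, unfolded G.Units_eq] assms by (simp add: arr_Hom)
qed

lemma Plus_right_cancel:
  assumes "g \<boxplus> f = h \<boxplus> f" "arr f" "arr g" "arr h"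
    "src f = src g" "tgt f = tgt g" "src f = src h" "tgt f = tgt h"
  shows "g = h"
proof (rule Plus_left_cancel)
  show "f \<boxplus> g = f \<boxplus> h"
    using assms(1) Plus_commute[OF assms(2,3,5,6)] Plus_commute[OF assms(2,4,7,8)] by argo
qed (use assms in simp_all)

lemma Comp_Plus [simp]:
  "\<lbrakk>arr f; arr g; arr h; tgt f = src g; src g = src h; tgt g = tgt h\<rbrakk>
    \<Longrightarrow> (g \<boxplus> h) \<cdot> f = (g \<cdot> f) \<boxplus> (h \<cdot> f)"
  "\<lbrakk>arr f; arr g; arr h; src f = src g; tgt f = tgt g; tgt g = src h\<rbrakk>
    \<Longrightarrow> h \<cdot> (f \<boxplus> g) = (h \<cdot> f) \<boxplus> (h \<cdot> g)"
  using Comp_Plus_left[of "src f" "tgt f" "tgt g" f g h]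
    Comp_Plus_right[of "src f" "tgt f" "tgt h" f g h]
    arr_in_hom[of f] arr_in_hom[of g] arr_in_hom[of h] by (auto simp: in_hom_def)

lemma Comp_Zero [simp]:
  assumes "arr f" "A \<in> Obj C"
  shows "src f = B \<Longrightarrow> f \<cdot> Zero C A B = Zero C A (tgt f)"
    and "tgt f = B \<Longrightarrow> Zero C B A \<cdot> f = Zero C (src f) A"
proof -
  assume B: "src f = B"
  then have "B \<in> Obj C" using assms by auto
  let ?z = "f \<cdot> Zero C A B"
  have "?z \<boxplus> ?z = f \<cdot> (Zero C A B \<boxplus> Zero C A B)"
    using assms B \<open>B \<in> Obj C\<close> by (simp del: Plus_Zero)
  also have "\<dots> = ?z \<boxplus> Zero C A (tgt f)"
    using assms B \<open>B \<in> Obj C\<close> by simp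
  finally show "?z = Zero C A (tgt f)"
    by (rule Plus_left_cancel) (use assms B \<open>B \<in> Obj C\<close> in simp_all)
next
  assume B: "tgt f = B"
  then have "B \<in> Obj C" using assms by auto
  let ?z = "Zero C B A \<cdot> f"
  have "?z \<boxplus> ?z = (Zero C B A \<boxplus> Zero C B A) \<cdot> f"
    using assms B \<open>B \<in> Obj C\<close> by (simp del: Plus_Zero)
  also have "\<dots> = ?z \<boxplus> Zero C (src f) A"
    using assms B \<open>B \<in> Obj C\<close> by simp
  finally show "?z = Zero C (src f) A"
    by (rule Plus_left_cancel) (use assms B \<open>B \<in> Obj C\<close> in simp_all)
qed

lemma kernelD:
  assumes "is_kernel C K k A f B"
  shows "\<guillemotleft>k : K \<rightarrow> A\<guillemotright>" "\<guillemotleft>f : A \<rightarrow> B\<guillemotright>" "f \<cdot> k = Zero C K B"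
  using assms by (auto simp: is_kernel_def in_hom_def)

lemma kernel_lift:
  assumes "is_kernel C K k A f B" "\<guillemotleft>g : Y \<rightarrow> A\<guillemotright>" "f \<cdot> g = Zero C Y B"
  obtains h where "\<guillemotleft>h : Y \<rightarrow> K\<guillemotright>" "k \<cdot> h = g"
  using assms unfolding is_kernel_def in_hom_def by metis

lemma kernel_cancel:
  assumes "is_kernel C K k A f B" "k \<cdot> h = k \<cdot> h'" "\<guillemotleft>h : Y \<rightarrow> K\<guillemotright>" "\<guillemotleft>h' : Y \<rightarrow> K\<guillemotright>"
  shows "h = h'"
proof -
  note kernelD[OF assms(1)]
  then have "\<guillemotleft>k \<cdot> h : Y \<rightarrow> A\<guillemotright>" "f \<cdot> k \<cdot> h = Zero C Y B"
    using assms by (auto simp: in_hom_iff kernelD(3)[OF assms(1), THEN post])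
  then show ?thesis using assms unfolding is_kernel_def in_hom_def by metis
qed

lemma cokernelD:
  assumes "is_cokernel C A f B c K"
  shows "\<guillemotleft>f : A \<rightarrow> B\<guillemotright>" "\<guillemotleft>c : B \<rightarrow> K\<guillemotright>" "c \<cdot> f = Zero C A K"
  using assms by (auto simp: is_cokernel_def in_hom_def)

lemma cokernel_desc:
  assumes "is_cokernel C A f B c K" "\<guillemotleft>g : B \<rightarrow> Y\<guillemotright>" "g \<cdot> f = Zero C A Y"
  obtains h where "\<guillemotleft>h : K \<rightarrow> Y\<guillemotright>" "h \<cdot> c = g"
  using assms unfolding is_cokernel_def in_hom_def by metis

lemma cokernel_cancel:
  assumes "is_cokernel C A f B c K" "h \<cdot> c = h' \<cdot> c" "\<guillemotleft>h : K \<rightarrow> Y\<guillemotright>" "\<guillemotleft>h' : K \<rightarrow> Y\<guillemotright>"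
  shows "h = h'"
proof -
  note kc = cokernelD[OF assms(1)]
  then have "\<guillemotleft>h \<cdot> c : B \<rightarrow> Y\<guillemotright>" "(h \<cdot> c) \<cdot> f = Zero C A Y"
    using assms by (auto simp: in_hom_iff)
  then show ?thesis using assms unfolding is_cokernel_def in_hom_def by metis
qed

lemma kernel_iso:
  assumes "is_kernel C K k A f B" "is_kernel C K' k' A f B"
  obtains u where "is_iso C K K' u" "k' \<cdot> u = k"
proof -
  note k = kernelD[OF assms(1)] and k' = kernelD[OF assms(2)]
  obtain u where u: "\<guillemotleft>u : K \<rightarrow> K'\<guillemotright>" "k' \<cdot> u = k" using kernel_lift[OF assms(2) k(1,3)] .
  obtain v where v: "\<guillemotleft>v : K' \<rightarrow> K\<guillemotright>" "k \<cdot> v = k'" using kernel_lift[OF assms(1) k'(1,3)] .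
  have "v \<cdot> u = Ident C K"
    by (rule kernel_cancel[OF assms(1), of _ _ K])
      (use u v k k' in \<open>simp_all add: in_hom_iff v(2)[THEN post]\<close>)
  moreover have "u \<cdot> v = Ident C K'"
    by (rule kernel_cancel[OF assms(2), of _ _ K'])
      (use u v k k' in \<open>simp_all add: in_hom_iff u(2)[THEN post]\<close>)
  ultimately show ?thesis using that u v by (auto simp: is_iso_def dest!: in_homD)
qed

lemma cokernel_iso:
  assumes "is_cokernel C A f B c K" "is_cokernel C A f B c' K'"
  obtains u where "is_iso C K K' u" "u \<cdot> c = c'"
proof -
  note k = cokernelD[OF assms(1)] and k' = cokernelD[OF assms(2)]
  obtain u where u: "\<guillemotleft>u : K \<rightarrow> K'\<guillemotright>" "u \<cdot> c = c'" using cokernel_desc[OF assms(1) k'(2,3)] .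
  obtain v where v: "\<guillemotleft>v : K' \<rightarrow> K\<guillemotright>" "v \<cdot> c' = c" using cokernel_desc[OF assms(2) k(2,3)] .
  have "v \<cdot> u = Ident C K"
    by (rule cokernel_cancel[OF assms(1), of _ _ K]) (use u v k k' in \<open>simp_all add: in_hom_iff\<close>)
  moreover have "u \<cdot> v = Ident C K'"
    by (rule cokernel_cancel[OF assms(2), of _ _ K']) (use u v k k' in \<open>simp_all add: in_hom_iff\<close>)
  ultimately show ?thesis using that u v by (auto simp: is_iso_def dest!: in_homD)
qed

lemma is_iso_Ident: "A \<in> Obj C \<Longrightarrow> is_iso C A A (Ident C A)"
  using Ident_in_Hom by (force simp: is_iso_def)

end

section \<open>Exact and Frobenius categories\<close>

context exact_category
begin

notation in_hom  (\<open>\<guillemotleft>_ : _ \<rightarrow> _\<guillemotright>\<close>)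

lemma conflationD:
  assumes "conflation E A i B p D"
  shows "\<guillemotleft>i : A \<rightarrow> B\<guillemotright>" "\<guillemotleft>p : B \<rightarrow> D\<guillemotright>" "p \<cdot> i = Zero E A D"
  using kernelD[OF conflation_kernel[OF assms]] by auto

lemmas conflation_lift = kernel_lift[OF conflation_kernel]
lemmas conflation_desc = cokernel_desc[OF conflation_cokernel]
lemmas conflation_mono = kernel_cancel[OF conflation_kernel]
lemmas conflation_epi = cokernel_cancel[OF conflation_cokernel]

text \<open>
  \<open>f - g\<close> is killed by \<open>p\<close> and so factors through its kernel \<open>i\<close>. In this form, and in the dual one
  below, the exactness of conflations enters the diagram chases.
\<close>

lemma lift_difference:
  assumes c: "conflation E A i B p D"
    and f: "\<guillemotleft>f : Z \<rightarrow> B\<guillemotright>" and g: "\<guillemotleft>g : Z \<rightarrow> B\<guillemotright>" and eq: "p \<cdot> f = p \<cdot> g"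
  obtains h where "\<guillemotleft>h : Z \<rightarrow> A\<guillemotright>" "f = g \<boxplus> i \<cdot> h"
proof -
  note c' = conflationD[OF c]
  obtain d where d: "\<guillemotleft>d : Z \<rightarrow> B\<guillemotright>" "f = g \<boxplus> d" using difference_exists[OF f g] .
  have "p \<cdot> g \<boxplus> p \<cdot> d = p \<cdot> g \<boxplus> Zero E Z D"
    using eq c' g d by (simp add: in_hom_iff)
  then have "p \<cdot> d = Zero E Z D"
    by (rule Plus_left_cancel) (use c' g d in \<open>simp_all add: in_hom_iff\<close>)
  then obtain h where "\<guillemotleft>h : Z \<rightarrow> A\<guillemotright>" "i \<cdot> h = d"
    using conflation_lift[OF c d(1)] by blast
  then show ?thesis using that d by blast
qed

lemma desc_difference:
  assumes c: "conflation E A i B p D"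
    and f: "\<guillemotleft>f : B \<rightarrow> Z\<guillemotright>" and g: "\<guillemotleft>g : B \<rightarrow> Z\<guillemotright>" and eq: "f \<cdot> i = g \<cdot> i"
  obtains h where "\<guillemotleft>h : D \<rightarrow> Z\<guillemotright>" "f = g \<boxplus> h \<cdot> p"
proof -
  note c' = conflationD[OF c]
  obtain d where d: "\<guillemotleft>d : B \<rightarrow> Z\<guillemotright>" "f = g \<boxplus> d" using difference_exists[OF f g] .
  have "g \<cdot> i \<boxplus> d \<cdot> i = g \<cdot> i \<boxplus> Zero E A Z"
    using eq c' g d by (simp add: in_hom_iff)
  then have "d \<cdot> i = Zero E A Z"
    by (rule Plus_left_cancel) (use c' g d in \<open>simp_all add: in_hom_iff\<close>)
  then obtain h where "\<guillemotleft>h : D \<rightarrow> Z\<guillemotright>" "h \<cdot> p = d"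
    using conflation_desc[OF c d(1)] by blast
  then show ?thesis using that d by blast
qed

text \<open>
  Both inflations of a pushout square have the same cokernel, so the conflation itself is pushed out
  and not only its first arrow.
\<close>

lemma conflation_pushout:
  assumes c: "conflation E A i B p D" and f: "\<guillemotleft>f : A \<rightarrow> A'\<guillemotright>"
  obtains B' i' f' p' where "conflation E A' i' B' p' D" "\<guillemotleft>f' : B \<rightarrow> B'\<guillemotright>"
    "f' \<cdot> i = i' \<cdot> f" "p' \<cdot> f' = p"
    "\<And>Y s t. \<lbrakk>\<guillemotleft>s : B \<rightarrow> Y\<guillemotright>; \<guillemotleft>t : A' \<rightarrow> Y\<guillemotright>; s \<cdot> i = t \<cdot> f\<rbrakk> \<Longrightarrow>
      \<exists>h. \<guillemotleft>h : B' \<rightarrow> Y\<guillemotright> \<and> h \<cdot> f' = s \<and> h \<cdot> i' = t"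
proof -
  note c' = conflationD[OF c]
  have "inflation E A B i" using c by (auto simp: inflation_def)
  then obtain B' f' i' where po: "is_pushout E A B A' B' i f f' i'" and inf: "inflation E A' B' i'"
    using inflation_pushout f unfolding in_hom_def by blast
  have t: "\<guillemotleft>f' : B \<rightarrow> B'\<guillemotright>" "\<guillemotleft>i' : A' \<rightarrow> B'\<guillemotright>" "f' \<cdot> i = i' \<cdot> f"
    using po unfolding is_pushout_def in_hom_def by auto
  have ex: "\<exists>h. \<guillemotleft>h : B' \<rightarrow> Y\<guillemotright> \<and> h \<cdot> f' = s \<and> h \<cdot> i' = t"
    if "\<guillemotleft>s : B \<rightarrow> Y\<guillemotright>" "\<guillemotleft>t : A' \<rightarrow> Y\<guillemotright>" "s \<cdot> i = t \<cdot> f" for Y s t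
    using po that unfolding is_pushout_def in_hom_def by metis
  have un: "h = h'" if h: "\<guillemotleft>h : B' \<rightarrow> Y\<guillemotright>" "\<guillemotleft>h' : B' \<rightarrow> Y\<guillemotright>" "h \<cdot> f' = h' \<cdot> f'" "h \<cdot> i' = h' \<cdot> i'"
    for Y h h'
  proof -
    have "\<guillemotleft>h \<cdot> f' : B \<rightarrow> Y\<guillemotright>" "\<guillemotleft>h \<cdot> i' : A' \<rightarrow> Y\<guillemotright>"
      using h t Comp_in_hom by blast+
    moreover have "(h \<cdot> f') \<cdot> i = (h \<cdot> i') \<cdot> f" using h(1) t c' f by (simp add: in_hom_iff)
    ultimately show ?thesis using po h unfolding is_pushout_def in_hom_def by metis
  qed
  obtain p' where p': "\<guillemotleft>p' : B' \<rightarrow> D\<guillemotright>" "p' \<cdot> f' = p" "p' \<cdot> i' = Zero E A' D"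
    using ex[of p D "Zero E A' D"] c' f by (auto simp: in_hom_iff)
  \<comment> \<open>By the universal property of the pushout \<open>p'\<close> is a cokernel of \<open>i'\<close>, hence isomorphic to the deflation.\<close>
  have "is_cokernel E A' i' B' p' D"
    unfolding is_cokernel_def
  proof (intro conjI ballI impI)
    fix Y g assume Y: "Y \<in> Obj E" and g: "g \<in> Hom E B' Y" and g0: "g \<cdot> i' = Zero E A' Y"
    have gh: "\<guillemotleft>g : B' \<rightarrow> Y\<guillemotright>" using Y g t by (simp add: in_hom_def)
    have "(g \<cdot> f') \<cdot> i = (g \<cdot> i') \<cdot> f" using gh t c' f by (simp add: in_hom_iff)
    then have "(g \<cdot> f') \<cdot> i = Zero E A Y" using f Y by (simp add: g0 in_hom_iff)
    then obtain h where h: "\<guillemotleft>h : D \<rightarrow> Y\<guillemotright>" "h \<cdot> p = g \<cdot> f'"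
      using conflation_desc[OF c Comp_in_hom[OF t(1) gh]] by blast
    have "h \<cdot> p' = g"
      by (rule un[of _ Y]) (use h p' gh t g0 in \<open>simp_all add: in_hom_iff\<close>)
    moreover have "h' = h" if "\<guillemotleft>h' : D \<rightarrow> Y\<guillemotright>" "h' \<cdot> p' = g" for h'
    proof (rule conflation_epi[OF c])
      show "h' \<cdot> p = h \<cdot> p"
        using that p' t h by (auto simp: in_hom_iff that(2)[THEN post] simp flip: p'(2))
    qed (use that h in auto)
    ultimately show "\<exists>!h. h \<in> Hom E D Y \<and> h \<cdot> p' = g"
      using h Y c' unfolding in_hom_def by metis
  qed (use t p' in \<open>auto simp: in_hom_def\<close>)
  moreover obtain D'' p'' where c'': "conflation E A' i' B' p'' D''"
    using inf by (auto simp: inflation_def)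
  ultimately obtain u where u: "is_iso E D'' D u" "u \<cdot> p'' = p'"
    using cokernel_iso[OF conflation_cokernel[OF c'']] by blast
  have "conflation E A' i' B' p' D"
    by (rule conflation_iso[OF c'' _ _ _ _ _ is_iso_Ident is_iso_Ident u(1)])
      (use c' t p' u in \<open>simp_all add: in_hom_iff in_homD arr_Hom\<close>)
  then show ?thesis using that t ex p' by blast
qed

lemma conflation_pullback:
  assumes c: "conflation E A i B p D" and f: "\<guillemotleft>f : D' \<rightarrow> D\<guillemotright>"
  obtains B' i' f' p' where "conflation E A i' B' p' D'" "\<guillemotleft>f' : B' \<rightarrow> B\<guillemotright>"
    "p \<cdot> f' = f \<cdot> p'" "f' \<cdot> i' = i"
    "\<And>Y s t. \<lbrakk>\<guillemotleft>s : Y \<rightarrow> B\<guillemotright>; \<guillemotleft>t : Y \<rightarrow> D'\<guillemotright>; p \<cdot> s = f \<cdot> t\<rbrakk> \<Longrightarrow>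
      \<exists>h. \<guillemotleft>h : Y \<rightarrow> B'\<guillemotright> \<and> f' \<cdot> h = s \<and> p' \<cdot> h = t"
    "\<And>Y h h'. \<lbrakk>\<guillemotleft>h : Y \<rightarrow> B'\<guillemotright>; \<guillemotleft>h' : Y \<rightarrow> B'\<guillemotright>; f' \<cdot> h = f' \<cdot> h'; p' \<cdot> h = p' \<cdot> h'\<rbrakk> \<Longrightarrow> h = h'"
proof -
  note c' = conflationD[OF c]
  have "deflation E B D p" using c by (auto simp: deflation_def)
  then obtain B' f' p' where pb: "is_pullback E B D B' D' p f f' p'" and def: "deflation E B' D' p'"
    using deflation_pullback f unfolding in_hom_def by blast
  have t: "\<guillemotleft>f' : B' \<rightarrow> B\<guillemotright>" "\<guillemotleft>p' : B' \<rightarrow> D'\<guillemotright>" "p \<cdot> f' = f \<cdot> p'"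
    using pb unfolding is_pullback_def in_hom_def by auto
  have ex: "\<exists>h. \<guillemotleft>h : Y \<rightarrow> B'\<guillemotright> \<and> f' \<cdot> h = s \<and> p' \<cdot> h = t"
    if "\<guillemotleft>s : Y \<rightarrow> B\<guillemotright>" "\<guillemotleft>t : Y \<rightarrow> D'\<guillemotright>" "p \<cdot> s = f \<cdot> t" for Y s t
    using pb that unfolding is_pullback_def in_hom_def by metis
  have un: "h = h'" if h: "\<guillemotleft>h : Y \<rightarrow> B'\<guillemotright>" "\<guillemotleft>h' : Y \<rightarrow> B'\<guillemotright>" "f' \<cdot> h = f' \<cdot> h'" "p' \<cdot> h = p' \<cdot> h'"
    for Y h h'
  proof -
    have "\<guillemotleft>f' \<cdot> h : Y \<rightarrow> B\<guillemotright>" "\<guillemotleft>p' \<cdot> h : Y \<rightarrow> D'\<guillemotright>"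
      using h t Comp_in_hom by blast+
    moreover have "p \<cdot> (f' \<cdot> h) = f \<cdot> (p' \<cdot> h)"
      using h(1) t c' f by (simp add: in_hom_iff t(3)[THEN post])
    ultimately show ?thesis using pb h unfolding is_pullback_def in_hom_def by metis
  qed
  obtain i' where i': "\<guillemotleft>i' : A \<rightarrow> B'\<guillemotright>" "f' \<cdot> i' = i" "p' \<cdot> i' = Zero E A D'"
    using ex[of i A "Zero E A D'"] c' f by (auto simp: in_hom_iff)
  have "is_kernel E A i' B' p' D'"
    unfolding is_kernel_def
  proof (intro conjI ballI impI)
    fix Y g assume Y: "Y \<in> Obj E" and g: "g \<in> Hom E Y B'" and g0: "p' \<cdot> g = Zero E Y D'"
    have gh: "\<guillemotleft>g : Y \<rightarrow> B'\<guillemotright>" using Y g t by (simp add: in_hom_def)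
    have "p \<cdot> f' \<cdot> g = Zero E Y D"
      using gh t c' f by (simp add: in_hom_iff t(3)[THEN post] g0)
    then obtain h where h: "\<guillemotleft>h : Y \<rightarrow> A\<guillemotright>" "i \<cdot> h = f' \<cdot> g"
      using conflation_lift[OF c Comp_in_hom[OF gh t(1)]] by blast
    have "i' \<cdot> h = g"
      by (rule un[of _ Y]) (use h i' gh t g0 in \<open>simp_all add: in_hom_iff i'(2)[THEN post] i'(3)[THEN post]\<close>)
    moreover have "h' = h" if "\<guillemotleft>h' : Y \<rightarrow> A\<guillemotright>" "i' \<cdot> h' = g" for h'
    proof (rule conflation_mono[OF c])
      show "i \<cdot> h' = i \<cdot> h"
        using that i' t h by (auto simp: in_hom_iff simp flip: i'(2))
    qed (use that h in auto)
    ultimately show "\<exists>!h. h \<in> Hom E Y A \<and> i' \<cdot> h = g"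
      using h Y c' unfolding in_hom_def by metis
  qed (use t i' in \<open>auto simp: in_hom_def\<close>)
  moreover obtain A'' i'' where c'': "conflation E A'' i'' B' p' D'"
    using def by (auto simp: deflation_def)
  ultimately obtain u where u: "is_iso E A A'' u" "i'' \<cdot> u = i'"
    using kernel_iso conflation_kernel[OF c''] by blast
  then obtain v where v: "is_iso E A'' A v" "i' \<cdot> v = i''"
    using kernel_iso[OF conflation_kernel[OF c''] \<open>is_kernel E A i' B' p' D'\<close>] by blast
  have "conflation E A i' B' p' D'"
    by (rule conflation_iso[OF c'' _ _ _ _ _ v(1) is_iso_Ident is_iso_Ident])
      (use c' t i' v(2) conflationD[OF c''] in \<open>simp_all add: in_hom_iff in_homD arr_Hom\<close>)
  then show ?thesis using that t ex i' un by blast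
qed

end

context frobenius_category
begin

definition null :: "'m \<Rightarrow> bool" where
  "null f \<longleftrightarrow> (\<exists>A J B a b. is_injective E J \<and> \<guillemotleft>a : A \<rightarrow> J\<guillemotright> \<and> \<guillemotleft>b : J \<rightarrow> B\<guillemotright> \<and> f = b \<cdot> a)"

lemma nullI: "\<lbrakk>is_injective E J; \<guillemotleft>a : A \<rightarrow> J\<guillemotright>; \<guillemotleft>b : J \<rightarrow> B\<guillemotright>\<rbrakk> \<Longrightarrow> null (b \<cdot> a)"
  unfolding null_def by blast

lemma nullE:
  assumes "null f" "\<guillemotleft>f : A \<rightarrow> B\<guillemotright>"
  obtains J a b where "is_injective E J" "\<guillemotleft>a : A \<rightarrow> J\<guillemotright>" "\<guillemotleft>b : J \<rightarrow> B\<guillemotright>" "f = b \<cdot> a"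
  using assms unfolding null_def by (metis Comp_in_hom in_hom_unique)

lemma injective_extend:
  assumes "is_injective E J" "conflation E A i B p D" "\<guillemotleft>f : A \<rightarrow> J\<guillemotright>"
  obtains g where "\<guillemotleft>g : B \<rightarrow> J\<guillemotright>" "f = g \<cdot> i"
  using assms conflationD[OF assms(2)] unfolding is_injective_def inflation_def in_hom_def by metis

lemma injective_lift:
  assumes "is_injective E P" "conflation E A i B p D" "\<guillemotleft>f : P \<rightarrow> D\<guillemotright>"
  obtains g where "\<guillemotleft>g : P \<rightarrow> B\<guillemotright>" "f = p \<cdot> g"
  using assms conflationD[OF assms(2)] projective_iff_injective
  unfolding is_projective_def deflation_def in_hom_def by metis

text \<open>
  Null arrows extend along every inflation, not only along some inflation into an injective object,
  since the injective object through which they factor has the extension property. This makes sums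
  of null arrows null without forming sums of injective objects.
\<close>

lemma null_extend:
  assumes "null f" "\<guillemotleft>f : A \<rightarrow> Z\<guillemotright>" "conflation E A i B p D"
  obtains g where "\<guillemotleft>g : B \<rightarrow> Z\<guillemotright>" "f = g \<cdot> i"
proof -
  obtain J a b where J: "is_injective E J" "\<guillemotleft>a : A \<rightarrow> J\<guillemotright>" "\<guillemotleft>b : J \<rightarrow> Z\<guillemotright>" "f = b \<cdot> a"
    using nullE assms by blast
  obtain g where "\<guillemotleft>g : B \<rightarrow> J\<guillemotright>" "a = g \<cdot> i" using injective_extend[OF J(1) assms(3) J(2)] .
  then show ?thesis
    using that[of "b \<cdot> g"] J conflationD[OF assms(3)] Comp_in_hom by (auto simp: in_hom_iff)
qed

text \<open>
  The dual of \<open>null_extend\<close>; injective objects are projective.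
\<close>

lemma null_lift:
  assumes "null f" "\<guillemotleft>f : Z \<rightarrow> D\<guillemotright>" "conflation E A i B p D"
  obtains g where "\<guillemotleft>g : Z \<rightarrow> B\<guillemotright>" "f = p \<cdot> g" "null g"
proof -
  obtain J a b where J: "is_injective E J" "\<guillemotleft>a : Z \<rightarrow> J\<guillemotright>" "\<guillemotleft>b : J \<rightarrow> D\<guillemotright>" "f = b \<cdot> a"
    using nullE assms by blast
  obtain g where "\<guillemotleft>g : J \<rightarrow> B\<guillemotright>" "b = p \<cdot> g" using injective_lift[OF J(1) assms(3) J(3)] .
  then show ?thesis
    using that[of "g \<cdot> a"] J conflationD[OF assms(3)] Comp_in_hom nullI by (auto simp: in_hom_iff)
qed

lemma null_Comp_left: "\<lbrakk>null f; \<guillemotleft>f : A \<rightarrow> B\<guillemotright>; \<guillemotleft>g : B \<rightarrow> D\<guillemotright>\<rbrakk> \<Longrightarrow> null (g \<cdot> f)"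
proof -
  assume *: "null f" "\<guillemotleft>f : A \<rightarrow> B\<guillemotright>" "\<guillemotleft>g : B \<rightarrow> D\<guillemotright>"
  obtain J a b where J: "is_injective E J" "\<guillemotleft>a : A \<rightarrow> J\<guillemotright>" "\<guillemotleft>b : J \<rightarrow> B\<guillemotright>" "f = b \<cdot> a"
    using nullE * by blast
  then show ?thesis
    using nullI[of J a A "g \<cdot> b" D] * by (simp add: in_hom_iff)
qed

lemma null_Comp_right: "\<lbrakk>null f; \<guillemotleft>f : A \<rightarrow> B\<guillemotright>; \<guillemotleft>g : D \<rightarrow> A\<guillemotright>\<rbrakk> \<Longrightarrow> null (f \<cdot> g)"
proof -
  assume *: "null f" "\<guillemotleft>f : A \<rightarrow> B\<guillemotright>" "\<guillemotleft>g : D \<rightarrow> A\<guillemotright>"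
  obtain J a b where J: "is_injective E J" "\<guillemotleft>a : A \<rightarrow> J\<guillemotright>" "\<guillemotleft>b : J \<rightarrow> B\<guillemotright>" "f = b \<cdot> a"
    using nullE * by blast
  then show ?thesis
    using nullI[of J "a \<cdot> g" D b B] * by (simp add: in_hom_iff)
qed

lemma ex_injective_conflation:
  assumes "A \<in> Obj E"
  obtains J i p D where "is_injective E J" "conflation E A i J p D"
  using enough_injectives[OF assms] by (auto simp: inflation_def)

lemma ex_projective_conflation:
  assumes "A \<in> Obj E"
  obtains K i P p where "is_injective E P" "conflation E K i P p A"
  using enough_projectives[OF assms] by (auto simp: deflation_def projective_iff_injective)

lemma null_Plus:
  assumes "null f" "null g" "\<guillemotleft>f : A \<rightarrow> B\<guillemotright>" "\<guillemotleft>g : A \<rightarrow> B\<guillemotright>"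
  shows "null (f \<boxplus> g)"
proof -
  obtain J i p D where J: "is_injective E J" "conflation E A i J p D"
    using ex_injective_conflation assms(3) unfolding in_hom_def by metis
  obtain f' g' where *: "\<guillemotleft>f' : J \<rightarrow> B\<guillemotright>" "f = f' \<cdot> i" "\<guillemotleft>g' : J \<rightarrow> B\<guillemotright>" "g = g' \<cdot> i"
    using null_extend J(2) assms by metis
  then show ?thesis
    using nullI[OF J(1), of i A "f' \<boxplus> g'" B] conflationD[OF J(2)] by (simp add: in_hom_iff)
qed

lemma null_Zero:
  assumes "A \<in> Obj E" "B \<in> Obj E"
  shows "null (Zero E A B)"
proof -
  obtain J i p D where J: "is_injective E J" "conflation E A i J p D"
    using ex_injective_conflation assms(1) by blast
  then show ?thesis
    using nullI[OF J(1), of i A "Zero E J B" B] conflationD[OF J(2)] assms by (simp add: in_hom_iff)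
qed

lemma null_inverse:
  assumes "null t" "\<guillemotleft>t : A \<rightarrow> B\<guillemotright>"
  obtains t' where "null t'" "\<guillemotleft>t' : A \<rightarrow> B\<guillemotright>" "t \<boxplus> t' = Zero E A B"
proof -
  obtain J a b where J: "is_injective E J" "\<guillemotleft>a : A \<rightarrow> J\<guillemotright>" "\<guillemotleft>b : J \<rightarrow> B\<guillemotright>" "t = b \<cdot> a"
    using nullE assms by blast
  obtain b' where b': "\<guillemotleft>b' : J \<rightarrow> B\<guillemotright>" "Zero E J B = b \<boxplus> b'"
    using difference_exists[OF Zero_in_hom J(3)] J by (auto simp: in_hom_iff)
  have "b \<cdot> a \<boxplus> b' \<cdot> a = (b \<boxplus> b') \<cdot> a" using J b' by (simp add: in_hom_iff)
  also have "\<dots> = Zero E A B" using J by (simp add: in_hom_iff flip: b'(2))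
  finally show ?thesis using that[of "b' \<cdot> a"] J b' nullI Comp_in_hom by blast
qed

subsection \<open>Vanishing and isomorphism in the stable category\<close>

text \<open>
  This is the vanishing of \<open>Hom(A, B)\<close> in the stable category.
\<close>

definition orthogonal :: "'o \<Rightarrow> 'o \<Rightarrow> bool" where
  "orthogonal A B \<longleftrightarrow> (\<forall>f. \<guillemotleft>f : A \<rightarrow> B\<guillemotright> \<longrightarrow> null f)"

text \<open>
  Isomorphism in the stable category, expressed by representatives: \<open>g \<cdot> f\<close> and \<open>f \<cdot> g\<close> are
  identities up to null arrows.
\<close>

definition stably_iso :: "'o \<Rightarrow> 'o \<Rightarrow> bool" where
  "stably_iso A B \<longleftrightarrow> (\<exists>f g t t'. \<guillemotleft>f : A \<rightarrow> B\<guillemotright> \<and> \<guillemotleft>g : B \<rightarrow> A\<guillemotright> \<and>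
     \<guillemotleft>t : A \<rightarrow> A\<guillemotright> \<and> null t \<and> Ident E A = g \<cdot> f \<boxplus> t \<and>
     \<guillemotleft>t' : B \<rightarrow> B\<guillemotright> \<and> null t' \<and> Ident E B = f \<cdot> g \<boxplus> t')"

lemma stably_iso_sym: "stably_iso A B \<Longrightarrow> stably_iso B A"
  unfolding stably_iso_def by blast

lemma stably_isoE:
  assumes "stably_iso A B"
  obtains f g t where "\<guillemotleft>f : A \<rightarrow> B\<guillemotright>" "\<guillemotleft>g : B \<rightarrow> A\<guillemotright>" "\<guillemotleft>t : A \<rightarrow> A\<guillemotright>" "null t"
    "Ident E A = g \<cdot> f \<boxplus> t"
  using assms unfolding stably_iso_def by blast

text \<open>
  Up to null arrows \<open>h\<close> is \<open>(h \<cdot> g) \<cdot> f\<close>.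
\<close>

lemma null_if_precomposite:
  assumes "\<guillemotleft>f : A \<rightarrow> B\<guillemotright>" "\<guillemotleft>g : B \<rightarrow> A\<guillemotright>" "\<guillemotleft>t : A \<rightarrow> A\<guillemotright>" "null t" "Ident E A = g \<cdot> f \<boxplus> t"
    and "\<guillemotleft>h : A \<rightarrow> Z\<guillemotright>" "null (h \<cdot> g)"
  shows "null h"
proof -
  have "h = h \<cdot> Ident E A" using assms(6) by (simp add: in_hom_iff)
  also have "\<dots> = (h \<cdot> g) \<cdot> f \<boxplus> h \<cdot> t" using assms(1,2,3,6) by (simp add: in_hom_iff assms(5))
  finally have h: "h = (h \<cdot> g) \<cdot> f \<boxplus> h \<cdot> t" .
  have "null ((h \<cdot> g) \<cdot> f \<boxplus> h \<cdot> t)"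
    using assms by (blast intro: null_Plus null_Comp_left null_Comp_right Comp_in_hom)
  then show ?thesis using h by simp
qed

lemma orthogonal_stably_iso:
  assumes "orthogonal A Z" "stably_iso A B"
  shows "orthogonal B Z"
  unfolding orthogonal_def
proof (intro allI impI)
  fix h assume h: "\<guillemotleft>h : B \<rightarrow> Z\<guillemotright>"
  obtain f g t where *: "\<guillemotleft>f : B \<rightarrow> A\<guillemotright>" "\<guillemotleft>g : A \<rightarrow> B\<guillemotright>" "\<guillemotleft>t : B \<rightarrow> B\<guillemotright>" "null t"
    "Ident E B = g \<cdot> f \<boxplus> t" using stably_isoE[OF stably_iso_sym[OF assms(2)]] .
  show "null h"
    using null_if_precomposite[OF * h] assms(1) Comp_in_hom[OF *(2) h]
    unfolding orthogonal_def by blast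
qed

text \<open>
  Here \<open>M\<close> is \<open>A[1]\<close> and \<open>K\<close> is \<open>B[-1]\<close>, and the lemma is the vanishing part of the adjunction
  \<open>Hom(A[1], B) = Hom(A, B[-1])\<close>. Given an arrow at one end of the two
  conflations, \<open>e : J \<rightarrow> P\<close> is a compatible arrow of their middle terms. The arrow induced at the
  other end is null, and removing from \<open>e\<close> its factorization through a middle term leaves a
  factorization of the given arrow through \<open>J\<close> or \<open>P\<close>.
\<close>

lemma orthogonal_shift:
  assumes A: "conflation E A r J s M" "is_injective E J"
    and B: "conflation E K \<kappa> P \<pi> B" "is_injective E P"
  shows "orthogonal M B \<longleftrightarrow> orthogonal A K"
proof
  note A' = conflationD[OF A(1)] and B' = conflationD[OF B(1)]
  assume M: "orthogonal M B"
  show "orthogonal A K" unfolding orthogonal_def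
  proof (intro allI impI)
    fix f assume f: "\<guillemotleft>f : A \<rightarrow> K\<guillemotright>"
    obtain e where e: "\<guillemotleft>e : J \<rightarrow> P\<guillemotright>" "\<kappa> \<cdot> f = e \<cdot> r"
      using injective_extend[OF B(2) A(1) Comp_in_hom[OF f B'(1)]] .
    have "(\<pi> \<cdot> e) \<cdot> r = Zero E A B"
      using A' B' f e(1) by (simp add: in_hom_iff B'(3)[THEN post] flip: e(2))
    then obtain g where g: "\<guillemotleft>g : M \<rightarrow> B\<guillemotright>" "g \<cdot> s = \<pi> \<cdot> e"
      using conflation_desc[OF A(1) Comp_in_hom[OF e(1) B'(2)]] by blast
    obtain g' where g': "\<guillemotleft>g' : M \<rightarrow> P\<guillemotright>" "g = \<pi> \<cdot> g'"
      using null_lift[OF _ g(1) B(1)] M g(1) unfolding orthogonal_def by blast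
    have "\<pi> \<cdot> e = \<pi> \<cdot> g' \<cdot> s" using g g' A' B' by (simp add: in_hom_iff flip: g(2))
    then obtain m where m: "\<guillemotleft>m : J \<rightarrow> K\<guillemotright>" "e = g' \<cdot> s \<boxplus> \<kappa> \<cdot> m"
      using lift_difference[OF B(1) e(1) Comp_in_hom[OF A'(2) g'(1)]] by blast
    have "f = m \<cdot> r"
    proof (rule conflation_mono[OF B(1)])
      show "\<kappa> \<cdot> f = \<kappa> \<cdot> m \<cdot> r" using A' B' f e g' m by (simp add: in_hom_iff)
    qed (use f m A' in \<open>auto simp: in_hom_iff\<close>)
    then show "null f" using nullI[OF A(2) A'(1) m(1)] by simp
  qed
next
  note A' = conflationD[OF A(1)] and B' = conflationD[OF B(1)]
  assume K: "orthogonal A K"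
  show "orthogonal M B" unfolding orthogonal_def
  proof (intro allI impI)
    fix f assume f: "\<guillemotleft>f : M \<rightarrow> B\<guillemotright>"
    obtain e where e: "\<guillemotleft>e : J \<rightarrow> P\<guillemotright>" "f \<cdot> s = \<pi> \<cdot> e"
      using injective_lift[OF A(2) B(1) Comp_in_hom[OF A'(2) f]] .
    have "\<pi> \<cdot> e \<cdot> r = Zero E A B"
      using A' B' f e(1) by (simp add: in_hom_iff e(2)[symmetric, THEN post])
    then obtain n where n: "\<guillemotleft>n : A \<rightarrow> K\<guillemotright>" "\<kappa> \<cdot> n = e \<cdot> r"
      using conflation_lift[OF B(1) Comp_in_hom[OF A'(1) e(1)]] by blast
    obtain n' where n': "\<guillemotleft>n' : J \<rightarrow> K\<guillemotright>" "n = n' \<cdot> r"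
      using null_extend[OF _ n(1) A(1)] K n(1) unfolding orthogonal_def by blast
    have "e \<cdot> r = (\<kappa> \<cdot> n') \<cdot> r" using n n' A' B' by (simp add: in_hom_iff flip: n(2))
    then obtain m where m: "\<guillemotleft>m : M \<rightarrow> P\<guillemotright>" "e = \<kappa> \<cdot> n' \<boxplus> m \<cdot> s"
      using desc_difference[OF A(1) e(1) Comp_in_hom[OF n'(1) B'(1)]] by blast
    have "f = \<pi> \<cdot> m"
    proof (rule conflation_epi[OF A(1)])
      show "f \<cdot> s = (\<pi> \<cdot> m) \<cdot> s"
        using A' B' f e n' m by (simp add: in_hom_iff B'(3)[THEN post])
    qed (use f m B' in \<open>auto simp: in_hom_iff\<close>)
    then show "null f" using nullI[OF B(2) m(1) B'(2)] by simp
  qed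
qed

text \<open>
  Exactness of \<open>Hom(X[1], W) \<rightarrow> Hom(Z, W) \<rightarrow> Hom(Y, W)\<close> for the triangle of a conflation; \<open>M\<close> is
  \<open>X[1]\<close>.
\<close>

lemma orthogonal_cone:
  assumes c: "conflation E X u Y v Z" and s: "conflation E X i J s M" "is_injective E J"
    and YW: "orthogonal Y W" and MW: "orthogonal M W"
  shows "orthogonal Z W"
  unfolding orthogonal_def
proof (intro allI impI)
  note c' = conflationD[OF c] and s' = conflationD[OF s(1)]
  fix f assume f: "\<guillemotleft>f : Z \<rightarrow> W\<guillemotright>"
  obtain h where h: "\<guillemotleft>h : Y \<rightarrow> J\<guillemotright>" "i = h \<cdot> u" using injective_extend[OF s(2) c s'(1)] .
  have "(s \<cdot> h) \<cdot> u = Zero E X M" using s' c' h by (simp add: in_hom_iff)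
  then obtain w where w: "\<guillemotleft>w : Z \<rightarrow> M\<guillemotright>" "w \<cdot> v = s \<cdot> h"
    using conflation_desc[OF c Comp_in_hom[OF h(1) s'(2)]] by blast
  have fv: "\<guillemotleft>f \<cdot> v : Y \<rightarrow> W\<guillemotright>" using Comp_in_hom c' f by blast
  then obtain J' a b where J': "is_injective E J'" "\<guillemotleft>a : Y \<rightarrow> J'\<guillemotright>" "\<guillemotleft>b : J' \<rightarrow> W\<guillemotright>" "f \<cdot> v = b \<cdot> a"
    using YW nullE[of "f \<cdot> v"] unfolding orthogonal_def by blast
  obtain e where e: "\<guillemotleft>e : J \<rightarrow> J'\<guillemotright>" "a \<cdot> u = e \<cdot> i"
    using injective_extend[OF J'(1) s(1) Comp_in_hom[OF c'(1) J'(2)]] .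
  have "(b \<cdot> e) \<cdot> i = b \<cdot> a \<cdot> u" using e J' s'(1) by (simp add: in_hom_iff)
  also have "\<dots> = (f \<cdot> v) \<cdot> u" unfolding J'(4) using J' c' by (simp add: in_hom_iff)
  also have "\<dots> = Zero E X W" using c' f by (simp add: in_hom_iff)
  finally obtain g where g: "\<guillemotleft>g : M \<rightarrow> W\<guillemotright>" "g \<cdot> s = b \<cdot> e"
    using conflation_desc[OF s(1) Comp_in_hom[OF e(1) J'(3)]] by blast
  have "a \<cdot> u = (e \<cdot> h) \<cdot> u" using e h c' by (simp add: in_hom_iff)
  then obtain m where m: "\<guillemotleft>m : Z \<rightarrow> J'\<guillemotright>" "a = e \<cdot> h \<boxplus> m \<cdot> v"
    using desc_difference[OF c J'(2) Comp_in_hom[OF h(1) e(1)]] by blast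
  \<comment> \<open>\<open>f\<close> comes from \<open>g : X[1] \<rightarrow> W\<close> along the connecting arrow \<open>w\<close>, up to a null arrow.\<close>
  have "f = g \<cdot> w \<boxplus> b \<cdot> m"
  proof (rule conflation_epi[OF c])
    show "f \<cdot> v = (g \<cdot> w \<boxplus> b \<cdot> m) \<cdot> v"
      using J' c' e s' f g w h m
      by (simp add: in_hom_iff g(2)[THEN post])
  qed (use f g w m J' in \<open>auto simp: in_hom_iff\<close>)
  moreover have "null (g \<cdot> w \<boxplus> b \<cdot> m)"
    using null_Plus[of "g \<cdot> w" "b \<cdot> m" Z W] null_Comp_right[of g M W w Z] nullI[OF J'(1) m(1) J'(3)]
      MW g(1) w(1) m(1) J'(3) Comp_in_hom unfolding orthogonal_def by blast
  ultimately show "null f" by simp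
qed

text \<open>
  A morphism between two conflations starting in \<open>A\<close> that is the identity on \<open>A\<close> induces a stable
  isomorphism of cokernels: \<open>h' \<cdot> h\<close> differs from the identity by some \<open>m \<cdot> p\<close>, and so \<open>g' \<cdot> g\<close>
  differs from it by \<open>p \<cdot> m\<close>.
\<close>

lemma cokernel_comparison:
  assumes a: "conflation E A i J p D" "is_injective E J"
    and b: "conflation E A i' J' p' D'" "is_injective E J'"
    and h: "\<guillemotleft>h : J \<rightarrow> J'\<guillemotright>" "h \<cdot> i = i'" and g: "\<guillemotleft>g : D \<rightarrow> D'\<guillemotright>" "g \<cdot> p = p' \<cdot> h"
    and h': "\<guillemotleft>h' : J' \<rightarrow> J\<guillemotright>" "h' \<cdot> i' = i" and g': "\<guillemotleft>g' : D' \<rightarrow> D\<guillemotright>" "g' \<cdot> p' = p \<cdot> h'"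
  obtains t where "\<guillemotleft>t : D \<rightarrow> D\<guillemotright>" "null t" "Ident E D = g' \<cdot> g \<boxplus> t"
proof -
  note a' = conflationD[OF a(1)] and b' = conflationD[OF b(1)]
  have "Ident E J \<cdot> i = (h' \<cdot> h) \<cdot> i" using a' b' h h' by (simp add: in_hom_iff)
  then obtain m where m: "\<guillemotleft>m : D \<rightarrow> J\<guillemotright>" "Ident E J = h' \<cdot> h \<boxplus> m \<cdot> p"
    using desc_difference[OF a(1) Ident_in_hom Comp_in_hom[OF h(1) h'(1)]] a'
    by (metis in_hom_def)
  have "Ident E D = g' \<cdot> g \<boxplus> p \<cdot> m"
  proof (rule conflation_epi[OF a(1)])
    have "Ident E D \<cdot> p = p \<cdot> Ident E J" using a' by (simp add: in_hom_iff)
    also have "\<dots> = p \<cdot> h' \<cdot> h \<boxplus> p \<cdot> m \<cdot> p"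
      using a' h h' m(1) by (simp add: in_hom_iff m(2) del: Comp_Ident_arr)
    also have "\<dots> = (g' \<cdot> g \<boxplus> p \<cdot> m) \<cdot> p"
      using a' b' h h' m(1) g g' by (simp add: in_hom_iff g'(2)[THEN post])
    finally show "Ident E D \<cdot> p = (g' \<cdot> g \<boxplus> p \<cdot> m) \<cdot> p" .
  qed (use a' g g' m in \<open>auto simp: in_hom_iff\<close>)
  then show ?thesis using that[of "p \<cdot> m"] nullI[OF a(2) m(1) a'(2)] Comp_in_hom[OF m(1) a'(2)] by blast
qed

lemma cokernel_map:
  assumes a: "conflation E A i J p D" and b: "conflation E A' i' J' p' D'" "is_injective E J'"
    and f: "\<guillemotleft>f : A \<rightarrow> A'\<guillemotright>"
  obtains h g where "\<guillemotleft>h : J \<rightarrow> J'\<guillemotright>" "h \<cdot> i = i' \<cdot> f" "\<guillemotleft>g : D \<rightarrow> D'\<guillemotright>" "g \<cdot> p = p' \<cdot> h"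
proof -
  note a' = conflationD[OF a(1)] and b' = conflationD[OF b(1)]
  obtain h where h: "\<guillemotleft>h : J \<rightarrow> J'\<guillemotright>" "i' \<cdot> f = h \<cdot> i"
    using injective_extend[OF b(2) a Comp_in_hom[OF f b'(1)]] .
  have "(p' \<cdot> h) \<cdot> i = Zero E A D'"
    using a' b' h(1) f by (simp add: in_hom_iff b'(3)[THEN post] flip: h(2))
  then obtain g where "\<guillemotleft>g : D \<rightarrow> D'\<guillemotright>" "g \<cdot> p = p' \<cdot> h"
    using conflation_desc[OF a Comp_in_hom[OF h(1) b'(2)]] by blast
  then show ?thesis using that h by metis
qed

lemma cokernels_stably_iso:
  assumes a: "conflation E A i J p D" "is_injective E J"
    and b: "conflation E A i' J' p' D'" "is_injective E J'"
  shows "stably_iso D D'"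
proof -
  have A: "A \<in> Obj E" using a by (simp add: conflation_def)
  obtain h g where h: "\<guillemotleft>h : J \<rightarrow> J'\<guillemotright>" "h \<cdot> i = i' \<cdot> Ident E A" "\<guillemotleft>g : D \<rightarrow> D'\<guillemotright>" "g \<cdot> p = p' \<cdot> h"
    using cokernel_map[OF a(1) b Ident_in_hom[OF A]] .
  obtain h' g' where h': "\<guillemotleft>h' : J' \<rightarrow> J\<guillemotright>" "h' \<cdot> i' = i \<cdot> Ident E A" "\<guillemotleft>g' : D' \<rightarrow> D\<guillemotright>" "g' \<cdot> p' = p \<cdot> h'"
    using cokernel_map[OF b(1) a Ident_in_hom[OF A]] .
  have *: "h \<cdot> i = i'" "h' \<cdot> i' = i"
    using h h' conflationD[OF a(1)] conflationD[OF b(1)] by (simp_all add: in_hom_iff)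
  show ?thesis
    using cokernel_comparison[OF a b h(1) *(1) h(3,4) h'(1) *(2) h'(3,4)]
      cokernel_comparison[OF b a h'(1) *(2) h'(3,4) h(1) *(1) h(3,4)] h(3) h'(3)
    unfolding stably_iso_def by metis
qed

text \<open>
  Rotates the triangle of a conflation \<open>A \<rightarrow> N \<rightarrow> D\<close> to \<open>D[-1] \<rightarrow> A \<rightarrow> N\<close>, which is isomorphic to
  the triangle of another conflation: for a projective \<open>P\<close> over \<open>D\<close> the pullback \<open>W\<close> of \<open>N\<close> and \<open>P\<close> is
  an extension of \<open>N\<close> by \<open>D[-1]\<close>, and it is also an extension of \<open>P\<close> by \<open>A\<close>, which splits.
\<close>

lemma extension_is_cone:
  assumes c: "conflation E A x N d D" and P: "conflation E K \<kappa> P \<pi> D" "is_injective E P"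
  obtains W u v where "conflation E K u W v N" "stably_iso A W"
proof -
  note c' = conflationD[OF c] and P' = conflationD[OF P(1)]
  obtain W u v w where W: "conflation E K u W v N" "\<guillemotleft>w : W \<rightarrow> P\<guillemotright>" "\<pi> \<cdot> w = d \<cdot> v" "w \<cdot> u = \<kappa>"
    and ex: "\<And>Y s t. \<lbrakk>\<guillemotleft>s : Y \<rightarrow> P\<guillemotright>; \<guillemotleft>t : Y \<rightarrow> N\<guillemotright>; \<pi> \<cdot> s = d \<cdot> t\<rbrakk> \<Longrightarrow>
      \<exists>h. \<guillemotleft>h : Y \<rightarrow> W\<guillemotright> \<and> w \<cdot> h = s \<and> v \<cdot> h = t"
    and un: "\<And>Y h h'. \<lbrakk>\<guillemotleft>h : Y \<rightarrow> W\<guillemotright>; \<guillemotleft>h' : Y \<rightarrow> W\<guillemotright>; w \<cdot> h = w \<cdot> h'; v \<cdot> h = v \<cdot> h'\<rbrakk> \<Longrightarrow> h = h'"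
    using conflation_pullback[OF P(1) c'(2)] by metis
  note W' = conflationD[OF W(1)]
  obtain l where l: "\<guillemotleft>l : P \<rightarrow> N\<guillemotright>" "\<pi> = d \<cdot> l" using injective_lift[OF P(2) c P'(2)] .
  obtain \<sigma> where \<sigma>: "\<guillemotleft>\<sigma> : P \<rightarrow> W\<guillemotright>" "w \<cdot> \<sigma> = Ident E P" "v \<cdot> \<sigma> = l"
    using ex[of "Ident E P" P l] l P' by (auto simp: in_hom_iff)
  obtain a where a: "\<guillemotleft>a : A \<rightarrow> W\<guillemotright>" "w \<cdot> a = Zero E A P" "v \<cdot> a = x"
    using ex[of "Zero E A P" A x] c' P' by (auto simp: in_hom_iff)
  have "d \<cdot> v = d \<cdot> l \<cdot> w" using W(2,3) l c' by (simp add: in_hom_iff flip: W(3))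
  then obtain \<rho> where \<rho>: "\<guillemotleft>\<rho> : W \<rightarrow> A\<guillemotright>" "v = l \<cdot> w \<boxplus> x \<cdot> \<rho>"
    using lift_difference[OF c W'(2) Comp_in_hom[OF W(2) l(1)]] by blast
  \<comment> \<open>The section \<open>\<sigma>\<close> of \<open>w\<close> given by a lift of \<open>\<pi>\<close> splits \<open>W\<close> into \<open>A\<close> and \<open>P\<close>.\<close>
  have idW: "Ident E W = a \<cdot> \<rho> \<boxplus> \<sigma> \<cdot> w"
  proof (rule un)
    show "w \<cdot> Ident E W = w \<cdot> (a \<cdot> \<rho> \<boxplus> \<sigma> \<cdot> w)"
      using W(2) W' a \<rho>(1) \<sigma> c' P'
      by (simp add: in_hom_iff a(2)[THEN post] \<sigma>(2)[THEN post])
    have "v \<cdot> (a \<cdot> \<rho> \<boxplus> \<sigma> \<cdot> w) = x \<cdot> \<rho> \<boxplus> l \<cdot> w"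
      using W(2) W' a(1) \<rho>(1) \<sigma>(1) c' by (simp add: in_hom_iff a(3)[THEN post] \<sigma>(3)[THEN post])
    also have "\<dots> = v" using Plus_commute[of "x \<cdot> \<rho>" "l \<cdot> w"] \<rho> W(2) l(1) c'
      by (simp add: in_hom_iff)
    finally show "v \<cdot> Ident E W = v \<cdot> (a \<cdot> \<rho> \<boxplus> \<sigma> \<cdot> w)" using W' by (simp add: in_hom_iff)
  qed (use W W' a \<rho> \<sigma> in \<open>auto simp: in_hom_iff\<close>)
  have "Ident E A = \<rho> \<cdot> a"
  proof (rule conflation_mono[OF c])
    have "x = (l \<cdot> w \<boxplus> x \<cdot> \<rho>) \<cdot> a" using a \<rho> by simp
    also have "\<dots> = x \<cdot> \<rho> \<cdot> a"
      using W(2) W' a(1,2) \<rho>(1) l(1) c' by (simp add: in_hom_iff)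
    finally show "x \<cdot> Ident E A = x \<cdot> \<rho> \<cdot> a" using c' by (simp add: in_hom_iff)
  qed (use c' a \<rho> in \<open>auto simp: in_hom_iff\<close>)
  then have idA: "Ident E A = \<rho> \<cdot> a \<boxplus> Zero E A A"
    using a \<rho> by (simp add: in_hom_iff)
  have A: "A \<in> Obj E" using c' by (simp add: in_hom_def)
  have "stably_iso A W"
    unfolding stably_iso_def
    using a(1) \<rho>(1) idA idW null_Zero[OF A A] Zero_in_hom[OF A A] nullI[OF P(2) W(2) \<sigma>(1)]
      Comp_in_hom[OF W(2) \<sigma>(1)] by blast
  then show ?thesis using that W(1) by blast
qed

subsection \<open>The cone of a precover\<close>

text \<open>
  \<open>M\<close> is a retract in \<open>E\<close> of the sum of \<open>Q\<close> and \<open>I\<close>: in the stable category it is a retract of \<open>Q\<close>, and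
  the null arrow \<open>t\<close> by which \<open>b \<cdot> a\<close> differs from the identity factors through \<open>s\<close> because
  injective objects are projective. So arrows to \<open>X\<close> that lift from \<open>Q\<close> and from \<open>I\<close> also lift from
  \<open>M\<close>. This is applied to \<open>M = A[1]\<close> and \<open>I = I(A)\<close>, where \<open>A\<close> and \<open>Q\<close> are in \<open>R\<close> and \<open>p\<close> is a
  precover.
\<close>

lemma lift_from_cokernel:
  assumes c: "conflation E A r I s M" "is_injective E I" and iso: "stably_iso M Q"
    and Q: "\<And>f. \<guillemotleft>f : Q \<rightarrow> X\<guillemotright> \<Longrightarrow> \<exists>g. \<guillemotleft>g : Q \<rightarrow> B\<guillemotright> \<and> p \<cdot> g = f"
    and I: "\<And>f. \<guillemotleft>f : I \<rightarrow> X\<guillemotright> \<Longrightarrow> \<exists>g. \<guillemotleft>g : I \<rightarrow> B\<guillemotright> \<and> p \<cdot> g = f"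
    and p: "\<guillemotleft>p : B \<rightarrow> X\<guillemotright>" and f: "\<guillemotleft>f : M \<rightarrow> X\<guillemotright>"
  shows "\<exists>g. \<guillemotleft>g : M \<rightarrow> B\<guillemotright> \<and> p \<cdot> g = f"
proof -
  note c' = conflationD[OF c(1)]
  obtain a b t where a: "\<guillemotleft>a : M \<rightarrow> Q\<guillemotright>" and b: "\<guillemotleft>b : Q \<rightarrow> M\<guillemotright>" and t: "\<guillemotleft>t : M \<rightarrow> M\<guillemotright>" "null t"
    and id: "Ident E M = b \<cdot> a \<boxplus> t" using stably_isoE[OF iso] .
  obtain J j t' where J: "is_injective E J" "\<guillemotleft>j : M \<rightarrow> J\<guillemotright>" "\<guillemotleft>t' : J \<rightarrow> M\<guillemotright>" "t = t' \<cdot> j"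
    using nullE[OF t(2,1)] .
  obtain t'' where t'': "\<guillemotleft>t'' : J \<rightarrow> I\<guillemotright>" "t' = s \<cdot> t''" using injective_lift[OF J(1) c(1) J(3)] .
  obtain g1 where g1: "\<guillemotleft>g1 : Q \<rightarrow> B\<guillemotright>" "p \<cdot> g1 = f \<cdot> b" using Q[OF Comp_in_hom[OF b f]] by blast
  obtain g2 where g2: "\<guillemotleft>g2 : I \<rightarrow> B\<guillemotright>" "p \<cdot> g2 = f \<cdot> s" using I[OF Comp_in_hom[OF c'(2) f]] by blast
  let ?g = "g1 \<cdot> a \<boxplus> g2 \<cdot> t'' \<cdot> j"
  have "p \<cdot> ?g = (f \<cdot> b) \<cdot> a \<boxplus> (f \<cdot> s) \<cdot> t'' \<cdot> j"
    using p f a b g1(1) g2(1) t''(1) J(2) c'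
    by (simp add: in_hom_iff g1(2)[THEN post] g2(2)[THEN post])
  also have "\<dots> = f \<cdot> (b \<cdot> a \<boxplus> t)"
    using f a b t'' J c' by (simp add: in_hom_iff)
  also have "\<dots> = f" using f by (simp add: in_hom_iff flip: id)
  finally show ?thesis using a g1(1) g2(1) t''(1) J(2) by (intro exI[of _ ?g]) (simp add: in_hom_iff)
qed

text \<open>
  The conflation \<open>B \<rightarrow> N \<rightarrow> D\<close> is the pushout of \<open>K \<rightarrow> Y \<rightarrow> D\<close> along the kernel \<open>k\<close> of \<open>p\<close>, and \<open>q\<close> is
  \<open>p\<close> on \<open>B\<close> and \<open>0\<close> on \<open>Y\<close>. Viewed in an abelian category, the kernel of \<open>q\<close> is \<open>Y\<close>: an arrow killed
  by \<open>q\<close> should factor through \<open>k'\<close>, and then it is null because \<open>M\<close> is orthogonal to \<open>Y\<close>. The factor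
  is found on the projective object \<open>I\<close> and descends to \<open>M\<close>.
\<close>

lemma null_if_killed:
  assumes x: "conflation E K x Y v D" and x': "conflation E B x' N d D"
    and k': "\<guillemotleft>k' : Y \<rightarrow> N\<guillemotright>" "k' \<cdot> x = x' \<cdot> k" "d \<cdot> k' = v"
    and k: "is_kernel E K k B p X"
    and q: "\<guillemotleft>q : N \<rightarrow> X\<guillemotright>" "q \<cdot> x' = p" "q \<cdot> k' = Zero E Y X"
    and c: "conflation E A r I s M" "is_injective E I" and MY: "orthogonal M Y"
    and g: "\<guillemotleft>g : M \<rightarrow> N\<guillemotright>" "q \<cdot> g = Zero E M X"
  shows "null g"
proof -
  note xD = conflationD[OF x] and x'D = conflationD[OF x'] and cD = conflationD[OF c(1)]
    and kD = kernelD[OF k]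
  have dgs: "\<guillemotleft>d \<cdot> g \<cdot> s : I \<rightarrow> D\<guillemotright>" using x'D cD g by (simp add: in_hom_iff)
  obtain e\<^sub>1 where e1: "\<guillemotleft>e\<^sub>1 : I \<rightarrow> Y\<guillemotright>" "d \<cdot> g \<cdot> s = v \<cdot> e\<^sub>1" using injective_lift[OF c(2) x dgs] .
  have "d \<cdot> g \<cdot> s = d \<cdot> k' \<cdot> e\<^sub>1" using e1 k' x'D by (simp add: in_hom_iff k'(3)[THEN post])
  then obtain t where t: "\<guillemotleft>t : I \<rightarrow> B\<guillemotright>" "g \<cdot> s = k' \<cdot> e\<^sub>1 \<boxplus> x' \<cdot> t"
    using lift_difference[OF x' Comp_in_hom[OF cD(2) g(1)] Comp_in_hom[OF e1(1) k'(1)]] by blast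
  have "p \<cdot> t = q \<cdot> (k' \<cdot> e\<^sub>1 \<boxplus> x' \<cdot> t)"
    using q k'(1) e1(1) t(1) x'D kD
    by (simp add: in_hom_iff q(2)[THEN post] q(3)[THEN post])
  also have "\<dots> = q \<cdot> g \<cdot> s" by (simp add: t(2))
  also have "\<dots> = Zero E I X" using q g cD by (simp add: in_hom_iff g(2)[THEN post])
  finally have pt: "p \<cdot> t = Zero E I X" .
  obtain t' where t': "\<guillemotleft>t' : I \<rightarrow> K\<guillemotright>" "k \<cdot> t' = t" using kernel_lift[OF k t(1) pt] .
  \<comment> \<open>\<open>t\<close> factors through \<open>k\<close>, and the square \<open>k' \<cdot> x = x' \<cdot> k\<close> absorbs it into the first summand.\<close>
  define e\<^sub>2 where "e\<^sub>2 = e\<^sub>1 \<boxplus> x \<cdot> t'"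
  have e2: "\<guillemotleft>e\<^sub>2 : I \<rightarrow> Y\<guillemotright>" using e1 t' xD by (simp add: e\<^sub>2_def in_hom_iff)
  have gs: "g \<cdot> s = k' \<cdot> e\<^sub>2"
    using t' e1(1) t(1) k'(1) xD x'D kD
    by (simp add: e\<^sub>2_def in_hom_iff t(2) k'(2)[THEN post])
  have "v \<cdot> e\<^sub>2 = d \<cdot> g \<cdot> s"
    using e1 t' xD by (simp add: e\<^sub>2_def in_hom_iff xD(3)[THEN post])
  then have "v \<cdot> e\<^sub>2 \<cdot> r = d \<cdot> g \<cdot> s \<cdot> r"
    using e2 xD x'D cD g post[of v e\<^sub>2 "d \<cdot> g \<cdot> s" r] by (simp add: in_hom_iff del: cD(3))
  also have "\<dots> = Zero E A D" using x'D cD g by (simp add: in_hom_iff)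
  finally obtain u where u: "\<guillemotleft>u : A \<rightarrow> K\<guillemotright>" "x \<cdot> u = e\<^sub>2 \<cdot> r"
    using conflation_lift[OF x Comp_in_hom[OF cD(1) e2]] by blast
  \<comment> \<open>\<open>e\<^sub>2 \<cdot> r\<close> vanishes because \<open>x' \<cdot> k\<close> is a composite of monomorphisms.\<close>
  have "x' \<cdot> k \<cdot> u = k' \<cdot> x \<cdot> u"
    using u(1) k' kD x'D xD by (simp add: in_hom_iff k'(2)[THEN post])
  also have "\<dots> = g \<cdot> s \<cdot> r"
    using u e2 g cD k'(1) gs[THEN post, of r] by (simp add: in_hom_iff)
  also have "\<dots> = x' \<cdot> Zero E A B" using cD g x'D by (simp add: in_hom_iff)
  finally have "k \<cdot> u = Zero E A B"
    using conflation_mono[OF x', of "k \<cdot> u" "Zero E A B" A] u(1) kD x'D by (simp add: in_hom_iff)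
  then have "k \<cdot> u = k \<cdot> Zero E A K" using u(1) kD by (simp add: in_hom_iff)
  then have "u = Zero E A K"
    using kernel_cancel[OF k, of u "Zero E A K" A] u(1) by (simp add: in_hom_iff)
  then have "e\<^sub>2 \<cdot> r = Zero E A Y" using u xD by (simp add: in_hom_iff)
  then obtain e\<^sub>3 where e3: "\<guillemotleft>e\<^sub>3 : M \<rightarrow> Y\<guillemotright>" "e\<^sub>3 \<cdot> s = e\<^sub>2" using conflation_desc[OF c(1) e2] by blast
  have "g = k' \<cdot> e\<^sub>3"
  proof (rule conflation_epi[OF c(1)])
    show "g \<cdot> s = (k' \<cdot> e\<^sub>3) \<cdot> s" using gs k'(1) e3 cD by (simp add: in_hom_iff)
  qed (use g k' e3 in \<open>auto simp: in_hom_iff\<close>)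
  then show ?thesis
    using null_Comp_left[OF _ e3(1) k'(1)] MY e3(1) unfolding orthogonal_def by blast
qed

text \<open>
  \<open>Y\<close> is the cone of \<open>q\<close>, and \<open>M\<close> is \<open>A[1]\<close>. In the exact sequence
  \<open>Hom(A[1], N) \<rightarrow> Hom(A[1], X) \<rightarrow> Hom(A[1], Y) \<rightarrow> Hom(A, N) \<rightarrow> Hom(A, X)\<close> of stable Hom groups the
  first arrow is onto by \<open>liftM\<close>. The last one is injective: if \<open>q \<cdot> n\<close> is null, it extends to \<open>I\<close>,
  and lifting the extension by \<open>liftI\<close> changes \<open>n\<close> by a null arrow into one with \<open>q \<cdot> n = 0\<close>, to which
  \<open>killed\<close> applies.
\<close>

lemma orthogonal_cone_of_lifting:
  assumes q: "\<guillemotleft>q : N \<rightarrow> X\<guillemotright>" "\<guillemotleft>x' : B \<rightarrow> N\<guillemotright>"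
    and N: "conflation E N i J \<pi> D" "is_injective E J"
    and y: "conflation E X y Y c D" and q': "\<guillemotleft>q' : J \<rightarrow> Y\<guillemotright>" "q' \<cdot> i = y \<cdot> q" "c \<cdot> q' = \<pi>"
    and A: "conflation E A r I s M" "is_injective E I"
    and liftI: "\<And>f. \<guillemotleft>f : I \<rightarrow> X\<guillemotright> \<Longrightarrow> \<exists>g. \<guillemotleft>g : I \<rightarrow> B\<guillemotright> \<and> (q \<cdot> x') \<cdot> g = f"
    and liftM: "\<And>f. \<guillemotleft>f : M \<rightarrow> X\<guillemotright> \<Longrightarrow> \<exists>g. \<guillemotleft>g : M \<rightarrow> B\<guillemotright> \<and> (q \<cdot> x') \<cdot> g = f"
    and killed: "\<And>n. \<lbrakk>\<guillemotleft>n : A \<rightarrow> N\<guillemotright>; q \<cdot> n = Zero E A X\<rbrakk> \<Longrightarrow> null n"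
  shows "orthogonal M Y"
  unfolding orthogonal_def
proof (intro allI impI)
  fix f assume f: "\<guillemotleft>f : M \<rightarrow> Y\<guillemotright>"
  note AD = conflationD[OF A(1)] and ND = conflationD[OF N(1)] and yD = conflationD[OF y]
  have cfs: "\<guillemotleft>c \<cdot> f \<cdot> s : I \<rightarrow> D\<guillemotright>" using yD f AD by (simp add: in_hom_iff)
  obtain e where e: "\<guillemotleft>e : I \<rightarrow> J\<guillemotright>" "c \<cdot> f \<cdot> s = \<pi> \<cdot> e" using injective_lift[OF A(2) N(1) cfs] .
  have "c \<cdot> f \<cdot> s = c \<cdot> q' \<cdot> e" using e q' yD by (simp add: in_hom_iff q'(3)[THEN post])
  then obtain b where b: "\<guillemotleft>b : I \<rightarrow> X\<guillemotright>" "f \<cdot> s = q' \<cdot> e \<boxplus> y \<cdot> b"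
    using lift_difference[OF y Comp_in_hom[OF AD(2) f] Comp_in_hom[OF e(1) q'(1)]] by blast
  obtain b' where b': "\<guillemotleft>b' : I \<rightarrow> B\<guillemotright>" "q \<cdot> x' \<cdot> b' = b"
    using liftI[OF b(1)] q by (auto simp: in_hom_iff)
  have "\<pi> \<cdot> e \<cdot> r = (c \<cdot> f \<cdot> s) \<cdot> r" using e ND AD by (simp add: in_hom_iff)
  also have "\<dots> = Zero E A D" using yD f AD by (simp add: in_hom_iff)
  finally obtain n where n: "\<guillemotleft>n : A \<rightarrow> N\<guillemotright>" "i \<cdot> n = e \<cdot> r"
    using conflation_lift[OF N(1) Comp_in_hom[OF AD(1) e(1)]] by blast
  have "y \<cdot> (q \<cdot> n \<boxplus> b \<cdot> r) = (q' \<cdot> i) \<cdot> n \<boxplus> y \<cdot> b \<cdot> r"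
    unfolding q'(2) using n(1) b(1) AD yD q(1) by (simp add: in_hom_iff)
  also have "\<dots> = (f \<cdot> s) \<cdot> r"
    unfolding b(2) using n b(1) AD yD q'(1) ND e(1) by (simp add: in_hom_iff)
  also have "\<dots> = y \<cdot> Zero E A X" using f AD yD by (simp add: in_hom_iff)
  finally have qn: "q \<cdot> n \<boxplus> b \<cdot> r = Zero E A X"
    using conflation_mono[OF y, of _ _ A] n(1) b(1) AD q(1) by (simp add: in_hom_iff)
  \<comment> \<open>\<open>q \<cdot> n\<close> is \<open>- b \<cdot> r\<close>, and \<open>b\<close> lifts to \<open>x' \<cdot> b'\<close>; the sum is killed by \<open>q\<close>.\<close>
  have "q \<cdot> (n \<boxplus> x' \<cdot> b' \<cdot> r) = q \<cdot> n \<boxplus> (q \<cdot> x' \<cdot> b') \<cdot> r"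
    using q n(1) b'(1) AD by (simp add: in_hom_iff)
  also have "\<dots> = Zero E A X" using qn b' by simp
  finally have "null (n \<boxplus> x' \<cdot> b' \<cdot> r)"
    using killed[of "n \<boxplus> x' \<cdot> b' \<cdot> r"] q n(1) b'(1) AD by (simp add: in_hom_iff)
  then obtain n\<^sub>1 where n1: "\<guillemotleft>n\<^sub>1 : I \<rightarrow> N\<guillemotright>" "n \<boxplus> x' \<cdot> b' \<cdot> r = n\<^sub>1 \<cdot> r"
    using null_extend[OF _ _ A(1), of "n \<boxplus> x' \<cdot> b' \<cdot> r" N] q n(1) b'(1) AD
    by (auto simp: in_hom_iff)
  obtain n\<^sub>2 where n2: "\<guillemotleft>n\<^sub>2 : I \<rightarrow> N\<guillemotright>" "n\<^sub>1 = x' \<cdot> b' \<boxplus> n\<^sub>2"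
    using difference_exists[OF n1(1) Comp_in_hom[OF b'(1) q(2)]] .
  have "n \<boxplus> x' \<cdot> b' \<cdot> r = n\<^sub>2 \<cdot> r \<boxplus> x' \<cdot> b' \<cdot> r"
    using Plus_commute[of "n\<^sub>2 \<cdot> r" "x' \<cdot> b' \<cdot> r"] n1(2) n2 b'(1) q AD by (simp add: in_hom_iff)
  then have nr: "n = n\<^sub>2 \<cdot> r"
    by (rule Plus_right_cancel) (use n(1) n2(1) b'(1) q AD in \<open>simp_all add: in_hom_iff\<close>)
  \<comment> \<open>\<open>n\<close> extends to \<open>I\<close>, and the extension splits \<open>f\<close> into a null part and a part coming from \<open>X\<close>.\<close>
  have "e \<cdot> r = (i \<cdot> n\<^sub>2) \<cdot> r" using n n2 nr ND AD by (simp add: in_hom_iff)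
  then obtain e' where e': "\<guillemotleft>e' : M \<rightarrow> J\<guillemotright>" "e = i \<cdot> n\<^sub>2 \<boxplus> e' \<cdot> s"
    using desc_difference[OF A(1) e(1) Comp_in_hom[OF n2(1) ND(1)]] by blast
  have qnb: "\<guillemotleft>q \<cdot> n\<^sub>2 \<boxplus> b : I \<rightarrow> X\<guillemotright>" using q n2 b by (simp add: in_hom_iff)
  have "(q \<cdot> n\<^sub>2 \<boxplus> b) \<cdot> r = Zero E A X"
    using qn q(1) n2(1) b(1) AD by (simp add: in_hom_iff nr)
  then obtain w where w: "\<guillemotleft>w : M \<rightarrow> X\<guillemotright>" "w \<cdot> s = q \<cdot> n\<^sub>2 \<boxplus> b"
    using conflation_desc[OF A(1) qnb] by blast
  obtain w' where w': "\<guillemotleft>w' : M \<rightarrow> B\<guillemotright>" "q \<cdot> x' \<cdot> w' = w"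
    using liftM[OF w(1)] q by (auto simp: in_hom_iff)
  have "f = y \<cdot> w \<boxplus> q' \<cdot> e'"
  proof (rule conflation_epi[OF A(1)])
    have "f \<cdot> s = (q' \<cdot> i) \<cdot> n\<^sub>2 \<boxplus> q' \<cdot> e' \<cdot> s \<boxplus> y \<cdot> b"
      using b(1) q'(1) e'(1) n2(1) AD ND yD by (simp add: b(2) e'(2) in_hom_iff)
    also have "\<dots> = y \<cdot> q \<cdot> n\<^sub>2 \<boxplus> (y \<cdot> b \<boxplus> q' \<cdot> e' \<cdot> s)"
      unfolding q'(2) using b(1) q'(1) e'(1) n2(1) AD yD q(1)
        Plus_commute[of "q' \<cdot> e' \<cdot> s" "y \<cdot> b"] by (simp add: in_hom_iff Plus_assoc)
    also have "\<dots> = (y \<cdot> w \<boxplus> q' \<cdot> e') \<cdot> s"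
      using b(1) q'(1) e'(1) n2(1) AD yD q(1) w by (simp add: in_hom_iff Plus_assoc)
    finally show "f \<cdot> s = (y \<cdot> w \<boxplus> q' \<cdot> e') \<cdot> s" .
  qed (use f yD w q' e' in \<open>auto simp: in_hom_iff\<close>)
  \<comment> \<open>\<open>w\<close> lifts to \<open>N\<close>, and \<open>y \<cdot> q\<close> factors through the injective object \<open>J\<close>.\<close>
  also have "y \<cdot> w = q' \<cdot> i \<cdot> x' \<cdot> w'"
    using yD q w' q' ND by (simp add: in_hom_iff q'(2)[THEN post] flip: w'(2))
  finally have "f = q' \<cdot> (i \<cdot> x' \<cdot> w' \<boxplus> e')"
    using q'(1) ND q w'(1) e'(1) by (simp add: in_hom_iff)
  moreover have "\<guillemotleft>i \<cdot> x' \<cdot> w' \<boxplus> e' : M \<rightarrow> J\<guillemotright>"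
    using ND q w'(1) e'(1) by (simp add: in_hom_iff)
  ultimately show "null f" using nullI[OF N(2) _ q'(1)] by simp
qed

text \<open>
  \<open>K\<close> is \<open>D[-1]\<close>, and \<open>\<epsilon>\<close> is the arrow \<open>D[-1] \<rightarrow> X\<close> of the triangle of the conflation. The two properties
  express that \<open>\<epsilon>\<close> induces a surjection \<open>Hom(Z, K) \<rightarrow> Hom(Z, X)\<close> of stable Hom groups if
  \<open>Hom(Z, Y) = 0\<close> and an injection if \<open>Hom(Z[1], Y) = 0\<close>.
\<close>

lemma fibre_coreflection:
  assumes x: "conflation E X x Y v D" and K: "conflation E K \<kappa> P \<pi> D" "is_injective E P"
  obtains \<epsilon> where "\<guillemotleft>\<epsilon> : K \<rightarrow> X\<guillemotright>"
    "\<And>Z f. \<lbrakk>orthogonal Z Y; \<guillemotleft>f : Z \<rightarrow> X\<guillemotright>\<rbrakk> \<Longrightarrow>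
       \<exists>n t. \<guillemotleft>n : Z \<rightarrow> K\<guillemotright> \<and> \<guillemotleft>t : Z \<rightarrow> X\<guillemotright> \<and> null t \<and> f = \<epsilon> \<cdot> n \<boxplus> t"
    "\<And>Z i J s M n. \<lbrakk>conflation E Z i J s M; is_injective E J; orthogonal M Y;
       \<guillemotleft>n : Z \<rightarrow> K\<guillemotright>; null (\<epsilon> \<cdot> n)\<rbrakk> \<Longrightarrow> null n"
proof -
  note xD = conflationD[OF x] and KD = conflationD[OF K(1)]
  obtain l where l: "\<guillemotleft>l : P \<rightarrow> Y\<guillemotright>" "\<pi> = v \<cdot> l" using injective_lift[OF K(2) x KD(2)] .
  have "v \<cdot> l \<cdot> \<kappa> = Zero E K D" using KD xD l by (simp add: in_hom_iff)
  then obtain \<epsilon> where \<epsilon>: "\<guillemotleft>\<epsilon> : K \<rightarrow> X\<guillemotright>" "x \<cdot> \<epsilon> = l \<cdot> \<kappa>"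
    using conflation_lift[OF x Comp_in_hom[OF KD(1) l(1)]] by blast
  have 1: "\<exists>n t. \<guillemotleft>n : Z \<rightarrow> K\<guillemotright> \<and> \<guillemotleft>t : Z \<rightarrow> X\<guillemotright> \<and> null t \<and> f = \<epsilon> \<cdot> n \<boxplus> t"
    if Z: "orthogonal Z Y" and f: "\<guillemotleft>f : Z \<rightarrow> X\<guillemotright>" for Z f
  proof -
    have xf: "\<guillemotleft>x \<cdot> f : Z \<rightarrow> Y\<guillemotright>" using Comp_in_hom[OF f xD(1)] .
    obtain J j h where J: "is_injective E J" "\<guillemotleft>j : Z \<rightarrow> J\<guillemotright>" "\<guillemotleft>h : J \<rightarrow> Y\<guillemotright>" "x \<cdot> f = h \<cdot> j"
      using nullE[OF _ xf] Z xf unfolding orthogonal_def by blast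
    obtain m where m: "\<guillemotleft>m : J \<rightarrow> P\<guillemotright>" "v \<cdot> h = \<pi> \<cdot> m"
      using injective_lift[OF J(1) K(1) Comp_in_hom[OF J(3) xD(2)]] .
    have "\<pi> \<cdot> m \<cdot> j = v \<cdot> h \<cdot> j" using m J xD KD by (simp add: in_hom_iff m(2)[THEN post])
    also have "\<dots> = Zero E Z D" using xD f by (simp add: in_hom_iff xD(3)[THEN post] flip: J(4))
    finally obtain n where n: "\<guillemotleft>n : Z \<rightarrow> K\<guillemotright>" "\<kappa> \<cdot> n = m \<cdot> j"
      using conflation_lift[OF K(1) Comp_in_hom[OF J(2) m(1)]] by blast
    have "v \<cdot> h = v \<cdot> l \<cdot> m" using m l xD by (simp add: in_hom_iff)
    then obtain r where r: "\<guillemotleft>r : J \<rightarrow> X\<guillemotright>" "h = l \<cdot> m \<boxplus> x \<cdot> r"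
      using lift_difference[OF x J(3) Comp_in_hom[OF m(1) l(1)]] by blast
    have "f = \<epsilon> \<cdot> n \<boxplus> r \<cdot> j"
    proof (rule conflation_mono[OF x])
      have "x \<cdot> (\<epsilon> \<cdot> n \<boxplus> r \<cdot> j) = l \<cdot> m \<cdot> j \<boxplus> x \<cdot> r \<cdot> j"
        using \<epsilon>(1) n xD r(1) J(2) l(1) KD by (simp add: in_hom_iff \<epsilon>(2)[THEN post])
      also have "\<dots> = x \<cdot> f"
        using m(1) xD r J l(1) by (simp add: in_hom_iff)
      finally show "x \<cdot> f = x \<cdot> (\<epsilon> \<cdot> n \<boxplus> r \<cdot> j)" by simp
    qed (use f \<epsilon> n r J in \<open>auto simp: in_hom_iff\<close>)
    then show ?thesis using n r J nullI Comp_in_hom by blast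
  qed
  have 2: "null n" if Z: "conflation E Z i J s M" "is_injective E J" and M: "orthogonal M Y"
    and n: "\<guillemotleft>n : Z \<rightarrow> K\<guillemotright>" "null (\<epsilon> \<cdot> n)" for Z i J s M n
  proof -
    note ZD = conflationD[OF Z(1)]
    obtain e where e: "\<guillemotleft>e : J \<rightarrow> P\<guillemotright>" "\<kappa> \<cdot> n = e \<cdot> i"
      using injective_extend[OF K(2) Z(1) Comp_in_hom[OF n(1) KD(1)]] .
    obtain b where b: "\<guillemotleft>b : J \<rightarrow> X\<guillemotright>" "\<epsilon> \<cdot> n = b \<cdot> i"
      using null_extend[OF n(2) Comp_in_hom[OF n(1) \<epsilon>(1)] Z(1)] .
    have "(l \<cdot> e) \<cdot> i = (l \<cdot> \<kappa>) \<cdot> n" using l(1) e KD n(1) ZD by (simp add: in_hom_iff)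
    also have "\<dots> = (x \<cdot> b) \<cdot> i"
      unfolding \<epsilon>(2)[symmetric] using \<epsilon>(1) n(1) b xD ZD by (simp add: in_hom_iff)
    finally obtain y where y: "\<guillemotleft>y : M \<rightarrow> Y\<guillemotright>" "l \<cdot> e = x \<cdot> b \<boxplus> y \<cdot> s"
      using desc_difference[OF Z(1) Comp_in_hom[OF e(1) l(1)] Comp_in_hom[OF b(1) xD(1)]] by blast
    have vy: "\<guillemotleft>v \<cdot> y : M \<rightarrow> D\<guillemotright>" using Comp_in_hom[OF y(1) xD(2)] .
    have "null y" using M y(1) by (simp add: orthogonal_def)
    then obtain g where g: "\<guillemotleft>g : M \<rightarrow> P\<guillemotright>" "v \<cdot> y = \<pi> \<cdot> g"
      using null_lift[OF null_Comp_left[OF _ y(1) xD(2)] vy K(1)] by blast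
    have "\<pi> \<cdot> e = v \<cdot> (x \<cdot> b \<boxplus> y \<cdot> s)" using l e(1) xD by (simp add: in_hom_iff flip: y(2))
    also have "\<dots> = \<pi> \<cdot> g \<cdot> s"
      using y(1) b(1) xD KD g ZD
      by (simp add: in_hom_iff xD(3)[THEN post] g(2)[THEN post])
    finally obtain n' where n': "\<guillemotleft>n' : J \<rightarrow> K\<guillemotright>" "e = g \<cdot> s \<boxplus> \<kappa> \<cdot> n'"
      using lift_difference[OF K(1) e(1) Comp_in_hom[OF ZD(2) g(1)]] by blast
    have "n = n' \<cdot> i"
    proof (rule conflation_mono[OF K(1)])
      show "\<kappa> \<cdot> n = \<kappa> \<cdot> n' \<cdot> i" using e n' ZD KD g(1) by (simp add: in_hom_iff)
    qed (use n n' ZD in \<open>auto simp: in_hom_iff\<close>)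
    then show ?thesis using nullI[OF Z(2) ZD(1) n'(1)] by simp
  qed
  show ?thesis using that[OF \<epsilon>(1)] 1 2 by blast
qed

end

section \<open>The stable category\<close>

locale frobenius_hulls = frobenius_category E
  for E :: "('o, 'm, 'z) exactcat_scheme" (structure) +
  fixes H :: "('o, 'm) hulls"
  assumes hulls: "injective_hulls E H"
begin

abbreviation T :: "('o, 'm set) tricat" where
  "T \<equiv> stable_category E H"

lemma hull:
  assumes "X \<in> Obj E"
  shows "conflation E X (inj_arr H X) (Inj H X) (susp_arr H X) (Susp H X)"
    and "is_injective E (Inj H X)" and "Inj H X \<in> Obj E" and "Susp H X \<in> Obj E"
  using hulls assms by (auto simp: injective_hulls_def is_injective_def conflation_def)

lemma T_simps [simp]:
  "Obj T = Obj E" "Hom T A B = Hom E A B // stable_rel E" "Ident T A = stable_class E (Ident E A)"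
  "ShO T = Susp H" "ShM T = stable_shift E H" "Tri T = stable_triangles E H"
  by (simp_all add: stable_category_def addcat.defs stable_addcat_def)

lemma stable_addcat_simps [simp]:
  "Hom (stable_addcat E) A B = Hom E A B // stable_rel E"
  "Ident (stable_addcat E) A = stable_class E (Ident E A)"
  "F \<cdot>\<^bsub>stable_addcat E\<^esub> G = F \<cdot>\<^bsub>T\<^esub> G"
  by (simp_all add: stable_category_def addcat.defs stable_addcat_def)

lemma is_iso_stable_addcat [simp]: "is_iso (stable_addcat E) A B F \<longleftrightarrow> is_iso T A B F"
  by (simp add: is_iso_def)

lemma stable_rel_iff:
  "(f, g) \<in> stable_rel E \<longleftrightarrow>
     (\<exists>A B t. \<guillemotleft>f : A \<rightarrow> B\<guillemotright> \<and> \<guillemotleft>t : A \<rightarrow> B\<guillemotright> \<and> null t \<and> g = f \<boxplus> t)"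
proof
  assume "(f, g) \<in> stable_rel E"
  then obtain A B J a b where *: "\<guillemotleft>f : A \<rightarrow> B\<guillemotright>" "is_injective E J" "\<guillemotleft>a : A \<rightarrow> J\<guillemotright>" "\<guillemotleft>b : J \<rightarrow> B\<guillemotright>"
    "g = f \<boxplus> b \<cdot> a"
    unfolding stable_rel_def in_hom_def is_injective_def by blast
  then show "\<exists>A B t. \<guillemotleft>f : A \<rightarrow> B\<guillemotright> \<and> \<guillemotleft>t : A \<rightarrow> B\<guillemotright> \<and> null t \<and> g = f \<boxplus> t"
    using Comp_in_hom nullI by blast
next
  assume "\<exists>A B t. \<guillemotleft>f : A \<rightarrow> B\<guillemotright> \<and> \<guillemotleft>t : A \<rightarrow> B\<guillemotright> \<and> null t \<and> g = f \<boxplus> t"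
  then obtain A B t where *: "\<guillemotleft>f : A \<rightarrow> B\<guillemotright>" "\<guillemotleft>t : A \<rightarrow> B\<guillemotright>" "null t" "g = f \<boxplus> t" by blast
  obtain J a b where "is_injective E J" "\<guillemotleft>a : A \<rightarrow> J\<guillemotright>" "\<guillemotleft>b : J \<rightarrow> B\<guillemotright>" "t = b \<cdot> a"
    using nullE[OF *(3,2)] .
  then show "(f, g) \<in> stable_rel E"
    using * Plus_in_hom[OF *(1,2)] unfolding stable_rel_def in_hom_def by blast
qed

lemma stable_relI: "\<lbrakk>\<guillemotleft>f : A \<rightarrow> B\<guillemotright>; \<guillemotleft>t : A \<rightarrow> B\<guillemotright>; null t\<rbrakk> \<Longrightarrow> (f, f \<boxplus> t) \<in> stable_rel E"
  unfolding stable_rel_iff by blast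

lemma stable_relE:
  assumes "(f, g) \<in> stable_rel E" "\<guillemotleft>f : A \<rightarrow> B\<guillemotright>"
  obtains t where "\<guillemotleft>t : A \<rightarrow> B\<guillemotright>" "null t" "g = f \<boxplus> t" "\<guillemotleft>g : A \<rightarrow> B\<guillemotright>"
  using assms unfolding stable_rel_iff by (metis in_hom_unique Plus_in_hom)

lemma stable_rel_refl: "\<guillemotleft>f : A \<rightarrow> B\<guillemotright> \<Longrightarrow> (f, f) \<in> stable_rel E"
  using stable_relI[of f A B "Zero E A B"] null_Zero by (simp add: in_hom_iff)

lemma sym_stable_rel: "sym (stable_rel E)"
proof (rule symI)
  fix f g assume "(f, g) \<in> stable_rel E"
  then obtain A B t where *: "\<guillemotleft>f : A \<rightarrow> B\<guillemotright>" "\<guillemotleft>t : A \<rightarrow> B\<guillemotright>" "null t" "g = f \<boxplus> t"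
    unfolding stable_rel_iff by blast
  obtain t' where t': "null t'" "\<guillemotleft>t' : A \<rightarrow> B\<guillemotright>" "t \<boxplus> t' = Zero E A B" using null_inverse[OF *(3,2)] .
  have "f = g \<boxplus> t'" using * t' by (simp add: in_hom_iff Plus_assoc)
  then show "(g, f) \<in> stable_rel E"
    using stable_relI[of g A B t'] * t' by (simp add: in_hom_iff)
qed

lemma trans_stable_rel: "trans (stable_rel E)"
proof (rule transI)
  fix f g h assume fg: "(f, g) \<in> stable_rel E" and gh: "(g, h) \<in> stable_rel E"
  then obtain A B t where *: "\<guillemotleft>f : A \<rightarrow> B\<guillemotright>" "\<guillemotleft>t : A \<rightarrow> B\<guillemotright>" "null t" "g = f \<boxplus> t"
    unfolding stable_rel_iff by blast
  then have "\<guillemotleft>g : A \<rightarrow> B\<guillemotright>" using Plus_in_hom by simp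
  then obtain t' where t': "\<guillemotleft>t' : A \<rightarrow> B\<guillemotright>" "null t'" "h = g \<boxplus> t'" using stable_relE[OF gh] by blast
  have "h = f \<boxplus> (t \<boxplus> t')" using * t' by (simp add: in_hom_iff Plus_assoc)
  then show "(f, h) \<in> stable_rel E"
    using stable_relI[OF *(1) Plus_in_hom[OF *(2) t'(1)]] null_Plus[OF *(3) t'(2) *(2) t'(1)] by simp
qed

lemma stable_class_eq_iff:
  assumes "\<guillemotleft>f : A \<rightarrow> B\<guillemotright>"
  shows "stable_class E f = stable_class E g \<longleftrightarrow> (f, g) \<in> stable_rel E"
proof
  assume "stable_class E f = stable_class E g"
  then have "(g, f) \<in> stable_rel E" using stable_rel_refl[OF assms] unfolding stable_class_def by blast
  then show "(f, g) \<in> stable_rel E" using sym_stable_rel by (blast dest: symD)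
next
  assume "(f, g) \<in> stable_rel E"
  then show "stable_class E f = stable_class E g"
    using sym_stable_rel trans_stable_rel unfolding stable_class_def
    by (blast dest: symD transD)
qed

lemma stable_class_in_Hom: "\<guillemotleft>f : A \<rightarrow> B\<guillemotright> \<Longrightarrow> stable_class E f \<in> Hom E A B // stable_rel E"
  unfolding stable_class_def in_hom_def by (simp add: quotientI)

lemma Hom_stableE:
  assumes "F \<in> Hom E A B // stable_rel E" "A \<in> Obj E" "B \<in> Obj E"
  obtains f where "\<guillemotleft>f : A \<rightarrow> B\<guillemotright>" "F = stable_class E f"
  using assms by (auto simp: stable_class_def in_hom_def elim!: quotientE)

lemma in_stable_class:
  assumes "\<guillemotleft>f : A \<rightarrow> B\<guillemotright>"
  shows "f' \<in> stable_class E f \<longleftrightarrow> (\<exists>t. \<guillemotleft>t : A \<rightarrow> B\<guillemotright> \<and> null t \<and> f' = f \<boxplus> t)"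
  using assms stable_relE[OF _ assms] stable_relI[OF assms] unfolding stable_class_def by blast

lemma stable_rel_Comp:
  assumes "(f, f') \<in> stable_rel E" "(g, g') \<in> stable_rel E" "\<guillemotleft>f : A \<rightarrow> B\<guillemotright>" "\<guillemotleft>g : B \<rightarrow> D\<guillemotright>"
  shows "(g \<cdot> f, g' \<cdot> f') \<in> stable_rel E"
proof -
  obtain t where t: "\<guillemotleft>t : A \<rightarrow> B\<guillemotright>" "null t" "f' = f \<boxplus> t" "\<guillemotleft>f' : A \<rightarrow> B\<guillemotright>"
    using stable_relE[OF assms(1,3)] .
  obtain u where u: "\<guillemotleft>u : B \<rightarrow> D\<guillemotright>" "null u" "g' = g \<boxplus> u"
    using stable_relE[OF assms(2,4)] by blast
  have "g' \<cdot> f' = g \<cdot> f' \<boxplus> u \<cdot> f'" using t(4) u assms by (simp add: in_hom_iff)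
  also have "g \<cdot> f' = g \<cdot> f \<boxplus> g \<cdot> t" using t assms by (simp add: in_hom_iff)
  finally have "g' \<cdot> f' = g \<cdot> f \<boxplus> (g \<cdot> t \<boxplus> u \<cdot> f')"
    using t u assms by (simp add: in_hom_iff Plus_assoc del: Comp_Plus)
  moreover have "null (g \<cdot> t \<boxplus> u \<cdot> f')" "\<guillemotleft>g \<cdot> t \<boxplus> u \<cdot> f' : A \<rightarrow> D\<guillemotright>"
    using t(1,2,4) u(1,2) assms
    by (blast intro: null_Plus null_Comp_left null_Comp_right Comp_in_hom Plus_in_hom)+
  ultimately show ?thesis using stable_relI[OF Comp_in_hom[OF assms(3,4)]] by simp
qed

lemma Comp_stable:
  assumes f: "\<guillemotleft>f : A \<rightarrow> B\<guillemotright>" and g: "\<guillemotleft>g : B \<rightarrow> D\<guillemotright>"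
  shows "stable_class E g \<cdot>\<^bsub>T\<^esub> stable_class E f = stable_class E (g \<cdot> f)"
proof -
  have "stable_class E (g' \<cdot> f') = stable_class E (g \<cdot> f)"
    if "g' \<in> stable_class E g" "f' \<in> stable_class E f" for f' g'
    using stable_rel_Comp[OF _ _ f g, of f' g'] that stable_class_eq_iff[OF Comp_in_hom[OF f g]]
    unfolding stable_class_def by auto
  moreover have "g \<in> stable_class E g" "f \<in> stable_class E f"
    using f g stable_rel_refl unfolding stable_class_def by auto
  moreover have "stable_class E g \<cdot>\<^bsub>T\<^esub> stable_class E f =
      (\<Union>g'\<in>stable_class E g. \<Union>f'\<in>stable_class E f. stable_class E (g' \<cdot> f'))"
    by (simp add: stable_category_def addcat.defs stable_addcat_def)
  ultimately show ?thesis by blast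
qed

sublocale stable: category T
proof unfold_locales
  fix A B A' B' F
  assume *: "A \<in> Obj T" "B \<in> Obj T" "A' \<in> Obj T" "B' \<in> Obj T" "F \<in> Hom T A B" "F \<in> Hom T A' B'"
  then obtain f f' where f: "\<guillemotleft>f : A \<rightarrow> B\<guillemotright>" "F = stable_class E f"
    and f': "\<guillemotleft>f' : A' \<rightarrow> B'\<guillemotright>" "F = stable_class E f'"
    by (auto elim!: Hom_stableE)
  then show "A = A' \<and> B = B'"
    using stable_class_eq_iff[OF f(1), of f'] stable_relE[OF _ f(1), of f'] in_hom_unique by metis
next
  fix A assume "A \<in> Obj T"
  then show "Ident T A \<in> Hom T A A" using stable_class_in_Hom[OF Ident_in_hom] by simp
next
  fix A B D F G assume "A \<in> Obj T" "B \<in> Obj T" "D \<in> Obj T" "F \<in> Hom T A B" "G \<in> Hom T B D"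
  then show "G \<cdot>\<^bsub>T\<^esub> F \<in> Hom T A D"
    by (auto elim!: Hom_stableE simp: Comp_stable intro!: stable_class_in_Hom Comp_in_hom)
next
  fix A B F assume "A \<in> Obj T" "B \<in> Obj T" "F \<in> Hom T A B"
  then obtain f where f: "\<guillemotleft>f : A \<rightarrow> B\<guillemotright>" "F = stable_class E f" by (auto elim!: Hom_stableE)
  then have "A \<in> Obj E" "B \<in> Obj E" by (simp_all add: in_hom_def)
  then show "F \<cdot>\<^bsub>T\<^esub> Ident T A = F" "Ident T B \<cdot>\<^bsub>T\<^esub> F = F"
    using f Comp_stable[OF Ident_in_hom f(1)] Comp_stable[OF f(1) Ident_in_hom]
    by (simp_all add: in_hom_iff)
next
  fix A B D K F G L
  assume "A \<in> Obj T" "B \<in> Obj T" "D \<in> Obj T" "K \<in> Obj T"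
    "F \<in> Hom T A B" "G \<in> Hom T B D" "L \<in> Hom T D K"
  then obtain f g l where f: "\<guillemotleft>f : A \<rightarrow> B\<guillemotright>" "F = stable_class E f"
    and g: "\<guillemotleft>g : B \<rightarrow> D\<guillemotright>" "G = stable_class E g" and l: "\<guillemotleft>l : D \<rightarrow> K\<guillemotright>" "L = stable_class E l"
    by (auto elim!: Hom_stableE)
  show "(L \<cdot>\<^bsub>T\<^esub> G) \<cdot>\<^bsub>T\<^esub> F = L \<cdot>\<^bsub>T\<^esub> G \<cdot>\<^bsub>T\<^esub> F"
    unfolding f(2) g(2) l(2) Comp_stable[OF f(1) g(1)] Comp_stable[OF g(1) l(1)]
      Comp_stable[OF f(1) Comp_in_hom[OF g(1) l(1)]] Comp_stable[OF Comp_in_hom[OF f(1) g(1)] l(1)]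
    using f g l by (simp add: in_hom_iff)
qed

lemma isomorphic_stable:
  assumes "A \<in> Obj E" "B \<in> Obj E"
  shows "isomorphic T A B \<longleftrightarrow> stably_iso A B"
proof
  assume "isomorphic T A B"
  then obtain F G where F: "F \<in> Hom T A B" "G \<in> Hom T B A"
    and FG: "G \<cdot>\<^bsub>T\<^esub> F = Ident T A" "F \<cdot>\<^bsub>T\<^esub> G = Ident T B"
    unfolding isomorphic_def is_iso_def by blast
  then obtain f g where f: "\<guillemotleft>f : A \<rightarrow> B\<guillemotright>" "F = stable_class E f" and g: "\<guillemotleft>g : B \<rightarrow> A\<guillemotright>" "G = stable_class E g"
    using assms by (auto elim!: Hom_stableE)
  have 1: "(g \<cdot> f, Ident E A) \<in> stable_rel E" and 2: "(f \<cdot> g, Ident E B) \<in> stable_rel E"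
    using FG f g Comp_stable[OF f(1) g(1)] Comp_stable[OF g(1) f(1)]
      stable_class_eq_iff[OF Comp_in_hom[OF f(1) g(1)]] stable_class_eq_iff[OF Comp_in_hom[OF g(1) f(1)]]
    by simp_all
  show "stably_iso A B"
    unfolding stably_iso_def
    using stable_relE[OF 1 Comp_in_hom[OF f(1) g(1)]] stable_relE[OF 2 Comp_in_hom[OF g(1) f(1)]] f(1) g(1)
    by metis
next
  assume "stably_iso A B"
  then obtain f g t t' where f: "\<guillemotleft>f : A \<rightarrow> B\<guillemotright>" and g: "\<guillemotleft>g : B \<rightarrow> A\<guillemotright>"
    and t: "\<guillemotleft>t : A \<rightarrow> A\<guillemotright>" "null t" "Ident E A = g \<cdot> f \<boxplus> t"
    and t': "\<guillemotleft>t' : B \<rightarrow> B\<guillemotright>" "null t'" "Ident E B = f \<cdot> g \<boxplus> t'"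
    unfolding stably_iso_def by blast
  note gf = Comp_in_hom[OF f g] and fg = Comp_in_hom[OF g f]
  have "stable_class E (g \<cdot> f) = stable_class E (Ident E A)"
    "stable_class E (f \<cdot> g) = stable_class E (Ident E B)"
    unfolding stable_class_eq_iff[OF gf] stable_class_eq_iff[OF fg]
    using stable_relI[OF gf t(1,2)] stable_relI[OF fg t'(1,2)] t(3) t'(3) by simp_all
  then have "is_iso T A B (stable_class E f)"
    unfolding is_iso_def
    using stable_class_in_Hom[OF f] stable_class_in_Hom[OF g] Comp_stable[OF f g] Comp_stable[OF g f]
    by force
  then show "isomorphic T A B" unfolding isomorphic_def by blast
qed

text \<open>
  The identity is one lift of the identity. Any other lift of an arrow in its stable class
  differs from it by an arrow that factors through \<open>Inj H X\<close>.
\<close>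

lemma stable_shift_Ident:
  assumes X: "X \<in> Obj E"
  shows "stable_shift E H (stable_class E (Ident E X)) = stable_class E (Ident E (Susp H X))"
proof -
  let ?i = "inj_arr H X" and ?s = "susp_arr H X"
  note h = hull[OF X]
  note hD = conflationD[OF h(1)]
  note id = Ident_in_hom[OF h(4)]
  have "(Ident E (Susp H X), g) \<in> stable_rel E"
    if AB: "A \<in> Obj E" "B \<in> Obj E" and f: "f \<in> stable_class E (Ident E X)" and l: "susp_lift E H A B f g" for A B f g
  proof -
    obtain t where t: "\<guillemotleft>t : X \<rightarrow> X\<guillemotright>" "null t" "f = Ident E X \<boxplus> t"
      using f in_stable_class[OF Ident_in_hom[OF X]] by blast
    have "\<guillemotleft>f : X \<rightarrow> X\<guillemotright>" using t X by (simp add: in_hom_iff)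
    moreover have "\<guillemotleft>f : A \<rightarrow> B\<guillemotright>" using AB l by (simp add: susp_lift_def in_hom_def)
    ultimately have [simp]: "A = X" "B = X" using in_hom_unique by blast+
    obtain k where k: "\<guillemotleft>k : Inj H X \<rightarrow> Inj H X\<guillemotright>" "k \<cdot> ?i = ?i \<cdot> f" "g \<cdot> ?s = ?s \<cdot> k" and g: "\<guillemotleft>g : Susp H X \<rightarrow> Susp H X\<guillemotright>"
      using l h(3,4) by (auto simp: susp_lift_def in_hom_def)
    obtain t' where t': "\<guillemotleft>t' : Inj H X \<rightarrow> X\<guillemotright>" "t = t' \<cdot> ?i" using null_extend[OF t(2,1) h(1)] .
    have k1: "\<guillemotleft>Ident E (Inj H X) \<boxplus> ?i \<cdot> t' : Inj H X \<rightarrow> Inj H X\<guillemotright>"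
      using h(3) t' hD by (simp add: in_hom_iff)
    have "k \<cdot> ?i = (Ident E (Inj H X) \<boxplus> ?i \<cdot> t') \<cdot> ?i"
      using k t t' hD X by (simp add: in_hom_iff)
    then obtain m where m: "\<guillemotleft>m : Susp H X \<rightarrow> Inj H X\<guillemotright>" "k = Ident E (Inj H X) \<boxplus> ?i \<cdot> t' \<boxplus> m \<cdot> ?s"
      using desc_difference[OF h(1) k(1) k1] by blast
    have "g = Ident E (Susp H X) \<boxplus> ?s \<cdot> m"
    proof (rule conflation_epi[OF h(1)])
      show "g \<cdot> ?s = (Ident E (Susp H X) \<boxplus> ?s \<cdot> m) \<cdot> ?s"
        using m t' hD by (simp add: k(3) in_hom_iff hD(3)[THEN post])
    qed (use g m hD in \<open>auto simp: in_hom_iff\<close>)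
    then show ?thesis
      using stable_relI[OF id Comp_in_hom[OF m(1) hD(2)] nullI[OF h(2) m(1) hD(2)]] by simp
  qed
  moreover have "susp_lift E H X X (Ident E X) (Ident E (Susp H X))"
    using hD X h(3,4) Ident_in_Hom unfolding susp_lift_def
    by (auto simp: in_hom_iff intro!: bexI[of _ "Ident E (Inj H X)"])
  moreover have "Ident E X \<in> stable_class E (Ident E X)"
    using stable_rel_refl[OF Ident_in_hom[OF X]] by (simp add: stable_class_def)
  ultimately show ?thesis
    using X trans_stable_rel unfolding stable_shift_def stable_class_def
    by (blast dest: transD)
qed

text \<open>
  A standard triangle is distinguished, via identities; \<open>stable_shift_Ident\<close> provides the commuting
  square at the connecting arrow.
\<close>

lemma conflation_gives_triangle:
  assumes c: "conflation E X u Y v Z"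
  obtains U V W where "U \<in> Hom T X Y" "V \<in> Hom T Y Z" "W \<in> Hom T Z (ShO T X)" "(U, V, W) \<in> Tri T"
proof -
  note cD = conflationD[OF c]
  have XYZ: "X \<in> Obj E" "Y \<in> Obj E" "Z \<in> Obj E" using cD by (auto simp: in_hom_def)
  note h = hull[OF XYZ(1)]
  note hD = conflationD[OF h(1)]
  obtain k where k: "\<guillemotleft>k : Y \<rightarrow> Inj H X\<guillemotright>" "inj_arr H X = k \<cdot> u" using injective_extend[OF h(2) c hD(1)] .
  have "(susp_arr H X \<cdot> k) \<cdot> u = Zero E X (Susp H X)" using hD cD k by (simp add: in_hom_iff)
  then obtain w where w: "\<guillemotleft>w : Z \<rightarrow> Susp H X\<guillemotright>" "w \<cdot> v = susp_arr H X \<cdot> k"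
    using conflation_desc[OF c Comp_in_hom[OF k(1) hD(2)]] by blast
  have std: "standard_triangle E H X Y Z u v w"
    unfolding standard_triangle_def using c k w by (auto simp: in_hom_def)
  have comps: "Ident T B \<cdot>\<^bsub>T\<^esub> stable_class E f = stable_class E f \<cdot>\<^bsub>T\<^esub> Ident T A" if "\<guillemotleft>f : A \<rightarrow> B\<guillemotright>" for f A B
    using stable.Comp_Ident_left[of A B "stable_class E f"] stable.Comp_Ident_right[of A B "stable_class E f"]
      stable_class_in_Hom[OF that] that by (simp add: in_hom_def)
  have iso: "is_iso T A A (Ident T A)" if "A \<in> Obj E" for A
    using that stable.Ident_in_Hom[of A] stable.Comp_Ident_left[of A A "Ident T A"]
    unfolding is_iso_def by force
  have "(stable_class E u, stable_class E v, stable_class E w) \<in> Tri T"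
    unfolding T_simps stable_triangles_def mem_Collect_eq split_conv is_iso_stable_addcat
      stable_addcat_simps
    apply (rule bexI[OF _ XYZ(1)], rule bexI[OF _ XYZ(2)], rule bexI[OF _ XYZ(3)])
    apply (rule exI[of _ X], rule exI[of _ Y], rule exI[of _ Z])
    apply (rule exI[of _ u], rule exI[of _ v], rule exI[of _ w])
    apply (rule exI[of _ "Ident T X"], rule exI[of _ "Ident T Y"], rule exI[of _ "Ident T Z"])
    using std iso XYZ comps[OF cD(1)] comps[OF cD(2)] comps[OF w(1)]
      stable_class_in_Hom[OF cD(1)] stable_class_in_Hom[OF cD(2)] stable_class_in_Hom[OF w(1)]
      stable_shift_Ident[OF XYZ(1)] by simp
  then show ?thesis
    using that stable_class_in_Hom[OF cD(1)] stable_class_in_Hom[OF cD(2)] stable_class_in_Hom[OF w(1)]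
    by simp
qed

lemma triangle_from_conflation:
  assumes "(U, V, W) \<in> Tri T" "X \<in> Obj E" "Y \<in> Obj E" "Z \<in> Obj E"
    "U \<in> Hom T X Y" "V \<in> Hom T Y Z"
  obtains X' u Y' v Z' where "conflation E X' u Y' v Z'"
    "stably_iso X' X" "stably_iso Y' Y" "stably_iso Z' Z"
proof -
  obtain X\<^sub>1 Y\<^sub>1 Z\<^sub>1 X' Y' Z' u v w a b c where *: "X\<^sub>1 \<in> Obj T" "Y\<^sub>1 \<in> Obj T" "Z\<^sub>1 \<in> Obj T"
    "U \<in> Hom T X\<^sub>1 Y\<^sub>1" "V \<in> Hom T Y\<^sub>1 Z\<^sub>1"
    "standard_triangle E H X' Y' Z' u v w"
    "is_iso T X' X\<^sub>1 a" "is_iso T Y' Y\<^sub>1 b" "is_iso T Z' Z\<^sub>1 c"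
    using assms(1) unfolding T_simps stable_triangles_def mem_Collect_eq split_conv is_iso_stable_addcat
      stable_addcat_simps by blast
  have "X\<^sub>1 = X" "Y\<^sub>1 = Y" "Z\<^sub>1 = Z"
    using stable.Hom_disjoint[OF *(1,2) _ _ *(4), of X Y] stable.Hom_disjoint[OF *(2,3) _ _ *(5), of Y Z]
      assms by simp_all
  moreover have c: "conflation E X' u Y' v Z'" using *(6) by (simp add: standard_triangle_def)
  then have "X' \<in> Obj E" "Y' \<in> Obj E" "Z' \<in> Obj E" by (simp_all add: conflation_def)
  ultimately show ?thesis
    using that[OF c] * assms isomorphic_stable unfolding isomorphic_def by blast
qed

text \<open>
  Closure under shifts of the left orthogonal class in both directions comes from the two closure
  properties of \<open>\<Y>\<close>. An arrow out of a coproduct vanishes if it does so on each summand, by the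
  uniqueness part of the universal property.
\<close>

lemma localizing_left_orthogonal:
  assumes Y: "\<Y> \<subseteq> Obj E" and susp: "\<And>Y. Y \<in> \<Y> \<Longrightarrow> Susp H Y \<in> \<Y>"
    and desusp: "\<And>Y. Y \<in> \<Y> \<Longrightarrow> \<exists>K \<kappa> P \<pi>. conflation E K \<kappa> P \<pi> Y \<and> is_injective E P \<and> K \<in> \<Y>"
  shows "localizing_subcategory T {Z \<in> Obj E. \<forall>Y\<in>\<Y>. orthogonal Z Y}" (is "localizing_subcategory T ?L")
proof -
  have iso: "B \<in> ?L" if "A \<in> ?L" "stably_iso A B" for A B
  proof -
    have "B \<in> Obj E" using that(2) unfolding stably_iso_def in_hom_def by blast
    then show ?thesis using that orthogonal_stably_iso by blast
  qed
  have shift: "Z \<in> ?L \<longleftrightarrow> Susp H Z \<in> ?L" if Z: "Z \<in> Obj E" for Z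
  proof -
    note h = hull[OF Z]
    have "orthogonal (Susp H Z) W" if "W \<in> \<Y>" "\<forall>Y\<in>\<Y>. orthogonal Z Y" for W
      using desusp[OF that(1)] orthogonal_shift[OF h(1,2)] that(2) by blast
    moreover have "orthogonal Z W" if "W \<in> \<Y>" "\<forall>Y\<in>\<Y>. orthogonal (Susp H Z) Y" for W
      using susp[OF that(1)] orthogonal_shift[OF h(1,2) hull(1,2)] that Y by blast
    ultimately show ?thesis using Z h(4) by blast
  qed
  have zero: "Z \<in> ?L" if "is_zero_object T Z" for Z
  proof -
    have Z: "Z \<in> Obj E" using that by (simp add: is_zero_object_def)
    have "null f" if W: "W \<in> \<Y>" and f: "\<guillemotleft>f : Z \<rightarrow> W\<guillemotright>" for f W
    proof -
      have W': "W \<in> Obj E" using W Y by blast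
      have "\<exists>!F. F \<in> Hom T Z W" using \<open>is_zero_object T Z\<close> W' by (simp add: is_zero_object_def)
      then have "stable_class E (Zero E Z W) = stable_class E f"
        using stable_class_in_Hom[OF f] stable_class_in_Hom[OF Zero_in_hom[OF Z W']] by auto
      then obtain t where "null t" "\<guillemotleft>t : Z \<rightarrow> W\<guillemotright>" "f = Zero E Z W \<boxplus> t"
        using stable_class_eq_iff[OF Zero_in_hom[OF Z W']] stable_relE[OF _ Zero_in_hom[OF Z W']] by metis
      then show ?thesis by (simp add: in_hom_iff)
    qed
    then show ?thesis using Z by (auto simp: orthogonal_def)
  qed
  have cone: "Z \<in> ?L" if XY: "X \<in> ?L" "Y \<in> ?L" and Z: "Z \<in> Obj T"
    and tri: "U \<in> Hom T X Y" "V \<in> Hom T Y Z" "(U, V, W) \<in> Tri T" for X Y Z U V W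
  proof -
    obtain X' u Y' v Z' where c: "conflation E X' u Y' v Z'"
      and i: "stably_iso X' X" "stably_iso Y' Y" "stably_iso Z' Z"
      by (rule triangle_from_conflation[OF tri(3) _ _ _ tri(1,2)]) (use XY Z in auto)
    have X': "X' \<in> ?L" and Y': "Y' \<in> ?L" using iso XY i stably_iso_sym by blast+
    have obj: "X' \<in> Obj E" "Z' \<in> Obj E" using c by (simp_all add: conflation_def)
    have "Susp H X' \<in> ?L" using X' shift obj by blast
    then have "Z' \<in> ?L" using orthogonal_cone[OF c hull(1,2)[OF obj(1)]] Y' obj by blast
    then show ?thesis using iso i by blast
  qed
  have coprod: "Q \<in> ?L" if Q: "is_coproduct T I X Q \<iota>" and X: "\<forall>i\<in>I. X i \<in> ?L"
    for I :: "'m set set" and X Q \<iota>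
  proof -
    have Qo: "Q \<in> Obj E" using Q by (simp add: is_coproduct_def)
    have "null f" if W: "W \<in> \<Y>" and f: "\<guillemotleft>f : Q \<rightarrow> W\<guillemotright>" for f W
    proof -
      have W': "W \<in> Obj E" using W Y by blast
      note z = Zero_in_hom[OF Qo W']
      have comp: "stable_class E g \<cdot>\<^bsub>T\<^esub> \<iota> i = stable_class E (Zero E (X i) W)"
        if i: "i \<in> I" and g: "\<guillemotleft>g : Q \<rightarrow> W\<guillemotright>" for i g
      proof -
        have Xi: "X i \<in> Obj E" "\<iota> i \<in> Hom T (X i) Q" using Q i by (auto simp: is_coproduct_def)
        then obtain j where j: "\<guillemotleft>j : X i \<rightarrow> Q\<guillemotright>" "\<iota> i = stable_class E j"
          using Qo by (auto elim!: Hom_stableE)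
        note gj = Comp_in_hom[OF j(1) g]
        have "null (g \<cdot> j)" using X i W gj by (auto simp: orthogonal_def)
        then have "(Zero E (X i) W, g \<cdot> j) \<in> stable_rel E"
          using stable_relI[OF Zero_in_hom[OF Xi(1) W'] gj] gj by (simp add: in_hom_iff)
        then show ?thesis
          using stable_class_eq_iff[OF Zero_in_hom[OF Xi(1) W'], of "g \<cdot> j"] Comp_stable[OF j(1) g] j(2)
          by simp
      qed
      have zeros: "\<forall>i\<in>I. stable_class E (Zero E (X i) W) \<in> Hom T (X i) W"
        using Q W' stable_class_in_Hom[OF Zero_in_hom] by (auto simp: is_coproduct_def)
      have univ: "\<forall>F. (\<forall>i\<in>I. F i \<in> Hom T (X i) W) \<longrightarrow>
          (\<exists>!G. G \<in> Hom T Q W \<and> (\<forall>i\<in>I. G \<cdot>\<^bsub>T\<^esub> \<iota> i = F i))"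
        using Q W' by (simp add: is_coproduct_def)
      have "\<exists>!G. G \<in> Hom T Q W \<and> (\<forall>i\<in>I. G \<cdot>\<^bsub>T\<^esub> \<iota> i = stable_class E (Zero E (X i) W))"
        by (rule mp[OF univ[THEN spec, of "\<lambda>i. stable_class E (Zero E (X i) W)"] zeros])
      moreover have "stable_class E g \<in> Hom T Q W \<and>
          (\<forall>i\<in>I. stable_class E g \<cdot>\<^bsub>T\<^esub> \<iota> i = stable_class E (Zero E (X i) W))"
        if "\<guillemotleft>g : Q \<rightarrow> W\<guillemotright>" for g
        using comp that stable_class_in_Hom[OF that] by simp
      ultimately have "stable_class E (Zero E Q W) = stable_class E f"
        using f z by blast
      then obtain t where "null t" "\<guillemotleft>t : Q \<rightarrow> W\<guillemotright>" "f = Zero E Q W \<boxplus> t"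
        using stable_class_eq_iff[OF z] stable_relE[OF _ z] by metis
      then show ?thesis by (simp add: in_hom_iff)
    qed
    then show ?thesis using Qo by (auto simp: orthogonal_def)
  qed
  show ?thesis
    unfolding localizing_subcategory_def triangulated_subcategory_def
  proof (intro conjI allI impI ballI)
    fix X Z assume X: "X \<in> ?L" and Z: "Z \<in> Obj T" "isomorphic T X Z"
    then have "stably_iso X Z" using isomorphic_stable[of X Z] by simp
    then show "Z \<in> ?L" using iso[OF X] by blast
  next
    show "?L \<subseteq> Obj T" by auto
  next
    fix Z assume "is_zero_object T Z"
    then show "Z \<in> ?L" by (rule zero)
  next
    fix Z assume "Z \<in> Obj T"
    then show "Z \<in> ?L \<longleftrightarrow> ShO T Z \<in> ?L" using shift[of Z] unfolding T_simps by blast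
  next
    fix X Y Z U V W
    assume "X \<in> ?L" "Y \<in> ?L" "Z \<in> Obj T" "U \<in> Hom T X Y" "V \<in> Hom T Y Z" "(U, V, W) \<in> Tri T"
    then show "Z \<in> ?L" by (rule cone)
  next
    fix I :: "'m set set" and X Q \<iota>
    assume "is_coproduct T I X Q \<iota> \<and> (\<forall>i\<in>I. X i \<in> ?L)"
    then show "Q \<in> ?L" using coprod[of I X Q \<iota>] by blast
  qed
qed

end

section \<open>Special preenvelopes\<close>

text \<open>
  The localizing closure is an intersection; that it consists of objects of \<open>T\<close> follows from the
  localizing subcategory \<open>L\<close>, which keeps the intersected family nonempty.
\<close>

lemma (in frobenius_hulls) triangulated_localizing_closure:
  assumes L: "localizing_subcategory T L" "R \<subseteq> L"
  shows "triangulated_subcategory T (localizing_closure T R)"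
    and "R \<subseteq> localizing_closure T R" and "localizing_closure T R \<subseteq> L"
proof -
  show "R \<subseteq> localizing_closure T R" and sub: "localizing_closure T R \<subseteq> L"
    using L unfolding localizing_closure_def by blast+
  have tri: "triangulated_subcategory T S" if "localizing_subcategory T S" for S
    using that by (simp add: localizing_subcategory_def)
  show "triangulated_subcategory T (localizing_closure T R)"
    unfolding triangulated_subcategory_def
  proof (intro conjI allI impI ballI)
    show "localizing_closure T R \<subseteq> Obj T"
      using sub tri[OF L(1)] unfolding triangulated_subcategory_def by blast
  next
    fix Z assume "is_zero_object T Z"
    then show "Z \<in> localizing_closure T R"
      using tri unfolding triangulated_subcategory_def localizing_closure_def by blast
  next
    fix X Y assume "X \<in> localizing_closure T R" "Y \<in> Obj T" "isomorphic T X Y"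
    then show "Y \<in> localizing_closure T R"
      using tri unfolding triangulated_subcategory_def localizing_closure_def by blast
  next
    fix X assume "X \<in> Obj T"
    then show "X \<in> localizing_closure T R \<longleftrightarrow> ShO T X \<in> localizing_closure T R"
      using tri unfolding triangulated_subcategory_def localizing_closure_def by blast
  next
    fix X Y Z u v w
    assume *: "X \<in> localizing_closure T R" "Y \<in> localizing_closure T R" "Z \<in> Obj T"
      "u \<in> Hom T X Y" "v \<in> Hom T Y Z" "w \<in> Hom T Z (ShO T X)" "(u, v, w) \<in> Tri T"
    show "Z \<in> localizing_closure T R"
      unfolding localizing_closure_def
    proof
      fix S assume "S \<in> {S. localizing_subcategory T S \<and> R \<subseteq> S}"
      then have "triangulated_subcategory T S" "X \<in> S" "Y \<in> S"
        using tri * unfolding localizing_closure_def by blast+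
      then show "Z \<in> S" using *(3-7) unfolding triangulated_subcategory_def by blast
    qed
  qed
qed

text \<open>
  Only cones are closed in by definition. Extensions reduce to them by rotating the triangle with
  \<open>extension_is_cone\<close>, and for \<open>K = A[-1]\<close> one has \<open>K[1] = A\<close> in the stable category because cokernels
  of inflations of \<open>K\<close> into injective objects are stably isomorphic.
\<close>

lemma (in frobenius_hulls) triangulated_subcategoryD:
  assumes S: "triangulated_subcategory T S"
  shows triangulated_Obj: "A \<in> S \<Longrightarrow> A \<in> Obj E"
    and triangulated_stably_iso: "\<lbrakk>A \<in> S; stably_iso A B\<rbrakk> \<Longrightarrow> B \<in> S"
    and triangulated_Susp: "A \<in> S \<Longrightarrow> Susp H A \<in> S"
    and triangulated_cocone: "\<lbrakk>conflation E K \<kappa> P \<pi> A; is_injective E P; A \<in> S\<rbrakk> \<Longrightarrow> K \<in> S"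
    and triangulated_extension: "\<lbrakk>conflation E A x N d D; A \<in> S; D \<in> S\<rbrakk> \<Longrightarrow> N \<in> S"
proof -
  show obj: "A \<in> Obj E" if "A \<in> S" for A
    using S that unfolding triangulated_subcategory_def T_simps by blast
  show iso: "B \<in> S" if "A \<in> S" "stably_iso A B" for A B
  proof -
    have "B \<in> Obj E" using that(2) unfolding stably_iso_def in_hom_def by blast
    then have "B \<in> Obj T" "isomorphic T A B" using isomorphic_stable[OF obj[OF that(1)]] that(2) by simp_all
    then show ?thesis using S that(1) unfolding triangulated_subcategory_def by blast
  qed
  have shift: "A \<in> S \<longleftrightarrow> Susp H A \<in> S" if "A \<in> Obj E" for A
    using S that unfolding triangulated_subcategory_def T_simps by blast
  show "Susp H A \<in> S" if "A \<in> S" for A using shift obj that by blast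
  show desusp: "K \<in> S" if c: "conflation E K \<kappa> P \<pi> A" "is_injective E P" and A: "A \<in> S" for K \<kappa> P \<pi> A
  proof -
    have K: "K \<in> Obj E" using c by (simp add: conflation_def)
    show ?thesis using iso[OF A cokernels_stably_iso[OF c hull(1,2)[OF K]]] shift[OF K] by blast
  qed
  show "N \<in> S" if c: "conflation E A x N d D" and A: "A \<in> S" and D: "D \<in> S" for A x N d D
  proof -
    obtain K \<kappa> P \<pi> where P: "is_injective E P" "conflation E K \<kappa> P \<pi> D"
      using ex_projective_conflation[OF obj[OF D]] .
    obtain W u v where W: "conflation E K u W v N" "stably_iso A W"
      using extension_is_cone[OF c P(2,1)] .
    have KW: "K \<in> S" "W \<in> S" and N: "N \<in> Obj T"
      using desusp[OF P(2,1) D] iso[OF A W(2)] W(1) by (auto simp: conflation_def)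
    show ?thesis
      using conflation_gives_triangle[OF W(1)] S KW N unfolding triangulated_subcategory_def by metis
  qed
qed

locale shifted_class = frobenius_hulls E H
  for E :: "('o, 'm, 'z) exactcat_scheme" (structure) and H :: "('o, 'm) hulls" +
  fixes R :: "'o set"
  assumes R_Obj: "R \<subseteq> Obj E"
    and R_shift: "Q \<in> R \<Longrightarrow> \<exists>Q'\<in>R. stably_iso (Susp H Q) Q'"
    and R_unshift: "Q \<in> R \<Longrightarrow> \<exists>Q'\<in>R. stably_iso (Susp H Q') Q"
    and R_Inj: "Q \<in> R \<Longrightarrow> Inj H Q \<in> R"
begin

definition R_perp :: "'o set" where
  "R_perp = {Y \<in> Obj E. \<forall>Q\<in>R. orthogonal Q Y}"

text \<open>
  In the stable category such a conflation is a triangle \<open>D[-1] \<rightarrow> X \<rightarrow> Y \<rightarrow> D\<close>, whose first arrow is going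
  to be the coreflection of \<open>X\<close> in \<open>S\<close>.
\<close>

definition special_preenvelope :: "'o set \<Rightarrow> 'o \<Rightarrow> bool" where
  "special_preenvelope S X \<longleftrightarrow> (\<exists>x Y v D. conflation E X x Y v D \<and> Y \<in> R_perp \<and> D \<in> S)"

lemma R_perp_Susp:
  assumes Y: "Y \<in> R_perp" shows "Susp H Y \<in> R_perp"
proof -
  have Yo: "Y \<in> Obj E" using Y by (simp add: R_perp_def)
  have "orthogonal Q (Susp H Y)" if Q: "Q \<in> R" for Q
  proof -
    obtain Q' where Q': "Q' \<in> R" "stably_iso (Susp H Q') Q" using R_unshift[OF Q] by blast
    then have "Q' \<in> Obj E" using R_Obj by blast
    then have "orthogonal (Susp H Q') (Susp H Y)"
      using orthogonal_shift[OF hull(1,2) hull(1,2)[OF Yo], of Q'] Y Q'(1) by (simp add: R_perp_def)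
    then show ?thesis using orthogonal_stably_iso Q'(2) by blast
  qed
  then show ?thesis using hull(4)[OF Yo] by (simp add: R_perp_def)
qed

lemma R_perp_desusp:
  assumes Y: "Y \<in> R_perp" and c: "conflation E K \<kappa> P \<pi> Y" "is_injective E P"
  shows "K \<in> R_perp"
proof -
  have "orthogonal Q K" if Q: "Q \<in> R" for Q
  proof -
    obtain Q' where Q': "Q' \<in> R" "stably_iso (Susp H Q) Q'" using R_shift[OF Q] by blast
    have "orthogonal (Susp H Q) Y"
      using orthogonal_stably_iso[OF _ stably_iso_sym[OF Q'(2)]] Y Q'(1) by (simp add: R_perp_def)
    then show ?thesis using orthogonal_shift[OF hull(1,2) c, of Q] R_Obj Q by blast
  qed
  then show ?thesis using c by (simp add: R_perp_def conflation_def)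
qed

lemma localizing_left_orthogonal_R_perp:
  "localizing_subcategory T {Z \<in> Obj E. \<forall>Y\<in>R_perp. orthogonal Z Y}"
proof (rule localizing_left_orthogonal)
  show "\<exists>K \<kappa> P \<pi>. conflation E K \<kappa> P \<pi> Y \<and> is_injective E P \<and> K \<in> R_perp" if "Y \<in> R_perp" for Y
    using ex_projective_conflation[of Y] R_perp_desusp[OF that] that
    by (metis (no_types, lifting) R_perp_def mem_Collect_eq)
qed (auto simp: R_perp_Susp, simp add: R_perp_def)

lemma special_preenvelope_R:
  assumes "Q \<in> R" "Susp H Q \<in> S"
  shows "special_preenvelope S Q"
proof -
  have Q: "Q \<in> Obj E" using assms R_Obj by blast
  have "null f" if f: "\<guillemotleft>f : Z \<rightarrow> Inj H Q\<guillemotright>" for f Z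
    using nullI[OF hull(2)[OF Q] f Ident_in_hom[OF hull(3)[OF Q]]] f by (simp add: in_hom_iff)
  then have "Inj H Q \<in> R_perp" using hull(3)[OF Q] by (simp add: R_perp_def orthogonal_def)
  then show ?thesis using hull(1)[OF Q] assms(2) unfolding special_preenvelope_def by blast
qed

text \<open>
  If \<open>K \<rightarrow> Y \<rightarrow> D\<close> is a special preenvelope of \<open>K\<close>, the cone of \<open>q : N \<rightarrow> X\<close> is one of \<open>X\<close>, where \<open>N\<close>
  is the pushout of \<open>Y\<close> and \<open>B\<close> over \<open>K\<close>. To test it against \<open>Q\<close> in \<open>R\<close>, write \<open>Q = A[1]\<close> and
  \<open>A = A'[1]\<close> in the stable category with \<open>A\<close> and \<open>A'\<close> in \<open>R\<close>: the two chases lift arrows along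
  \<open>I(A) \<rightarrow> A[1]\<close> and \<open>I(A') \<rightarrow> A'[1]\<close>.
\<close>

lemma special_preenvelope_step:
  assumes S: "triangulated_subcategory T S" "R \<subseteq> S"
    and p: "precover E R B p X" and k: "is_kernel E K k B p X"
    and K: "special_preenvelope S K"
  shows "special_preenvelope S X"
proof -
  note kD = kernelD[OF k]
  have B: "B \<in> R" and lift: "\<And>Q f. \<lbrakk>Q \<in> R; \<guillemotleft>f : Q \<rightarrow> X\<guillemotright>\<rbrakk> \<Longrightarrow> \<exists>g. \<guillemotleft>g : Q \<rightarrow> B\<guillemotright> \<and> p \<cdot> g = f"
    using p kD unfolding precover_def in_hom_def by blast+
  obtain x Y v D where x: "conflation E K x Y v D" and Y: "Y \<in> R_perp" and D: "D \<in> S"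
    using K unfolding special_preenvelope_def by blast
  note xD = conflationD[OF x]
  obtain N x' k' d where x': "conflation E B x' N d D" and k': "\<guillemotleft>k' : Y \<rightarrow> N\<guillemotright>" "k' \<cdot> x = x' \<cdot> k" "d \<cdot> k' = v"
    and desc: "\<And>Z s t. \<lbrakk>\<guillemotleft>s : Y \<rightarrow> Z\<guillemotright>; \<guillemotleft>t : B \<rightarrow> Z\<guillemotright>; s \<cdot> x = t \<cdot> k\<rbrakk> \<Longrightarrow>
      \<exists>h. \<guillemotleft>h : N \<rightarrow> Z\<guillemotright> \<and> h \<cdot> k' = s \<and> h \<cdot> x' = t"
    using conflation_pushout[OF x kD(1)] by metis
  note x'D = conflationD[OF x']
  obtain q where q: "\<guillemotleft>q : N \<rightarrow> X\<guillemotright>" "q \<cdot> k' = Zero E Y X" "q \<cdot> x' = p"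
    using desc[of "Zero E Y X" X p] xD kD by (auto simp: in_hom_iff)
  have NS: "N \<in> S" using triangulated_extension[OF S(1) x'] B D S(2) by blast
  have N: "N \<in> Obj E" using q by (simp add: in_hom_def)
  note h = hull[OF N]
  obtain Y' y q' c where y: "conflation E X y Y' c (Susp H N)"
    and q': "\<guillemotleft>q' : Inj H N \<rightarrow> Y'\<guillemotright>" "q' \<cdot> inj_arr H N = y \<cdot> q" "c \<cdot> q' = susp_arr H N"
    using conflation_pushout[OF h(1) q(1)] by metis
  have "orthogonal Q Y'" if Q: "Q \<in> R" for Q
  proof -
    obtain A where A: "A \<in> R" "stably_iso (Susp H A) Q" using R_unshift[OF Q] by blast
    have Ao: "A \<in> Obj E" using A R_Obj by blast
    note hA = hull[OF Ao]
    have "orthogonal (Susp H A) Y'"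
    proof (rule orthogonal_cone_of_lifting[OF q(1) x'D(1) h(1,2) y q' hA(1,2)])
      show "\<exists>g. \<guillemotleft>g : Inj H A \<rightarrow> B\<guillemotright> \<and> (q \<cdot> x') \<cdot> g = f" if "\<guillemotleft>f : Inj H A \<rightarrow> X\<guillemotright>" for f
        using lift[OF R_Inj[OF A(1)] that] q(3) by simp
      show "\<exists>g. \<guillemotleft>g : Susp H A \<rightarrow> B\<guillemotright> \<and> (q \<cdot> x') \<cdot> g = f" if "\<guillemotleft>f : Susp H A \<rightarrow> X\<guillemotright>" for f
        unfolding q(3)
        using lift_from_cokernel[OF hA(1,2) A(2) _ _ kD(2) that] lift[OF Q] lift[OF R_Inj[OF A(1)]]
        by blast
      show "null n" if n: "\<guillemotleft>n : A \<rightarrow> N\<guillemotright>" "q \<cdot> n = Zero E A X" for n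
      proof -
        obtain A' where A': "A' \<in> R" "stably_iso (Susp H A') A" using R_unshift[OF A(1)] by blast
        have A'o: "A' \<in> Obj E" using A' R_Obj by blast
        obtain f g t where *: "\<guillemotleft>f : A \<rightarrow> Susp H A'\<guillemotright>" "\<guillemotleft>g : Susp H A' \<rightarrow> A\<guillemotright>" "\<guillemotleft>t : A \<rightarrow> A\<guillemotright>" "null t"
          "Ident E A = g \<cdot> f \<boxplus> t" using stably_isoE[OF stably_iso_sym[OF A'(2)]] .
        have "orthogonal (Susp H A') Y"
          using orthogonal_stably_iso[OF _ stably_iso_sym[OF A'(2)]] Y A(1) by (simp add: R_perp_def)
        moreover have "q \<cdot> n \<cdot> g = Zero E (Susp H A') X"
          using n(1) q(1) *(2) by (simp add: in_hom_iff n(2)[THEN post])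
        ultimately have "null (n \<cdot> g)"
          using null_if_killed[OF x x' k' k q(1,3,2) hull(1,2)[OF A'o] _ Comp_in_hom[OF *(2) n(1)]]
          by blast
        then show ?thesis using null_if_precomposite[OF * n(1)] by blast
      qed
    qed
    then show ?thesis using orthogonal_stably_iso A(2) by blast
  qed
  then have "Y' \<in> R_perp" using y by (simp add: R_perp_def conflation_def)
  then show ?thesis
    using y triangulated_Susp[OF S(1) NS] unfolding special_preenvelope_def by blast
qed

lemma special_preenvelope_finite_dimension:
  assumes S: "triangulated_subcategory T S" "R \<subseteq> S" and X: "finite_dimension E R X"
  shows "special_preenvelope S X"
proof -
  obtain K Q p k d where res: "K 0 = X" "\<And>i. precover E R (Q i) (p i) (K i)"
      "\<And>i. is_kernel E (K (Suc i)) (k i) (Q i) (p i) (K i)" and d: "K d \<in> R"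
    using X unfolding finite_dimension_def is_resolution_def by blast
  have "special_preenvelope S (K 0)"
  proof (rule inc_induct[of 0 d "\<lambda>i. special_preenvelope S (K i)"])
    have "K d \<in> S" using d S(2) by blast
    then show "special_preenvelope S (K d)"
      using special_preenvelope_R[OF d] triangulated_Susp[OF S(1)] by blast
  next
    fix i assume "special_preenvelope S (K (Suc i))"
    then show "special_preenvelope S (K i)" by (rule special_preenvelope_step[OF S res(2,3)])
  qed simp
  then show ?thesis using res by simp
qed

lemma coreflection_from_special_preenvelope:
  assumes S: "triangulated_subcategory T S" "S \<subseteq> {Z \<in> Obj E. \<forall>Y\<in>R_perp. orthogonal Z Y}"
    and X: "special_preenvelope S X"
  shows "\<exists>K\<in>S. \<exists>e. stable.in_hom e K X \<and>
    (\<forall>Z\<in>S. \<forall>F. stable.in_hom F Z X \<longrightarrow> (\<exists>!G. stable.in_hom G Z K \<and> e \<cdot>\<^bsub>T\<^esub> G = F))"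
proof -
  obtain x Y v D where x: "conflation E X x Y v D" and Y: "Y \<in> R_perp" and D: "D \<in> S"
    using X unfolding special_preenvelope_def by blast
  have "D \<in> Obj E" using x by (simp add: conflation_def)
  then obtain K \<kappa> P \<pi> where P: "is_injective E P" and K: "conflation E K \<kappa> P \<pi> D"
    using ex_projective_conflation by metis
  have KS: "K \<in> S" using triangulated_cocone[OF S(1) K P D] .
  obtain \<epsilon> where \<epsilon>: "\<guillemotleft>\<epsilon> : K \<rightarrow> X\<guillemotright>"
    and ex: "\<And>Z f. \<lbrakk>orthogonal Z Y; \<guillemotleft>f : Z \<rightarrow> X\<guillemotright>\<rbrakk> \<Longrightarrow>
       \<exists>n t. \<guillemotleft>n : Z \<rightarrow> K\<guillemotright> \<and> \<guillemotleft>t : Z \<rightarrow> X\<guillemotright> \<and> null t \<and> f = \<epsilon> \<cdot> n \<boxplus> t"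
    and inj: "\<And>Z i J s M n. \<lbrakk>conflation E Z i J s M; is_injective E J; orthogonal M Y;
       \<guillemotleft>n : Z \<rightarrow> K\<guillemotright>; null (\<epsilon> \<cdot> n)\<rbrakk> \<Longrightarrow> null n"
    using fibre_coreflection[OF x K P] by metis
  have hom: "stable.in_hom F A B \<longleftrightarrow> (\<exists>f. \<guillemotleft>f : A \<rightarrow> B\<guillemotright> \<and> F = stable_class E f)" for F A B
  proof
    assume "stable.in_hom F A B"
    then show "\<exists>f. \<guillemotleft>f : A \<rightarrow> B\<guillemotright> \<and> F = stable_class E f"
      unfolding stable.in_hom_def by (auto elim!: Hom_stableE)
  next
    assume "\<exists>f. \<guillemotleft>f : A \<rightarrow> B\<guillemotright> \<and> F = stable_class E f"
    then show "stable.in_hom F A B"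
      using stable_class_in_Hom unfolding stable.in_hom_def by (auto simp: in_hom_def)
  qed
  have "\<exists>!G. stable.in_hom G Z K \<and> stable_class E \<epsilon> \<cdot>\<^bsub>T\<^esub> G = F"
    if Z: "Z \<in> S" and F: "stable.in_hom F Z X" for Z F
  proof -
    have orth: "orthogonal Z Y" "orthogonal (Susp H Z) Y" and Zo: "Z \<in> Obj E"
      using Z triangulated_Susp[OF S(1) Z] S(2) Y by auto
    obtain f where f: "\<guillemotleft>f : Z \<rightarrow> X\<guillemotright>" "F = stable_class E f" using F hom by blast
    show ?thesis
    proof (rule ex_ex1I)
      obtain n t where n: "\<guillemotleft>n : Z \<rightarrow> K\<guillemotright>" and t: "\<guillemotleft>t : Z \<rightarrow> X\<guillemotright>" "null t" "f = \<epsilon> \<cdot> n \<boxplus> t"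
        using ex[OF orth(1) f(1)] by blast
      have "stable_class E (\<epsilon> \<cdot> n) = F"
        unfolding f(2) stable_class_eq_iff[OF Comp_in_hom[OF n \<epsilon>]]
        using stable_relI[OF Comp_in_hom[OF n \<epsilon>] t(1,2)] t(3) by simp
      then show "\<exists>G. stable.in_hom G Z K \<and> stable_class E \<epsilon> \<cdot>\<^bsub>T\<^esub> G = F"
        using hom n Comp_stable[OF n \<epsilon>] by metis
    next
      fix G G' assume G: "stable.in_hom G Z K \<and> stable_class E \<epsilon> \<cdot>\<^bsub>T\<^esub> G = F"
        and G': "stable.in_hom G' Z K \<and> stable_class E \<epsilon> \<cdot>\<^bsub>T\<^esub> G' = F"
      obtain n n' where n: "\<guillemotleft>n : Z \<rightarrow> K\<guillemotright>" "G = stable_class E n"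
        and n': "\<guillemotleft>n' : Z \<rightarrow> K\<guillemotright>" "G' = stable_class E n'" using G G' hom by meson
      note en = Comp_in_hom[OF n(1) \<epsilon>]
      have "(\<epsilon> \<cdot> n, \<epsilon> \<cdot> n') \<in> stable_rel E"
        using G G' Comp_stable[OF n(1) \<epsilon>] Comp_stable[OF n'(1) \<epsilon>] stable_class_eq_iff[OF en, of "\<epsilon> \<cdot> n'"] n(2) n'(2)
        by simp
      then obtain t where t: "\<guillemotleft>t : Z \<rightarrow> X\<guillemotright>" "null t" "\<epsilon> \<cdot> n' = \<epsilon> \<cdot> n \<boxplus> t"
        using stable_relE[OF _ en] by blast
      obtain \<delta> where \<delta>: "\<guillemotleft>\<delta> : Z \<rightarrow> K\<guillemotright>" "n' = n \<boxplus> \<delta>" using difference_exists[OF n'(1) n(1)] .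
      have "\<epsilon> \<cdot> n \<boxplus> \<epsilon> \<cdot> \<delta> = \<epsilon> \<cdot> n \<boxplus> t"
        using \<epsilon> n(1) \<delta> t(3) by (simp add: in_hom_iff)
      then have "\<epsilon> \<cdot> \<delta> = t"
        by (rule Plus_left_cancel) (use \<epsilon> n(1) \<delta>(1) t(1) in \<open>simp_all add: in_hom_iff\<close>)
      then have "null \<delta>" using inj[OF hull(1,2)[OF Zo] orth(2) \<delta>(1)] t(2) by simp
      then show "G = G'"
        unfolding n(2) n'(2) stable_class_eq_iff[OF n(1)] \<delta>(2) using stable_relI[OF n(1) \<delta>(1)] by blast
    qed
  qed
  moreover have "stable.in_hom (stable_class E \<epsilon>) K X" using hom \<epsilon> by blast
  ultimately show ?thesis using KS by blast
qed

end

theorem theorem3p1: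
  fixes E :: "('o, 'm, 'z) exactcat_scheme"
    and H :: "('o, 'm) hulls"
    and R :: "'o set"
  assumes "frobenius_category E"
    and "injective_hulls E H"
    and "precovering E R"
    and "\<And>Q p X. precover E R Q p X \<Longrightarrow> \<exists>K k. is_kernel E K k Q p X"
    and "closed_under_shifts (stable_category E H) R"
    and "\<And>Q. Q \<in> R \<Longrightarrow> Inj H Q \<in> R"
    and "\<And>X. X \<in> Obj (stable_category E H) \<Longrightarrow> finite_dimension E R X"
  shows "has_right_adjoint
           (full_subcategory (stable_category E H) (localizing_closure (stable_category E H) R))
           (stable_category E H)
           inclusion_functor"
proof -
  interpret frobenius_hulls E H
    using assms(1,2) by (simp add: frobenius_hulls_def frobenius_hulls_axioms_def)
  have R: "R \<subseteq> Obj E" using assms(3) by (simp add: precovering_def)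
  interpret shifted_class E H R
  proof unfold_locales
    show "\<exists>Q'\<in>R. stably_iso (Susp H Q) Q'" "\<exists>Q'\<in>R. stably_iso (Susp H Q') Q" if "Q \<in> R" for Q
      using assms(5) that R isomorphic_stable hull(4) unfolding closed_under_shifts_def T_simps
      by (meson subset_iff)+
  qed (use R assms(6) in auto)
  let ?L = "{Z \<in> Obj E. \<forall>Y\<in>R_perp. orthogonal Z Y}"
  let ?S = "localizing_closure T R"
  have "R \<subseteq> ?L" using R by (auto simp: R_perp_def)
  note S = triangulated_localizing_closure[OF localizing_left_orthogonal_R_perp this]
  show ?thesis
  proof (rule stable.right_adjoint_of_inclusion)
    show "?S \<subseteq> Obj T" using triangulated_Obj[OF S(1)] by auto
    fix X assume "X \<in> Obj T"
    then have "special_preenvelope ?S X"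
      using special_preenvelope_finite_dimension[OF S(1,2)] assms(7) by blast
    then show "\<exists>K\<in>?S. \<exists>e. stable.in_hom e K X \<and>
        (\<forall>Z\<in>?S. \<forall>F. stable.in_hom F Z X \<longrightarrow> (\<exists>!G. stable.in_hom G Z K \<and> e \<cdot>\<^bsub>T\<^esub> G = F))"
      using coreflection_from_special_preenvelope[OF S(1,3)] by blast
  qed
qed

end
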